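(* Let $I=(\ell,r)\subset\mathbb R$ be a nonempty open interval (possibly with infinite endpoints), and let $b,\sigma:I\to\mathbb R$ be Borel functions satisfying $\sigma(x)\neq 0$ for all $x\in I$ and $\frac1{\sigma^2},\frac b{\sigma^2}\in L^1_{\mathrm{loc}}(I)$; set $a=\sigma^2/2$. Let $q:I\to\mathbb R$ be bounded and Borel, let $f:I\to\mathbb R$ be Borel, let $\gamma_\ell\in\mathbb R$ be prescribed if $s(\ell+)>-\infty$ and $\gamma_r\in\mathbb R$ be prescribed if $s(r-)<\infty$, and let $s$, $\mu$, $\xi$ be as defined in the context. Suppose that $f-\xi\in L^2(I,\mu)$ and $q\xi\in L^2(I,\mu)$. Then there exists a function $u:(0,\infty)\times I\to\mathbb R$ with the following properties. (i) For every $k\in\mathbb N_0$, $\partial_t^ku$ and $\partial_x\partial_t^ku$ exist on $(0,\infty)\times I$ and are jointly continuous there. (ii) For every $t>0$, $\partial_xu(t,\cdot)\in \mathrm{AC}_{\mathrm{loc}}(I)$, and for almost every $x\in I$, $$\partial_tu(t,x)=a(x)\,\partial_{xx}u(t,x)+b(x)\,\partial_xu(t,x)-q(x)\,u(t,x).$$ For every $k\in\mathbb N_0$, the same assertions hold with $u$ replaced by $\partial_t^ku$. (iii) If $a$, $b$, and $q$ are continuous on $I$, then $u\in C^{1,2}((0,\infty)\times I)$ and the equation in (ii) holds pointwise on $(0,\infty)\times I$; moreover, $\partial_t^ku\in C^{1,2}((0,\infty)\times I)$ for every $k\in\mathbb N_0$. Moreover, for every $t>0$, $u(t,\cdot)-\xi\in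 L^2(I,\mu)$, $$\lim_{x\downarrow\ell}u(t,x)=\gamma_\ell\quad\text{if }s(\ell+)>-\infty,\qquad \lim_{x\uparrow r}u(t,x)=\gamma_r\quad\text{if }s(r-)<\infty,$$ and $u(t,\cdot)-f\to0$ in $L^2(I,\mu)$ as $t\downarrow0$.
   Context: All functions are real-valued; $\mathbb N_0=\{0,1,2,\dots\}$; $\mathrm{AC}_{\mathrm{loc}}$ denotes locally absolutely continuous functions; $C^{1,2}$ means once continuously differentiable in $t$ and twice continuously differentiable in $x$ (with jointly continuous derivatives); "almost every" refers to Lebesgue measure. Fix $x_0\in I$ and set $\rho(x)=\exp\left(-\int_{x_0}^x\frac{b(z)}{a(z)}\,dz\right)$, $s(x)=\int_{x_0}^x\rho(z)\,dz$, $\mu(dx)=\frac{dx}{a(x)\rho(x)}$, and $J=s(I)=(\alpha,\beta)$, where $\alpha=s(\ell+)$ and $\beta=s(r-)$ may be infinite. The function $\xi:I\to\mathbb R$ is defined by - $\xi(x)=\gamma_\ell+(\gamma_r-\gamma_\ell)\frac{s(x)-\alpha}{\beta-\alpha}$ if $\alpha>-\infty$ and $\beta<\infty$; - $\xi(x)=\gamma_\ell$ if $\alpha>-\infty$ and $\beta=\infty$; - $\xi(x)=\gamma_r$ if $\alpha=-\infty$ and $\beta<\infty$; - $\xi(x)=0$ if $\alpha=-\infty$ and $\beta=\infty$. *)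

theory Defs
  imports "HOL-Analysis.Analysis"
begin

definition L1_loc_on :: "real set \<Rightarrow> (real \<Rightarrow> real) \<Rightarrow> bool" where
  "L1_loc_on I g \<longleftrightarrow> (\<forall>K. compact K \<and> K \<subseteq> I \<longrightarrow> set_integrable lborel K g)"

definition abs_continuous_on :: "real \<Rightarrow> real \<Rightarrow> (real \<Rightarrow> real) \<Rightarrow> bool" where
  "abs_continuous_on c d g \<longleftrightarrow>
     (\<forall>\<epsilon>>0. \<exists>\<delta>>0. \<forall>(n::nat) y z.
        (\<forall>i<n. c \<le> y i \<and> y i \<le> z i \<and> z i \<le> d) \<and>
        disjoint_family_on (\<lambda>i. {y i<..<z i}) {..<n} \<and>
        (\<Sum>i<n. z i - y i) < \<delta>
        \<longrightarrow> (\<Sum>i<n. \<bar>g (z i) - g (y i)\<bar>) < \<epsilon>)"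

definition AC_loc_on :: "real set \<Rightarrow> (real \<Rightarrow> real) \<Rightarrow> bool" where
  "AC_loc_on I g \<longleftrightarrow> (\<forall>c d. c \<le> d \<and> {c..d} \<subseteq> I \<longrightarrow> abs_continuous_on c d g)"

definition square_integrable :: "'a measure \<Rightarrow> ('a \<Rightarrow> real) \<Rightarrow> bool" where
  "square_integrable M g \<longleftrightarrow> g \<in> borel_measurable M \<and> integrable M (\<lambda>x. (g x)\<^sup>2)"

definition L2_norm_on :: "'a measure \<Rightarrow> ('a \<Rightarrow> real) \<Rightarrow> real" where
  "L2_norm_on M g = sqrt (\<integral>x. (g x)\<^sup>2 \<partial>M)"

text \<open>The membership clause is needed because the Bochner integral of a
  non-integrable function is 0.\<close>
definition tendsto_zero_L2 :: "'a measure \<Rightarrow> ('b \<Rightarrow> 'a \<Rightarrow> real) \<Rightarrow> 'b filter \<Rightarrow> bool" where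
  "tendsto_zero_L2 M g F \<longleftrightarrow>
     (\<forall>\<^sub>F t in F. square_integrable M (g t)) \<and> ((\<lambda>t. L2_norm_on M (g t)) \<longlongrightarrow> 0) F"

definition rho :: "(real \<Rightarrow> real) \<Rightarrow> (real \<Rightarrow> real) \<Rightarrow> real \<Rightarrow> real \<Rightarrow> real" where
  "rho a b x0 x = exp (- (LBINT z=ereal x0..ereal x. b z / a z))"

definition scale_fun :: "(real \<Rightarrow> real) \<Rightarrow> (real \<Rightarrow> real) \<Rightarrow> real \<Rightarrow> real \<Rightarrow> real" where
  "scale_fun a b x0 x = (LBINT z=ereal x0..ereal x. rho a b x0 z)"

definition speed_measure ::
  "real set \<Rightarrow> (real \<Rightarrow> real) \<Rightarrow> (real \<Rightarrow> real) \<Rightarrow> real \<Rightarrow> real measure" where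
  "speed_measure I a b x0 =
     density (restrict_space lborel I) (\<lambda>x. ennreal (1 / (a x * rho a b x0 x)))"

text \<open>One-sided limits at a possibly infinite endpoint are taken along the ereal filters
  \<open>at_right l\<close> and \<open>at_left r\<close>, as in the library's treatment of improper integrals;
  \<open>s(l+)\<close> and \<open>s(r-)\<close> are extended-real-valued.\<close>
definition lim_left_end :: "ereal \<Rightarrow> (real \<Rightarrow> real) \<Rightarrow> ereal" where
  "lim_left_end l g = Lim (at_right l) (\<lambda>y. ereal (g (real_of_ereal y)))"

definition lim_right_end :: "ereal \<Rightarrow> (real \<Rightarrow> real) \<Rightarrow> ereal" where
  "lim_right_end r g = Lim (at_left r) (\<lambda>y. ereal (g (real_of_ereal y)))"

definition xi_fun ::
  "(real \<Rightarrow> real) \<Rightarrow> ereal \<Rightarrow> ereal \<Rightarrow> real \<Rightarrow> real \<Rightarrow> real \<Rightarrow> real" where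
  "xi_fun s \<alpha> \<beta> \<gamma>l \<gamma>r x =
     (if \<alpha> > -\<infinity> \<and> \<beta> < \<infinity>
        then \<gamma>l + (\<gamma>r - \<gamma>l) * ((s x - real_of_ereal \<alpha>) / (real_of_ereal \<beta> - real_of_ereal \<alpha>))
      else if \<alpha> > -\<infinity> then \<gamma>l
      else if \<beta> < \<infinity> then \<gamma>r
      else 0)"

text \<open>Functions on \<open>(0,\<infinity>) \<times> I\<close> are represented by total curried functions. As the domain
  is open, derivatives at its points do not depend on the values outside.\<close>
definition dt :: "(real \<Rightarrow> real \<Rightarrow> real) \<Rightarrow> real \<Rightarrow> real \<Rightarrow> real" where
  "dt v = (\<lambda>t x. deriv (\<lambda>\<tau>. v \<tau> x) t)"

definition dx :: "(real \<Rightarrow> real \<Rightarrow> real) \<Rightarrow> real \<Rightarrow> real \<Rightarrow> real" where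
  "dx v = (\<lambda>t x. deriv (\<lambda>y. v t y) x)"

definition dt_exists :: "real set \<Rightarrow> (real \<Rightarrow> real \<Rightarrow> real) \<Rightarrow> bool" where
  "dt_exists I v \<longleftrightarrow> (\<forall>t>0. \<forall>x\<in>I. (\<lambda>\<tau>. v \<tau> x) field_differentiable (at t))"

definition dx_exists :: "real set \<Rightarrow> (real \<Rightarrow> real \<Rightarrow> real) \<Rightarrow> bool" where
  "dx_exists I v \<longleftrightarrow> (\<forall>t>0. \<forall>x\<in>I. (\<lambda>y. v t y) field_differentiable (at x))"

definition jointly_continuous :: "real set \<Rightarrow> (real \<Rightarrow> real \<Rightarrow> real) \<Rightarrow> bool" where
  "jointly_continuous I v \<longleftrightarrow> continuous_on ({0<..} \<times> I) (\<lambda>(t, x). v t x)"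

definition C12 :: "real set \<Rightarrow> (real \<Rightarrow> real \<Rightarrow> real) \<Rightarrow> bool" where
  "C12 I v \<longleftrightarrow>
     dt_exists I v \<and> dx_exists I v \<and> dx_exists I (dx v) \<and>
     jointly_continuous I v \<and> jointly_continuous I (dt v) \<and>
     jointly_continuous I (dx v) \<and> jointly_continuous I (dx (dx v))"

definition pde_at ::
  "(real \<Rightarrow> real) \<Rightarrow> (real \<Rightarrow> real) \<Rightarrow> (real \<Rightarrow> real) \<Rightarrow> (real \<Rightarrow> real \<Rightarrow> real)
    \<Rightarrow> real \<Rightarrow> real \<Rightarrow> bool" where
  "pde_at a b q v t x \<longleftrightarrow>
     dt v t x = a x * dx (dx v) t x + b x * dx v t x - q x * v t x"

text \<open>Existence of the second space derivative at almost every point is part of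
  the assertion that the equation holds almost everywhere.\<close>
definition pde_ae ::
  "real set \<Rightarrow> (real \<Rightarrow> real) \<Rightarrow> (real \<Rightarrow> real) \<Rightarrow> (real \<Rightarrow> real)
    \<Rightarrow> (real \<Rightarrow> real \<Rightarrow> real) \<Rightarrow> bool" where
  "pde_ae I a b q v \<longleftrightarrow>
     (\<forall>t>0. AC_loc_on I (dx v t) \<and>
        (AE x in lborel. x \<in> I \<longrightarrow>
           dx v t field_differentiable (at x) \<and> pde_at a b q v t x))"

end

theory Submission
  imports Defs "HOL-Library.Function_Algebras" "HOL-Computational_Algebra.Polynomial"
begin

text \<open>
  Write \<open>u = \<xi> + v\<close>. Since \<open>a \<xi>'' + b \<xi>' = 0\<close>, the function \<open>v\<close> must solve \<open>v' = A v - q \<xi>\<close> with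
  \<open>v(0) = f - \<xi>\<close>, where \<open>A\<close> is the self-adjoint realisation of \<open>a D\<^sup>2 + b D - q\<close> in \<open>L\<^sup>2(\<mu>)\<close> with zero
  boundary values at the ends where \<open>s\<close> stays bounded. For large \<open>L\<close> the resolvent \<open>R = (L - A)\<^sup>-\<^sup>1\<close> comes from
  the Riesz representation theorem for the energy form of \<open>L - A\<close>; it is a positive symmetric contraction,
  and \<open>R g\<close> and the flux \<open>(R g)' / \<rho>\<close> are bounded by the norm of \<open>g\<close>, locally uniformly on \<open>I\<close>.
  In terms of \<open>R\<close> the semigroup is \<open>exp (t (L - 1/r))\<close> evaluated at \<open>r = R\<close>, which is
  defined by a continuous functional calculus on \<open>[0, 1]\<close>. For \<open>t > 0\<close> this function and all its time
  derivatives are divisible by \<open>r\<close>, so \<open>v\<close> and its time derivatives are of the form \<open>R (Y t)\<close> with \<open>Y\<close> smooth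
  in \<open>L\<^sup>2(\<mu>)\<close>, and the pointwise bounds on \<open>R g\<close> and its flux turn this into joint regularity.
\<close>

section \<open>Functional calculus for a positive contraction\<close>

text \<open>The conclusion speaks of values, derivatives and limits at every point, so elements of
  the Hilbert spaces stay honest functions, not classes modulo null functions. Inner products are
  then only semidefinite, and identities of the calculus hold up to norm zero; the pointwise bounds
  for \<open>R\<close> erase the ambiguity, since \<open>R\<close> sends a vector of norm zero to a
  function vanishing on \<open>I\<close>. With merely measurable coefficients second derivatives
  exist only almost everywhere, so the equation is carried in integrated form for the flux
  \<open>v' / \<rho>\<close>, which is absolutely continuous. Duhamel's formula reads \<open>v(t) =
  exp(t A) g - (integral of exp(\<tau> A) h over [0, t])\<close> with \<open>g = f - \<xi>\<close>
  and \<open>h = q \<xi>\<close>. As \<open>h\<close> is only known to lie in L2, the integral gets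
  a scalar function of its own, which tends to 1 at \<open>r = 0\<close>. If \<open>Q\<close> bounds
  the absolute value of \<open>q\<close>, then \<open>L = Q + 1\<close> gives
  \<open>q + L \<ge> 1\<close>, so the energy form dominates the norm and \<open>R\<close> lies
  between 0 and 1. Time derivatives come from Taylor estimates of scalar functions, uniform in
  \<open>r\<close>, which the calculus turns into norm estimates.\<close>

instantiation "fun" :: (type, real_vector) real_vector
begin

definition "c *\<^sub>R f = (\<lambda>x. c *\<^sub>R f x)"

instance
  by standard (auto simp: scaleR_fun_def scaleR_add_right scaleR_add_left)

end

lemma scaleR_fun_apply [simp]: "(c *\<^sub>R f) x = c *\<^sub>R f x"
  by (simp add: scaleR_fun_def)

text \<open>The form is only semidefinite, so completeness provides a limit that is determined up to
  a vector of norm zero. The instances are spaces of square integrable functions and the domain of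
  the energy form.\<close>

locale semi_hilbert =
  fixes S :: "'v::real_vector set" and ip :: "'v \<Rightarrow> 'v \<Rightarrow> real"
  assumes subspace_S: "subspace S"
    and ip_add: "\<And>x y z. x \<in> S \<Longrightarrow> y \<in> S \<Longrightarrow> z \<in> S \<Longrightarrow> ip (x + y) z = ip x z + ip y z"
    and ip_scale: "\<And>x z c. x \<in> S \<Longrightarrow> z \<in> S \<Longrightarrow> ip (c *\<^sub>R x) z = c * ip x z"
    and ip_sym: "\<And>x y. x \<in> S \<Longrightarrow> y \<in> S \<Longrightarrow> ip x y = ip y x"
    and ip_nonneg: "\<And>x. x \<in> S \<Longrightarrow> 0 \<le> ip x x"
    and complete: "\<And>X. (\<And>n::nat. X n \<in> S) \<Longrightarrow>
          (\<And>e. e > 0 \<Longrightarrow> \<exists>N. \<forall>m\<ge>N. \<forall>n\<ge>N. ip (X m - X n) (X m - X n) < e) \<Longrightarrow>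
          \<exists>x\<in>S. (\<lambda>n. ip (X n - x) (X n - x)) \<longlonglongrightarrow> 0"
begin

definition nrm :: "'v \<Rightarrow> real" where "nrm x = sqrt (ip x x)"

lemma S_add [intro]: "x \<in> S \<Longrightarrow> y \<in> S \<Longrightarrow> x + y \<in> S"
  and S_scale [intro]: "x \<in> S \<Longrightarrow> c *\<^sub>R x \<in> S"
  and S_zero [intro, simp]: "0 \<in> S"
  and S_diff [intro]: "x \<in> S \<Longrightarrow> y \<in> S \<Longrightarrow> x - y \<in> S"
  using subspace_S by (auto simp: subspace_add subspace_scale subspace_0 subspace_diff)

lemma ip_add_right: "x \<in> S \<Longrightarrow> y \<in> S \<Longrightarrow> z \<in> S \<Longrightarrow> ip z (x + y) = ip z x + ip z y"
  by (metis S_add ip_add ip_sym)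

lemma ip_scale_right: "x \<in> S \<Longrightarrow> z \<in> S \<Longrightarrow> ip z (c *\<^sub>R x) = c * ip z x"
  by (metis S_scale ip_scale ip_sym)

lemma ip_diff: "x \<in> S \<Longrightarrow> y \<in> S \<Longrightarrow> z \<in> S \<Longrightarrow> ip (x - y) z = ip x z - ip y z"
  using ip_add[of x "(-1) *\<^sub>R y" z] ip_scale[of y z "-1"] S_scale[of y "-1"] by simp

lemma ip_diff_right: "x \<in> S \<Longrightarrow> y \<in> S \<Longrightarrow> z \<in> S \<Longrightarrow> ip z (x - y) = ip z x - ip z y"
  by (metis S_diff ip_diff ip_sym)

lemmas ip_simps = ip_add ip_add_right ip_scale ip_scale_right ip_diff ip_diff_right

lemma nrm_nonneg [simp]: "x \<in> S \<Longrightarrow> 0 \<le> nrm x"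
  by (simp add: nrm_def ip_nonneg)

lemma nrm_sq: "x \<in> S \<Longrightarrow> (nrm x)\<^sup>2 = ip x x"
  by (simp add: nrm_def ip_nonneg)

lemma Cauchy_Schwarz_sq:
  assumes x: "x \<in> S" and y: "y \<in> S"
  shows "(ip x y)\<^sup>2 \<le> ip x x * ip y y"
proof -
  have q: "0 \<le> ip x x + 2 * t * ip x y + t\<^sup>2 * ip y y" for t
  proof -
    have "0 \<le> ip (x + t *\<^sub>R y) (x + t *\<^sub>R y)"
      using x y by (intro ip_nonneg) auto
    also have "\<dots> = ip x x + 2 * t * ip x y + t\<^sup>2 * ip y y"
      using x y by (simp add: ip_simps S_add S_scale ip_sym[of y x] power2_eq_square algebra_simps)
    finally show ?thesis .
  qed
  show ?thesis
  proof (cases "ip y y = 0")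
    case True
    have "ip x y = 0"
    proof (rule ccontr)
      assume "ip x y \<noteq> 0"
      \<comment> \<open>The form degenerates at \<open>y\<close>, so the quadratic in
        \<open>t\<close> is affine; at this \<open>t\<close> its value is -1.\<close>
      then show False
        using q[of "- (ip x x + 1) / (2 * ip x y)"] True by (simp add: field_simps)
    qed
    then show ?thesis using True by simp
  next
    case False
    then have "ip y y > 0" using ip_nonneg[OF y] by simp
    then show ?thesis using q[of "- ip x y / ip y y"]
      by (simp add: field_simps power2_eq_square)
  qed
qed

lemma Cauchy_Schwarz: "x \<in> S \<Longrightarrow> y \<in> S \<Longrightarrow> \<bar>ip x y\<bar> \<le> nrm x * nrm y"
  unfolding nrm_def real_sqrt_mult[symmetric]
  by (rule real_le_rsqrt) (simp add: Cauchy_Schwarz_sq)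

lemma nrm_triangle:
  assumes x: "x \<in> S" and y: "y \<in> S"
  shows "nrm (x + y) \<le> nrm x + nrm y"
proof (rule power2_le_imp_le)
  have "(nrm (x + y))\<^sup>2 = ip x x + 2 * ip x y + ip y y"
    using x y by (simp add: nrm_sq S_add ip_simps ip_sym[of y x])
  also have "\<dots> \<le> (nrm x + nrm y)\<^sup>2"
    using Cauchy_Schwarz[OF x y] by (simp add: power2_sum nrm_sq x y abs_le_iff)
  finally show "(nrm (x + y))\<^sup>2 \<le> (nrm x + nrm y)\<^sup>2" .
qed (simp add: x y)

lemma nrm_scale: "x \<in> S \<Longrightarrow> nrm (c *\<^sub>R x) = \<bar>c\<bar> * nrm x"
  by (simp add: nrm_def ip_simps S_scale real_sqrt_mult mult.assoc[symmetric])

lemma nrm_minus_commute: "x \<in> S \<Longrightarrow> y \<in> S \<Longrightarrow> nrm (x - y) = nrm (y - x)"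
  using nrm_scale[of "x - y" "-1"] S_diff by simp

lemma nrm_triangle_sub:
  assumes "x \<in> S" "y \<in> S" "z \<in> S"
  shows "nrm (x - z) \<le> nrm (x - y) + nrm (y - z)"
  using nrm_triangle[of "x - y" "y - z"] assms by auto

lemma nrm_diff_le: "x \<in> S \<Longrightarrow> y \<in> S \<Longrightarrow> nrm (x - y) \<le> nrm x + nrm y"
  using nrm_triangle[of x "(-1) *\<^sub>R y"] nrm_scale[of y "-1"] S_scale[of y "-1"] by simp

lemma complete_nrm:
  assumes X: "\<And>n::nat. X n \<in> S"
    and C: "\<And>e. e > 0 \<Longrightarrow> \<exists>N. \<forall>m\<ge>N. \<forall>n\<ge>N. nrm (X m - X n) < e"
  shows "\<exists>x\<in>S. (\<lambda>n. nrm (X n - x)) \<longlonglongrightarrow> 0"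
proof -
  have "\<exists>x\<in>S. (\<lambda>n. ip (X n - x) (X n - x)) \<longlonglongrightarrow> 0"
  proof (rule complete[OF X])
    fix e :: real assume "e > 0"
    then obtain N where "\<forall>m\<ge>N. \<forall>n\<ge>N. nrm (X m - X n) < sqrt e"
      using C[of "sqrt e"] by auto
    then show "\<exists>N. \<forall>m\<ge>N. \<forall>n\<ge>N. ip (X m - X n) (X m - X n) < e"
      unfolding nrm_def by auto
  qed
  then show ?thesis
    unfolding nrm_def using tendsto_real_sqrt by fastforce
qed

lemma nrm_limit_le:
  assumes X: "\<And>n::nat. X n \<in> S" and x: "x \<in> S" and y: "y \<in> S"
    and lim: "(\<lambda>n. nrm (X n - x)) \<longlonglongrightarrow> 0"
    and le: "\<And>n. nrm (X n - y) \<le> b n" and b: "b \<longlonglongrightarrow> B"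
  shows "nrm (x - y) \<le> B"
proof (rule LIMSEQ_le_const[of "\<lambda>n. nrm (X n - x) + b n"])
  show "(\<lambda>n. nrm (X n - x) + b n) \<longlonglongrightarrow> B"
    using tendsto_add[OF lim b] by simp
  have "nrm (x - y) \<le> nrm (X n - x) + b n" for n
    using nrm_triangle_sub[OF x X[of n] y] nrm_minus_commute[OF x X[of n]] le[of n] by linarith
  then show "\<exists>N. \<forall>n\<ge>N. nrm (x - y) \<le> nrm (X n - x) + b n" by blast
qed

text \<open>Minimise \<open>ip x x - 2 F x\<close>: by the parallelogram law minimising sequences are Cauchy.\<close>
theorem riesz_representation:
  assumes Fadd: "\<And>x y. x \<in> S \<Longrightarrow> y \<in> S \<Longrightarrow> F (x + y) = F x + F y"
    and Fscale: "\<And>x c. x \<in> S \<Longrightarrow> F (c *\<^sub>R x) = c * F x"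
    and Fle: "\<And>x. x \<in> S \<Longrightarrow> \<bar>F x\<bar> \<le> C * nrm x"
  shows "\<exists>y\<in>S. \<forall>x\<in>S. ip y x = F x"
proof -
  define J where "J x = ip x x - 2 * F x" for x
  \<comment> \<open>Completing the square in \<open>nrm x\<close> bounds the functional from below,
    so the infimum \<open>j\<close> exists.\<close>
  have Jlow: "- C\<^sup>2 \<le> J x" if "x \<in> S" for x
  proof -
    have "0 \<le> (nrm x - C)\<^sup>2" by simp
    then have "0 \<le> ip x x - 2 * (C * nrm x) + C\<^sup>2"
      using that by (simp add: power2_diff nrm_sq algebra_simps)
    then show ?thesis using Fle[OF that] by (simp add: J_def abs_le_iff)
  qed
  define j where "j = Inf (J ` S)"
  have bdd: "bdd_below (J ` S)" using Jlow by (intro bdd_belowI2) blast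
  have jle: "j \<le> J x" if "x \<in> S" for x
    unfolding j_def using bdd that by (intro cInf_lower) auto
  have "\<exists>x\<in>S. J x < j + 1 / (real n + 1)" for n :: nat
  proof -
    have "J ` S \<noteq> {}" using S_zero by blast
    moreover have "Inf (J ` S) < j + 1 / (real n + 1)" by (simp add: j_def)
    ultimately show ?thesis using cInf_lessD[of "J ` S"] by auto
  qed
  then obtain X where X: "\<And>n. X n \<in> S" and XJ: "\<And>n::nat. J (X n) < j + 1 / (real n + 1)"
    by metis
  have par: "ip (x - y) (x - y) \<le> 2 * (J x - j) + 2 * (J y - j)" if x: "x \<in> S" and y: "y \<in> S" for x y
  proof -
    have xy: "(1/2) *\<^sub>R (x + y) \<in> S" using x y by auto
    have "J ((1/2) *\<^sub>R (x + y)) = (ip x x + 2 * ip x y + ip y y) / 4 - (F x + F y)"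
      using x y by (simp add: J_def ip_simps S_add S_scale Fadd Fscale ip_sym[of y x] field_simps)
    moreover have "ip (x - y) (x - y) = ip x x - 2 * ip x y + ip y y"
      using x y by (simp add: ip_simps S_diff ip_sym[of y x])
    ultimately show ?thesis using jle[OF xy] unfolding J_def by argo
  qed
  have "\<exists>y\<in>S. (\<lambda>n. ip (X n - y) (X n - y)) \<longlonglongrightarrow> 0"
  proof (rule complete[OF X])
    fix e :: real assume e: "e > 0"
    obtain N :: nat where N: "4 / e < real N" using reals_Archimedean2 by blast
    have "ip (X m - X n) (X m - X n) < e" if mn: "m \<ge> N" "n \<ge> N" for m n
    proof -
      have s: "1 / (real i + 1) < e / 4" if "i \<ge> N" for i
      proof -
        have "4 / e < real i + 1" using N that by linarith
        then show ?thesis using e by (simp add: field_simps)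
      qed
      show ?thesis
        using par[OF X X, of m n] less_trans[OF XJ[of m] add_strict_left_mono[OF s[OF mn(1)]]]
          less_trans[OF XJ[of n] add_strict_left_mono[OF s[OF mn(2)]]] by argo
    qed
    then show "\<exists>N. \<forall>m\<ge>N. \<forall>n\<ge>N. ip (X m - X n) (X m - X n) < e" by blast
  qed
  then obtain y where y: "y \<in> S" and lim: "(\<lambda>n. ip (X n - y) (X n - y)) \<longlonglongrightarrow> 0" by blast
  have nlim: "(\<lambda>n. nrm (X n - y)) \<longlonglongrightarrow> 0"
    unfolding nrm_def using tendsto_real_sqrt[OF lim] by simp
  \<comment> \<open>The approximate minimiser \<open>X n\<close> is compared with
    \<open>X n + t x\<close>; the limit is taken in the resulting inequality, so continuity of
    \<open>J\<close> itself is never invoked.\<close>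
  have main: "0 \<le> t\<^sup>2 * ip x x + 2 * t * (ip y x - F x)" if x: "x \<in> S" for x t
  proof -
    have le: "0 \<le> 1 / (real n + 1) + t\<^sup>2 * ip x x + 2 * t * (ip (X n - y) x + (ip y x - F x))" for n
    proof -
      have "j \<le> J (X n + t *\<^sub>R x)" using X x by (intro jle) auto
      also have "\<dots> = J (X n) + t\<^sup>2 * ip x x + 2 * t * (ip (X n) x - F x)"
        using X[of n] x
        by (simp add: J_def ip_simps S_add S_scale Fadd Fscale ip_sym[of x "X n"] power2_eq_square algebra_simps)
      finally have "0 \<le> 1 / (real n + 1) + t\<^sup>2 * ip x x + 2 * t * (ip (X n) x - F x)"
        using XJ[of n] by linarith
      then show ?thesis using X[of n] x y by (simp add: ip_simps)
    qed
    have "(\<lambda>n. ip (X n - y) x) \<longlonglongrightarrow> 0"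
    proof (rule Lim_null_comparison)
      show "\<forall>\<^sub>F n in sequentially. norm (ip (X n - y) x) \<le> nrm (X n - y) * nrm x"
        using Cauchy_Schwarz[OF S_diff[OF X y] x] by simp
      show "(\<lambda>n. nrm (X n - y) * nrm x) \<longlonglongrightarrow> 0"
        using tendsto_mult_left_zero[OF nlim] .
    qed
    moreover have "(\<lambda>n. 1 / (real n + 1)) \<longlonglongrightarrow> 0"
      using LIMSEQ_inverse_real_of_nat by (simp add: inverse_eq_divide add.commute)
    ultimately have "(\<lambda>n. 1 / (real n + 1) + t\<^sup>2 * ip x x + 2 * t * (ip (X n - y) x + (ip y x - F x)))
        \<longlonglongrightarrow> 0 + t\<^sup>2 * ip x x + 2 * t * (0 + (ip y x - F x))"
      by (intro tendsto_intros)
    then have "0 \<le> 0 + t\<^sup>2 * ip x x + 2 * t * (0 + (ip y x - F x))"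
      by (rule LIMSEQ_le_const) (use le in blast)
    then show ?thesis by simp
  qed
  have "ip y x = F x" if x: "x \<in> S" for x
  proof (rule ccontr)
    define d where "d = ip y x - F x"
    assume "ip y x \<noteq> F x"
    then have d: "d \<noteq> 0" by (simp add: d_def)
    have xx: "0 \<le> ip x x" by (rule ip_nonneg[OF x])
    \<comment> \<open>Nearly the minimiser \<open>- d / ip x x\<close> of the quadratic; the added 1
      covers the case that \<open>x\<close> has norm zero and still leaves a negative value.\<close>
    define t where "t = - d / (ip x x + 1)"
    have eq: "t\<^sup>2 * ip x x + 2 * t * d = d\<^sup>2 / (ip x x + 1) * (ip x x / (ip x x + 1) - 2)"
      using xx by (simp add: t_def divide_simps) (simp add: power2_eq_square algebra_simps)
    have "ip x x / (ip x x + 1) - 2 < 0" using xx by (simp add: field_simps)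
    moreover have "d\<^sup>2 / (ip x x + 1) > 0" using d xx by simp
    ultimately have "t\<^sup>2 * ip x x + 2 * t * d < 0" unfolding eq by (intro mult_pos_neg)
    with main[OF x, of t] show False by (simp add: d_def)
  qed
  with y show ?thesis by blast
qed

end

section \<open>Polynomials of a positive contraction\<close>

locale positive_contraction = semi_hilbert S ip for S :: "'v::real_vector set" and ip +
  fixes R :: "'v \<Rightarrow> 'v"
  assumes R_in [intro, simp]: "\<And>x. x \<in> S \<Longrightarrow> R x \<in> S"
    and R_add: "\<And>x y. x \<in> S \<Longrightarrow> y \<in> S \<Longrightarrow> R (x + y) = R x + R y"
    and R_scale: "\<And>x c. x \<in> S \<Longrightarrow> R (c *\<^sub>R x) = c *\<^sub>R R x"
    and R_sym: "\<And>x y. x \<in> S \<Longrightarrow> y \<in> S \<Longrightarrow> ip (R x) y = ip x (R y)"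
    and R_pos: "\<And>x. x \<in> S \<Longrightarrow> 0 \<le> ip (R x) x"
    and R_le: "\<And>x. x \<in> S \<Longrightarrow> ip (R x) x \<le> ip x x"
begin

lemma R_zero [simp]: "R 0 = 0"
  using R_scale[of 0 0] by simp

lemma R_diff: "x \<in> S \<Longrightarrow> y \<in> S \<Longrightarrow> R (x - y) = R x - R y"
  using R_add[of x "(-1) *\<^sub>R y"] R_scale[of y "-1"] S_scale[of y "-1"] by simp

text \<open>Horner's scheme with \<open>R\<close> in place of the indeterminate, applied to a
  vector; in this form induction over \<open>pCons\<close> proves all algebraic rules.\<close>

definition pol :: "real poly \<Rightarrow> 'v \<Rightarrow> 'v" where
  "pol p x = fold_coeffs (\<lambda>c y. c *\<^sub>R x + R y) p 0"

lemma pol_0 [simp]: "pol 0 x = 0"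
  by (simp add: pol_def)

lemma pol_pCons [simp]: "pol (pCons c p) x = c *\<^sub>R x + R (pol p x)"
  by (cases "c = 0 \<and> p = 0") (auto simp: pol_def)

lemma pol_in [intro, simp]: "x \<in> S \<Longrightarrow> pol p x \<in> S"
  by (induct p) auto

lemma pol_add: "x \<in> S \<Longrightarrow> pol (p + q) x = pol p x + pol q x"
  by (induct p q rule: poly_induct2) (auto simp: R_add scaleR_add_left)

lemma pol_smult: "x \<in> S \<Longrightarrow> pol (smult c p) x = c *\<^sub>R pol p x"
  by (induct p) (auto simp: R_scale scaleR_add_right)

lemma pol_diff: "x \<in> S \<Longrightarrow> pol (p - q) x = pol p x - pol q x"
  using pol_add[of x p "smult (-1) q"] pol_smult[of x "-1" q] by simp

lemma pol_arg_add: "x \<in> S \<Longrightarrow> y \<in> S \<Longrightarrow> pol p (x + y) = pol p x + pol p y"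
  by (induct p) (auto simp: R_add scaleR_add_right)

lemma pol_arg_scale: "x \<in> S \<Longrightarrow> pol p (c *\<^sub>R x) = c *\<^sub>R pol p x"
  by (induct p) (auto simp: R_scale scaleR_add_right)

lemma pol_R: "x \<in> S \<Longrightarrow> pol p (R x) = R (pol p x)"
  by (induct p) (auto simp: R_add R_scale S_scale)

lemma pol_mult: "x \<in> S \<Longrightarrow> pol (p * q) x = pol p (pol q x)"
  by (induct p) (auto simp: pol_add pol_smult)

lemma pol_sym: "x \<in> S \<Longrightarrow> y \<in> S \<Longrightarrow> ip (pol p x) y = ip x (pol p y)"
proof (induct p arbitrary: y)
  case 0
  then show ?case using ip_scale[of x y 0] ip_scale_right[of y x 0] ip_scale[of 0 y 0] ip_scale_right[of 0 x 0] by simp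
next
  case (pCons c p)
  then show ?case
    using R_sym[of "pol p x" y] by (simp add: ip_simps S_scale pol_R[symmetric])
qed

text \<open>Positivity of the operator \<open>p(R)\<close> as a quadratic form. The aim is to derive
  it from nonnegativity of \<open>p\<close> on \<open>[0, 1]\<close> by algebra alone, without
  spectral theory or square roots of operators.\<close>

definition pos :: "real poly \<Rightarrow> bool" where
  "pos p \<longleftrightarrow> (\<forall>x\<in>S. 0 \<le> ip (pol p x) x)"

lemma pos_add: "pos p \<Longrightarrow> pos q \<Longrightarrow> pos (p + q)"
  by (auto simp: pos_def pol_add ip_simps)

lemma pos_smult: "pos p \<Longrightarrow> 0 \<le> c \<Longrightarrow> pos (smult c p)"
  by (auto simp: pos_def pol_smult ip_simps)

lemma pos_0: "pos 0"
  using ip_scale[of 0 _ 0] by (simp add: pos_def)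

lemma pos_sum: "(\<And>i. i \<in> A \<Longrightarrow> pos (f i)) \<Longrightarrow> pos (\<Sum>i\<in>A. f i)"
  by (induct A rule: infinite_finite_induct) (auto intro: pos_add pos_0)

text \<open>\<open>q(R)\<close> is symmetric, so one factor moves to the other side and leaves the
  form of \<open>p\<close> at the vector \<open>q(R) x\<close>.\<close>

lemma pos_conj: assumes "pos p" shows "pos (q * p * q)"
  unfolding pos_def
proof
  fix x assume x: "x \<in> S"
  have "ip (pol (q * p * q) x) x = ip (pol q (pol p (pol q x))) x"
    using x by (simp add: pol_mult mult.assoc)
  also have "\<dots> = ip (pol p (pol q x)) (pol q x)"
    using x by (simp add: pol_sym)
  finally show "0 \<le> ip (pol (q * p * q) x) x"
    using assms x by (auto simp: pos_def)
qed

abbreviation "pX \<equiv> [:0, 1::real:]"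
abbreviation "pY \<equiv> [:1, -1::real:]"

lemma pos_1: "pos 1"
  by (auto simp: pos_def one_pCons ip_nonneg)

lemma pos_X: "pos pX"
  by (auto simp: pos_def R_pos)

lemma pos_Y: "pos pY"
  using R_scale[where c = "-1"] by (auto simp: pos_def R_le ip_diff)

text \<open>Products of commuting positive operators usually call for a square root. Here
  multiplying by \<open>1 = X + (1 - X)\<close> writes \<open>X (1 - X)\<close> as a sum of two
  conjugated positive polynomials.\<close>

lemma pos_XY: "pos (pX * pY)"
proof -
  have "pX * pY = pX * pY * pX + pY * pX * pY"
    by (simp add: algebra_simps)
  then show ?thesis
    using pos_add[OF pos_conj[OF pos_Y, of pX] pos_conj[OF pos_X, of pY]] by metis
qed

text \<open>Even parts of the exponents are absorbed by conjugation with
  \<open>X^a (1 - X)^b\<close>; only the four products with exponents 0 or 1 remain.\<close>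

lemma pos_pow: "pos (pX ^ i * pY ^ j)"
proof -
  define a \<alpha> b \<beta> where "a = i div 2" and "\<alpha> = i mod 2" and "b = j div 2" and "\<beta> = j mod 2"
  then have a: "i = 2 * a + \<alpha>" "\<alpha> < 2" and b: "j = 2 * b + \<beta>" "\<beta> < 2" by simp_all
  have "pos (pX ^ \<alpha> * pY ^ \<beta>)"
  proof -
    have "\<alpha> = 0 \<or> \<alpha> = 1" "\<beta> = 0 \<or> \<beta> = 1" using a b by auto
    then show ?thesis using pos_1 pos_X pos_Y pos_XY by (elim disjE) (simp_all only: power_0 power_one_right mult_1 mult_1_right)
  qed
  moreover have "pX ^ i * pY ^ j = (pX ^ a * pY ^ b) * (pX ^ \<alpha> * pY ^ \<beta>) * (pX ^ a * pY ^ b)"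
    unfolding a b by (simp only: power_add mult_2 mult_2_right mult_ac)
  ultimately show ?thesis using pos_conj by metis
qed

lemma smult_sum_right: "smult c (\<Sum>i\<in>A. f i) = (\<Sum>i\<in>A. smult c (f i))"
  by (induct A rule: infinite_finite_induct) (auto simp: smult_add_right)

text \<open>Multiply \<open>X^j\<close> by the expanded power
  \<open>(X + (1 - X))^(N - j) = 1\<close>. The coefficients are written so that they vanish for
  \<open>k < j\<close>, which lets all degrees share the index set \<open>k \<le> N\<close>.\<close>

lemma monomial_Bernstein:
  assumes "j \<le> N"
  shows "pX ^ j = (\<Sum>k\<le>N. smult (real (k choose j) / real (N choose j) * real (N choose k)) (pX ^ k * pY ^ (N - k)))"
proof -
  have c: "real (k choose j) / real (N choose j) * real (N choose k) = real ((N - j) choose (k - j))"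
    if "j \<le> k" "k \<le> N" for k
  proof -
    have "(N choose k) * (k choose j) = (N choose j) * ((N - j) choose (k - j))"
      using that by (intro choose_mult)
    then have "real (N choose k) * real (k choose j) = real (N choose j) * real ((N - j) choose (k - j))"
      by (metis of_nat_mult)
    moreover have "real (N choose j) \<noteq> 0" using assms by simp
    ultimately show ?thesis by (simp add: field_simps)
  qed
  have "pX + pY = 1" by (simp add: one_pCons)
  then have "pX ^ j = pX ^ j * (pX + pY) ^ (N - j)" by (simp only: power_one mult_1_right)
  also have "\<dots> = (\<Sum>i\<le>N - j. of_nat ((N - j) choose i) * (pX ^ (i + j) * pY ^ (N - j - i)))"
    unfolding binomial_ring sum_distrib_left
    by (intro sum.cong refl) (simp only: power_add mult_ac)
  also have "\<dots> = (\<Sum>i\<in>{..N-j}. smult (real ((N - j) choose i)) (pX ^ (i + j) * pY ^ (N - j - i)))"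
    by (intro sum.cong refl) (simp only: of_nat_poly mult_pCons_left mult_zero_left smult_0_right pCons_0_0 add_0_right)
  also have "\<dots> = (\<Sum>k\<in>{j..N}. smult (real ((N - j) choose (k - j))) (pX ^ k * pY ^ (N - k)))"
    using assms by (intro sum.reindex_bij_witness[of _ "\<lambda>k. k - j" "\<lambda>i. i + j"]) (auto simp: add.commute)
  also have "\<dots> = (\<Sum>k\<in>{j..N}. smult (real (k choose j) / real (N choose j) * real (N choose k)) (pX ^ k * pY ^ (N - k)))"
    by (intro sum.cong refl) (metis c atLeastAtMost_iff)
  also have "\<dots> = (\<Sum>k\<le>N. smult (real (k choose j) / real (N choose j) * real (N choose k)) (pX ^ k * pY ^ (N - k)))"
    by (intro sum.mono_neutral_left) (auto simp: binomial_eq_0)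
  finally show ?thesis .
qed

text \<open>The ratio is the product of the factors \<open>(k - i) / (N - i)\<close> over
  \<open>i < j\<close>, each within \<open>i / (N - i)\<close> of \<open>k / N\<close>. Induction on
  \<open>j\<close> adds one such error at a time, and all numbers involved lie in
  \<open>[0, 1]\<close>.\<close>

lemma choose_ratio_approx:
  assumes "j < N" "k \<le> N"
  shows "\<bar>real (k choose j) / real (N choose j) - (real k / real N) ^ j\<bar> \<le> real (j\<^sup>2) / real (N - j)"
  using assms(1)
proof (induct j)
  case 0
  then show ?case by simp
next
  case (Suc j)
  let ?c = "\<lambda>j. real (k choose j) / real (N choose j)" and ?y = "real k / real N"
  have N: "N > 0" "j < N" using Suc by auto
  have y: "0 \<le> ?y" "?y \<le> 1" using assms N by auto
  have IH: "\<bar>?c j - ?y ^ j\<bar> \<le> real (j\<^sup>2) / real (N - j)" using Suc by simp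
  have Nj: "0 < real (N - Suc j)" "real (N - Suc j) \<le> real (N - j)" using Suc by auto
  have mono: "real (j\<^sup>2) / real (N - j) + real j / real (N - j) \<le> real ((Suc j)\<^sup>2) / real (N - Suc j)"
  proof -
    have "real (j\<^sup>2) / real (N - j) + real j / real (N - j) = real (j\<^sup>2 + j) / real (N - j)"
      by (simp add: add_divide_distrib)
    also have "\<dots> \<le> real ((Suc j)\<^sup>2) / real (N - Suc j)"
      using Nj by (intro frac_le) (auto simp: power2_eq_square)
    finally show ?thesis .
  qed
  show ?case
  proof (cases "k < j + 1")
    \<comment> \<open>For \<open>k \<le> j\<close> the new binomial coefficient is 0 and only
      \<open>(k / N)^(j + 1)\<close> has to be small. If \<open>k < j\<close>, the previous ratio is
      0 as well and the induction hypothesis bounds it; if \<open>k = j\<close>, it is at most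
      \<open>j / N\<close>.\<close>
    case True
    have "?y ^ Suc j \<le> ?y ^ j"
      unfolding power_Suc by (rule mult_left_le_one_le) (use y in simp_all)
    have "\<bar>?c (Suc j) - ?y ^ Suc j\<bar> \<le> real (j\<^sup>2) / real (N - j) + real j / real (N - j)"
    proof (cases "k < j")
      case True
      then have c0: "k choose Suc j = 0" "k choose j = 0" by (auto simp: binomial_eq_0)
      have "\<bar>?c (Suc j) - ?y ^ Suc j\<bar> = ?y ^ Suc j" using y by (simp add: c0)
      also have "\<dots> \<le> ?y ^ j" by fact
      also have "\<dots> = \<bar>?c j - ?y ^ j\<bar>" using y by (simp add: c0)
      also have "\<dots> \<le> real (j\<^sup>2) / real (N - j) + real j / real (N - j)" using IH by (simp add: add_increasing2)
      finally show ?thesis .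
    next
      case False
      then have "k = j" using True by simp
      then have c0: "k choose Suc j = 0" by (simp add: binomial_eq_0)
      have "\<bar>?c (Suc j) - ?y ^ Suc j\<bar> = ?y ^ Suc j" using y by (simp add: c0)
      also have "?y ^ Suc j \<le> real j / real (N - j)"
      proof -
        have "?y ^ Suc j \<le> ?y" unfolding power_Suc by (rule mult_left_le) (use y in \<open>simp_all add: power_le_one\<close>)
        also have "\<dots> \<le> real j / real (N - j)" using N \<open>k = j\<close> by (intro frac_le) auto
        finally show ?thesis .
      qed
      also have "\<dots> \<le> real (j\<^sup>2) / real (N - j) + real j / real (N - j)" by (simp add: add_increasing)
      finally show ?thesis .
    qed
    then show ?thesis using mono by (rule order_trans)
  next
    case False
    then have kj: "j \<le> k" by simp
    let ?z = "real (k - j) / real (N - j)"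
    have step: "real (n choose Suc j) * real (Suc j) = real (n choose j) * real (n - j)" for n
    proof -
      have "(n choose Suc j) * Suc j = (n choose j) * (n - j)"
        using binomial_absorb_comp[of n j] binomial_absorption[of j n] by (simp only: mult.commute)
      then show ?thesis by (metis of_nat_mult)
    qed
    have cS: "?c (Suc j) = ?c j * ?z"
    proof -
      have a: "real (n choose Suc j) = real (n choose j) * real (n - j) / real (Suc j)" for n
        using step[of n] by (simp add: field_simps)
      have b: "(A * x / s) / (B * y / s) = A / B * (x / y)" if "s \<noteq> 0" for A B x y s :: real
        using that by (cases "B = 0 \<or> y = 0") (auto simp: field_simps)
      show ?thesis unfolding a[of k] a[of N] by (rule b) simp
    qed
    have z: "0 \<le> ?z" "?z \<le> 1" using assms kj N by auto
    have zy: "\<bar>?z - ?y\<bar> \<le> real j / real (N - j)"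
    proof -
      have e: "?z - ?y = - (real j * (real N - real k) / (real N * real (N - j)))"
        using N kj by (simp add: field_simps of_nat_diff)
      have "real j * (real N - real k) / (real N * real (N - j)) \<le> real j * real N / (real N * real (N - j))"
        using N by (intro divide_right_mono mult_left_mono) auto
      moreover have "0 \<le> real j * (real N - real k) / (real N * real (N - j))"
        using assms by simp
      ultimately show ?thesis unfolding e using N by simp
    qed
    have "?c (Suc j) - ?y ^ Suc j = (?c j - ?y ^ j) * ?z + ?y ^ j * (?z - ?y)"
      by (simp only: cS) (simp add: algebra_simps)
    also have "\<bar>\<dots>\<bar> \<le> \<bar>?c j - ?y ^ j\<bar> * ?z + ?y ^ j * \<bar>?z - ?y\<bar>"
      using z y by (intro order_trans[OF abs_triangle_ineq]) (simp add: abs_mult)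
    also have "\<dots> \<le> \<bar>?c j - ?y ^ j\<bar> + \<bar>?z - ?y\<bar>"
      using z y by (intro add_mono mult_left_le mult_left_le_one_le) (auto simp: power_le_one)
    also have "\<dots> \<le> real ((Suc j)\<^sup>2) / real (N - Suc j)"
      using order_trans[OF add_mono[OF IH zy] mono] .
    finally show ?thesis .
  qed
qed

text \<open>The Bernstein coefficients of \<open>p\<close> of order \<open>N\<close> approach the values \<open>p(k / N)\<close> uniformly in \<open>k\<close>. Hence
  \<open>p + e\<close> is a nonnegative combination of the \<open>X\<^sup>k (1 - X)\<^sup>N\<^sup>-\<^sup>k\<close>, each of which is positive at \<open>R\<close>.\<close>
lemma pos_poly:
  assumes p: "\<And>r. 0 \<le> r \<Longrightarrow> r \<le> 1 \<Longrightarrow> 0 \<le> poly p r"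
  shows "pos p"
proof -
  have eps: "pos (p + [:e:])" if e: "e > 0" for e
  proof -
    define d where "d = degree p"
    define A where "A = (\<Sum>j\<le>d. \<bar>coeff p j\<bar> * real (d\<^sup>2))"
    have A: "A \<ge> 0" unfolding A_def by (intro sum_nonneg) auto
    obtain N0 :: nat where N0: "A / e < real N0" using reals_Archimedean2 by blast
    \<comment> \<open>\<open>N - d\<close> exceeds \<open>A / e\<close>, so the total coefficient
      error \<open>A / (N - d)\<close> stays below \<open>e\<close>.\<close>
    define N where "N = N0 + d + 1"
    have N: "d < N" "A / real (N - d) \<le> e"
      using N0 e A by (auto simp: N_def field_simps)
    define P where "P k = (\<Sum>j\<le>d. coeff p j * (real (k choose j) / real (N choose j)))" for k
    have Pge: "- e \<le> P k" if k: "k \<le> N" for k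
    proof -
      have "\<bar>P k - poly p (real k / real N)\<bar>
          = \<bar>\<Sum>j\<le>d. coeff p j * (real (k choose j) / real (N choose j) - (real k / real N) ^ j)\<bar>"
        unfolding P_def poly_altdef d_def[symmetric] sum_subtractf[symmetric] right_diff_distrib by simp
      also have "\<dots> \<le> (\<Sum>j\<le>d. \<bar>coeff p j\<bar> * (real (d\<^sup>2) / real (N - d)))"
      proof (rule order_trans[OF sum_abs], rule sum_mono)
        fix j assume j: "j \<in> {..d}"
        have "\<bar>real (k choose j) / real (N choose j) - (real k / real N) ^ j\<bar> \<le> real (j\<^sup>2) / real (N - j)"
          using j N k by (intro choose_ratio_approx) auto
        also have "\<dots> \<le> real (d\<^sup>2) / real (N - d)"
          using j N by (intro frac_le) (auto intro: power_mono)
        finally show "\<bar>coeff p j * (real (k choose j) / real (N choose j) - (real k / real N) ^ j)\<bar>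
            \<le> \<bar>coeff p j\<bar> * (real (d\<^sup>2) / real (N - d))"
          by (simp only: abs_mult mult_left_mono abs_ge_zero)
      qed
      also have "\<dots> = A / real (N - d)"
        by (simp add: A_def sum_divide_distrib)
      also have "\<dots> \<le> e" by (rule N)
      finally show ?thesis
        using p[of "real k / real N"] k N by (simp add: divide_le_eq_1)
    qed
    have one: "[:e:] = (\<Sum>k\<le>N. smult (e * real (N choose k)) (pX ^ k * pY ^ (N - k)))"
    proof -
      have "[:e:] = smult e (pX ^ 0)" by (simp add: one_pCons)
      also have "\<dots> = (\<Sum>k\<le>N. smult (e * real (N choose k)) (pX ^ k * pY ^ (N - k)))"
        unfolding monomial_Bernstein[OF le0, of N] smult_sum_right by simp
      finally show ?thesis .
    qed
    have "p = (\<Sum>j\<le>d. smult (coeff p j) (pX ^ j))"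
      unfolding d_def by (subst poly_as_sum_of_monoms[symmetric]) (simp add: monom_altdef)
    also have "\<dots> = (\<Sum>j\<le>d. \<Sum>k\<le>N. smult (coeff p j * (real (k choose j) / real (N choose j)) * real (N choose k)) (pX ^ k * pY ^ (N - k)))"
    proof (intro sum.cong refl)
      fix j assume "j \<in> {..d}"
      then have "j \<le> N" using N by simp
      show "smult (coeff p j) (pX ^ j) = (\<Sum>k\<le>N. smult (coeff p j * (real (k choose j) / real (N choose j)) * real (N choose k)) (pX ^ k * pY ^ (N - k)))"
        unfolding monomial_Bernstein[OF \<open>j \<le> N\<close>] smult_sum_right smult_smult mult.assoc by (rule refl)
    qed
    also have "\<dots> = (\<Sum>k\<le>N. smult (P k * real (N choose k)) (pX ^ k * pY ^ (N - k)))"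
      unfolding P_def sum_distrib_right smult_sum by (rule sum.swap)
    finally have "p + [:e:] = (\<Sum>k\<le>N. smult ((P k + e) * real (N choose k)) (pX ^ k * pY ^ (N - k)))"
      unfolding one by (simp only: sum.distrib[symmetric] smult_add_left[symmetric] distrib_right)
    moreover have "pos (\<Sum>k\<le>N. smult ((P k + e) * real (N choose k)) (pX ^ k * pY ^ (N - k)))"
    proof (intro pos_sum pos_smult pos_pow)
      fix k assume "k \<in> {..N}"
      then show "0 \<le> (P k + e) * real (N choose k)" using Pge[of k] by simp
    qed
    ultimately show ?thesis by metis
  qed
  show ?thesis
    unfolding pos_def
  proof
    fix x assume x: "x \<in> S"
    show "0 \<le> ip (pol p x) x"
    proof (rule field_le_epsilon)
      fix e :: real assume e: "e > 0"
      define d where "d = e / (ip x x + 1)"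
      have xx: "0 \<le> ip x x" by (rule ip_nonneg[OF x])
      have d: "d > 0" using e xx by (simp add: d_def)
      have "0 \<le> ip (pol (p + [:d:]) x) x" using eps[OF d] x by (auto simp: pos_def)
      also have "\<dots> = ip (pol p x) x + d * ip x x"
        using x by (simp add: pol_add ip_simps S_scale)
      also have "d * ip x x \<le> e" using e xx by (simp add: d_def field_simps)
      finally show "0 \<le> ip (pol p x) x + e" by simp
    qed
  qed
qed

text \<open>The polynomial \<open>B^2 - p^2\<close> is nonnegative on \<open>[0, 1]\<close>, and the
  squared norm of \<open>p(R) x\<close> is the form of \<open>p^2\<close> at \<open>x\<close> by
  symmetry. This is the supremum norm estimate that makes the passage to continuous functions
  possible.\<close>

lemma pol_bound:
  assumes x: "x \<in> S" and B: "\<And>r. 0 \<le> r \<Longrightarrow> r \<le> 1 \<Longrightarrow> \<bar>poly p r\<bar> \<le> B"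
  shows "nrm (pol p x) \<le> B * nrm x"
proof (rule power2_le_imp_le)
  have B0: "0 \<le> B" using B[of 0] by linarith
  have "pos ([:B\<^sup>2:] - p * p)"
  proof (rule pos_poly)
    fix r :: real assume "0 \<le> r" "r \<le> 1"
    then have "(poly p r)\<^sup>2 \<le> B\<^sup>2" using B[of r] B0 by (intro abs_le_square_iff[THEN iffD1]) simp
    then show "0 \<le> poly ([:B\<^sup>2:] - p * p) r" by (simp add: power2_eq_square)
  qed
  then have "0 \<le> ip (pol ([:B\<^sup>2:] - p * p) x) x" using x by (auto simp: pos_def)
  also have "\<dots> = B\<^sup>2 * ip x x - ip (pol p x) (pol p x)"
    using x by (simp add: pol_diff pol_mult ip_simps S_scale pol_sym)
  finally show "(nrm (pol p x))\<^sup>2 \<le> (B * nrm x)\<^sup>2"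
    using x by (simp add: power_mult_distrib nrm_sq)
  show "0 \<le> B * nrm x" using B0 x by simp
qed

lemma R_bound: "x \<in> S \<Longrightarrow> nrm (R x) \<le> nrm x"
  using pol_bound[of x pX 1] by simp

section \<open>Continuous functions of a positive contraction\<close>

text \<open>As \<open>ip\<close> is only semidefinite, \<open>fc F x\<close> is determined up to a vector of norm zero.\<close>
definition fc :: "(real \<Rightarrow> real) \<Rightarrow> 'v \<Rightarrow> 'v" where
  "fc F x = (SOME y. y \<in> S \<and> (\<forall>p B. (\<forall>r\<in>{0..1}. \<bar>poly p r - F r\<bar> \<le> B) \<longrightarrow> nrm (pol p x - y) \<le> B * nrm x))"

lemma poly_approx:
  assumes "continuous_on {0..1} F" "e > 0"
  shows "\<exists>p. \<forall>r\<in>{0..1::real}. \<bar>poly p r - F r\<bar> \<le> e"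
proof -
  obtain g where g: "real_polynomial_function g" "\<And>x. x \<in> {0..1} \<Longrightarrow> \<bar>F x - g x\<bar> < e"
    using Stone_Weierstrass_real_polynomial_function[OF compact_Icc assms] by blast
  obtain a n where "g = (\<lambda>x. \<Sum>i\<le>n. a i * x ^ i)"
    using g(1) real_polynomial_function_iff_sum by blast
  then have "poly (\<Sum>i\<le>n. monom (a i) i) r = g r" for r
    by (simp add: poly_sum poly_monom)
  then have "\<bar>poly (\<Sum>i\<le>n. monom (a i) i) r - F r\<bar> \<le> e" if "r \<in> {0..1}" for r
    using g(2)[OF that] by simp
  then show ?thesis by blast
qed

text \<open>The vector exists as the limit of \<open>pol (p n) x\<close> along uniform approximants
  of \<open>F\<close>. The second claim is how \<open>fc\<close> is used afterwards: any polynomial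
  within \<open>B\<close> of \<open>F\<close>, not just those of the sequence, is within
  \<open>B\<close> in norm.\<close>

lemma fc_spec:
  assumes F: "continuous_on {0..1} F" and x: "x \<in> S"
  shows "fc F x \<in> S"
    and "(\<forall>r\<in>{0..1}. \<bar>poly p r - F r\<bar> \<le> B) \<Longrightarrow> nrm (pol p x - fc F x) \<le> B * nrm x"
proof -
  have "\<exists>y. y \<in> S \<and> (\<forall>p B. (\<forall>r\<in>{0..1}. \<bar>poly p r - F r\<bar> \<le> B) \<longrightarrow> nrm (pol p x - y) \<le> B * nrm x)"
  proof -
    have "\<exists>p. \<forall>r\<in>{0..1::real}. \<bar>poly p r - F r\<bar> \<le> 1 / (real n + 1)" for n :: nat
      by (intro poly_approx F) simp
    then obtain p where p: "\<And>n r. r \<in> {0..1::real} \<Longrightarrow> \<bar>poly (p n) r - F r\<bar> \<le> 1 / (real n + 1)"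
      by metis
    \<comment> \<open>One estimate serves twice: with \<open>q\<close> another approximant it gives
      the Cauchy property, with \<open>q\<close> arbitrary it gives the characterising bound in the
      limit.\<close>
    have le: "nrm (pol (p n) x - pol q x) \<le> (1 / (real n + 1) + B) * nrm x"
      if q: "\<And>r. r \<in> {0..1} \<Longrightarrow> \<bar>poly q r - F r\<bar> \<le> B" for n q B
    proof -
      have "nrm (pol (p n - q) x) \<le> (1 / (real n + 1) + B) * nrm x"
      proof (rule pol_bound[OF x])
        fix r :: real assume "0 \<le> r" "r \<le> 1"
        then show "\<bar>poly (p n - q) r\<bar> \<le> 1 / (real n + 1) + B"
          using p[of r n] q[of r] by (simp add: abs_le_iff) 
      qed
      then show ?thesis using x by (simp add: pol_diff)
    qed
    have lim0: "(\<lambda>n. 1 / (real n + 1)) \<longlonglongrightarrow> 0"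
      using LIMSEQ_inverse_real_of_nat by (simp add: inverse_eq_divide add.commute)
    have "\<exists>y\<in>S. (\<lambda>n. nrm (pol (p n) x - y)) \<longlonglongrightarrow> 0"
    proof (rule complete_nrm)
      show "pol (p n) x \<in> S" for n using x by auto
      fix e :: real assume e: "e > 0"
      define d where "d = e / (2 * (nrm x + 1))"
      have nx: "0 \<le> nrm x" using x by simp
      have d: "d > 0" using e nx by (simp add: d_def)
      obtain N :: nat where N: "1 / d < real N" using reals_Archimedean2 by blast
      have s: "1 / (real i + 1) < d" if "i \<ge> N" for i
      proof -
        have "1 / d < real i + 1" using N that by linarith
        then show ?thesis using d by (simp add: field_simps)
      qed
      have "nrm (pol (p m) x - pol (p n) x) < e" if "m \<ge> N" "n \<ge> N" for m n
      proof -
        have "nrm (pol (p m) x - pol (p n) x) \<le> (1 / (real m + 1) + 1 / (real n + 1)) * nrm x"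
          by (intro le p)
        also have "\<dots> \<le> (2 * d) * nrm x"
          using s[OF that(1)] s[OF that(2)] nx by (intro mult_right_mono) auto
        also have "\<dots> < e" using e nx by (simp add: d_def field_simps)
        finally show ?thesis .
      qed
      then show "\<exists>N. \<forall>m\<ge>N. \<forall>n\<ge>N. nrm (pol (p m) x - pol (p n) x) < e" by blast
    qed
    then obtain y where y: "y \<in> S" and lim: "(\<lambda>n. nrm (pol (p n) x - y)) \<longlonglongrightarrow> 0" by blast
    have "nrm (pol q x - y) \<le> B * nrm x" if q: "\<forall>r\<in>{0..1}. \<bar>poly q r - F r\<bar> \<le> B" for q B
    proof -
      have "nrm (y - pol q x) \<le> (0 + B) * nrm x"
      proof (rule nrm_limit_le[OF _ y _ lim])
        show "nrm (pol (p n) x - pol q x) \<le> (1 / (real n + 1) + B) * nrm x" for n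
          using q by (intro le) auto
        show "(\<lambda>n. (1 / (real n + 1) + B) * nrm x) \<longlonglongrightarrow> (0 + B) * nrm x"
          by (intro tendsto_intros lim0)
      qed (use x in auto)
      then show ?thesis using nrm_minus_commute[OF y pol_in[OF x, of q]] by simp
    qed
    with y show ?thesis by blast
  qed
  from someI_ex[OF this] show "fc F x \<in> S"
    "(\<forall>r\<in>{0..1}. \<bar>poly p r - F r\<bar> \<le> B) \<Longrightarrow> nrm (pol p x - fc F x) \<le> B * nrm x"
    unfolding fc_def by blast+
qed

lemmas fc_in [intro, simp] = fc_spec(1)

lemma R_pol_fc:
  assumes F: "continuous_on {0..1} F" and x: "x \<in> S"
    and p: "\<forall>r\<in>{0..1}. \<bar>poly p r - F r\<bar> \<le> B"
  shows "nrm (pol (pCons 0 p) x - R (fc F x)) \<le> B * nrm x"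
proof -
  have "pol (pCons 0 p) x - R (fc F x) = R (pol p x - fc F x)"
    using F x by (simp add: R_diff)
  then show ?thesis
    using R_bound[OF S_diff[OF pol_in[OF x] fc_spec(1)[OF F x]], of p] fc_spec(2)[OF F x p] by simp
qed

text \<open>Prepending the coefficient 0 multiplies a polynomial by \<open>r\<close>, and as
  \<open>r \<le> 1\<close> the approximation error does not grow.\<close>

lemma fc_R:
  assumes F: "continuous_on {0..1} F" and x: "x \<in> S"
  shows "nrm (R (fc F x) - fc (\<lambda>r. r * F r) x) = 0"
proof -
  let ?G = "\<lambda>r. r * F r"
  have G: "continuous_on {0..1} ?G" by (intro continuous_intros F)
  have "nrm (R (fc F x) - fc ?G x) \<le> 0 + e" if e: "e > 0" for e
  proof -
    define d where "d = e / (2 * (nrm x + 1))"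
    have nx: "0 \<le> nrm x" using x by simp
    have d: "d > 0" using e nx by (simp add: d_def)
    obtain p where p: "\<forall>r\<in>{0..1}. \<bar>poly p r - F r\<bar> \<le> d" using poly_approx[OF F d] by blast
    have "\<forall>r\<in>{0..1}. \<bar>poly (pCons 0 p) r - ?G r\<bar> \<le> d"
    proof
      fix r :: real assume r: "r \<in> {0..1}"
      have "\<bar>poly (pCons 0 p) r - ?G r\<bar> = r * \<bar>poly p r - F r\<bar>"
        using r by (simp add: abs_mult right_diff_distrib[symmetric])
      also have "\<dots> \<le> 1 * \<bar>poly p r - F r\<bar>" using r by (intro mult_right_mono) auto
      finally show "\<bar>poly (pCons 0 p) r - ?G r\<bar> \<le> d" using p r by force
    qed
    then have "nrm (pol (pCons 0 p) x - fc ?G x) \<le> d * nrm x" by (rule fc_spec(2)[OF G x])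
    moreover have "nrm (R (fc F x) - pol (pCons 0 p) x) \<le> d * nrm x"
      using R_pol_fc[OF F x p] nrm_minus_commute[of "R (fc F x)" "pol (pCons 0 p) x"] F x by (metis R_in fc_in pol_in)
    moreover have "nrm (R (fc F x) - fc ?G x) \<le> nrm (R (fc F x) - pol (pCons 0 p) x) + nrm (pol (pCons 0 p) x - fc ?G x)"
      using F G x by (intro nrm_triangle_sub) auto
    moreover have "2 * (d * nrm x) \<le> e" using e nx by (simp add: d_def field_simps)
    ultimately show ?thesis by linarith
  qed
  then have "nrm (R (fc F x) - fc ?G x) \<le> 0" by (rule field_le_epsilon)
  then show ?thesis using F G x by (metis R_in S_diff antisym fc_in nrm_nonneg)
qed

text \<open>Three uses in one estimate: \<open>B = 0\<close> yields linear relations between values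
  of the calculus, \<open>a = b = 0\<close> yields the norm bound, and a Taylor remainder in place
  of the combination yields differentiability in a parameter.\<close>

lemma fc_lincomb_bound:
  assumes F: "continuous_on {0..1} F" and G: "continuous_on {0..1} G" and H: "continuous_on {0..1} H"
    and x: "x \<in> S" and B: "\<And>r. r \<in> {0..1} \<Longrightarrow> \<bar>F r - a * G r - b * H r\<bar> \<le> B"
  shows "nrm (fc F x - a *\<^sub>R fc G x - b *\<^sub>R fc H x) \<le> B * nrm x"
proof (rule field_le_epsilon)
  fix e :: real assume e: "e > 0"
  define c where "c = 1 + \<bar>a\<bar> + \<bar>b\<bar>"
  \<comment> \<open>The approximation error \<open>d\<close>, weighted by \<open>c\<close>, enters
    twice: inside the combined polynomial and when the three polynomials are exchanged for their
    functions. The factor 2 and \<open>nrm x + 1\<close> make the total at most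
    \<open>e\<close>.\<close>
  define d where "d = e / (2 * c * (nrm x + 1))"
  have c: "c \<ge> 1" by (simp add: c_def)
  have nx: "0 \<le> nrm x" using x by simp
  have d: "d > 0" using e nx c by (simp add: d_def)
  obtain p where p: "\<forall>r\<in>{0..1}. \<bar>poly p r - F r\<bar> \<le> d" using poly_approx[OF F d] by blast
  obtain q where q: "\<forall>r\<in>{0..1}. \<bar>poly q r - G r\<bar> \<le> d" using poly_approx[OF G d] by blast
  obtain w where w: "\<forall>r\<in>{0..1}. \<bar>poly w r - H r\<bar> \<le> d" using poly_approx[OF H d] by blast
  let ?p = "p - smult a q - smult b w"
  have 1: "nrm (pol ?p x) \<le> (B + c * d) * nrm x"
  proof (rule pol_bound[OF x])
    fix r :: real assume r: "0 \<le> r" "r \<le> 1"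
    have "poly ?p r = (poly p r - F r) - a * (poly q r - G r) - b * (poly w r - H r) + (F r - a * G r - b * H r)"
      by (simp add: algebra_simps)
    also have "\<bar>\<dots>\<bar> \<le> \<bar>poly p r - F r\<bar> + \<bar>a\<bar> * \<bar>poly q r - G r\<bar> + \<bar>b\<bar> * \<bar>poly w r - H r\<bar> + \<bar>F r - a * G r - b * H r\<bar>"
      unfolding abs_mult[symmetric] by linarith
    also have "\<dots> \<le> d + \<bar>a\<bar> * d + \<bar>b\<bar> * d + B"
      using p q w B r by (intro add_mono mult_left_mono) auto
    finally show "\<bar>poly ?p r\<bar> \<le> B + c * d" by (simp add: c_def algebra_simps)
  qed
  have S: "fc F x \<in> S" "fc G x \<in> S" "fc H x \<in> S" using F G H x by auto
  have e1: "fc F x - a *\<^sub>R fc G x - b *\<^sub>R fc H x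
     = pol ?p x - ((pol p x - fc F x) - (a *\<^sub>R (pol q x - fc G x) + b *\<^sub>R (pol w x - fc H x)))"
    unfolding pol_diff[OF x] pol_smult[OF x] by (simp add: algebra_simps)
  have "nrm (fc F x - a *\<^sub>R fc G x - b *\<^sub>R fc H x)
     \<le> nrm (pol ?p x) + (nrm (pol p x - fc F x) + (nrm (a *\<^sub>R (pol q x - fc G x)) + nrm (b *\<^sub>R (pol w x - fc H x))))"
  proof -
    have *: "nrm (P - (A - (B + C))) \<le> nrm P + (nrm A + (nrm B + nrm C))"
      if "P \<in> S" "A \<in> S" "B \<in> S" "C \<in> S" for P A B C
      using nrm_diff_le[of P "A - (B + C)"] nrm_diff_le[of A "B + C"] nrm_triangle[of B C] that
        S_add[of B C] S_diff[of A "B + C"] by linarith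
    show ?thesis unfolding e1 using x S by (intro *) auto
  qed
  also have "\<dots> \<le> (B + c * d) * nrm x + (d * nrm x + (\<bar>a\<bar> * (d * nrm x) + \<bar>b\<bar> * (d * nrm x)))"
    using x S fc_spec(2)[OF F x p] fc_spec(2)[OF G x q] fc_spec(2)[OF H x w] 1
    by (intro add_mono) (auto simp: nrm_scale S_diff intro!: mult_left_mono)
  also have "\<dots> = B * nrm x + 2 * c * d * nrm x" by (simp add: c_def algebra_simps)
  also have "2 * c * d * nrm x \<le> e"
  proof -
    have "2 * c * d = e / (nrm x + 1)" using c by (simp add: d_def)
    then have "2 * c * d * nrm x = e * (nrm x / (nrm x + 1))" by simp
    also have "\<dots> \<le> e" using e nx by (intro mult_left_le) auto
    finally show ?thesis .
  qed
  finally show "nrm (fc F x - a *\<^sub>R fc G x - b *\<^sub>R fc H x) \<le> B * nrm x + e" by simp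
qed

lemma fc_bound:
  assumes F: "continuous_on {0..1} F" and x: "x \<in> S" and B: "\<And>r. r \<in> {0..1} \<Longrightarrow> \<bar>F r\<bar> \<le> B"
  shows "nrm (fc F x) \<le> B * nrm x"
  using fc_lincomb_bound[OF F F F x, of 0 0 B] B by simp

lemma fc_one: "x \<in> S \<Longrightarrow> nrm (x - fc (\<lambda>_. 1) x) = 0"
  using fc_spec(2)[of "\<lambda>_. 1" x "[:1:]" 0] nrm_nonneg[OF S_diff, of x "fc (\<lambda>_. 1) x"]
  by (intro antisym) auto

text \<open>\<open>(1 - R) ^ n\<close> converges strongly, its limit lies in the kernel of \<open>R\<close>, and
  \<open>1 - (1 - R) ^ n\<close> is divisible by \<open>R\<close>.\<close>
lemma range_dense:
  assumes inj: "\<And>z. z \<in> S \<Longrightarrow> nrm (R z) = 0 \<Longrightarrow> nrm z = 0" and x: "x \<in> S" and e: "e > 0"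
  shows "\<exists>z\<in>S. nrm (x - R z) < e"
proof -
  define Z where "Z n = pol (pY ^ n) x" for n
  have Z: "Z n \<in> S" for n using x by (simp add: Z_def)
  \<comment> \<open>By symmetry every inner product of \<open>Z m\<close> and \<open>Z n\<close> is
    \<open>a (m + n)\<close>, so the squared distance is
    \<open>a (2 m) - 2 a (m + n) + a (2 n)\<close>. Positivity of \<open>X (1 - X)^n\<close> makes
    \<open>a\<close> decreasing, hence convergent and \<open>Z\<close> Cauchy.\<close>
  define a where "a n = ip (Z n) x" for n
  have ipZ: "ip (Z m) (Z n) = a (m + n)" for m n
    unfolding Z_def a_def power_add using x by (subst pol_sym[symmetric]) (auto simp: pol_mult mult.commute[of "pY ^ m"])
  have a0: "0 \<le> a n" for n
    using pos_pow[of 0 n] x by (auto simp: pos_def a_def Z_def)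
  have aS: "a (Suc n) \<le> a n" for n
  proof -
    have "0 \<le> ip (pol (pX ^ 1 * pY ^ n) x) x" using pos_pow[of 1 n] x unfolding pos_def by blast
    moreover have "pX ^ 1 * pY ^ n = pY ^ n - pY ^ Suc n" by simp
    ultimately have "0 \<le> ip (pol (pY ^ n - pY ^ Suc n) x) x" by metis
    then show ?thesis using x by (simp only: pol_diff ip_simps pol_in a_def Z_def)
  qed
  have "decseq a" using aS by (rule decseq_SucI)
  then obtain L where L: "a \<longlonglongrightarrow> L" using a0 decseq_convergent[of a 0] by metis
  have "\<exists>z\<in>S. (\<lambda>n. ip (Z n - z) (Z n - z)) \<longlonglongrightarrow> 0"
  proof (rule complete[OF Z])
    fix e :: real assume e: "e > 0"
    obtain N where N: "\<And>n. n \<ge> N \<Longrightarrow> \<bar>a n - L\<bar> < e / 4"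
      using LIMSEQ_D[OF L, of "e/4"] e by auto
    have "ip (Z m - Z n) (Z m - Z n) < e" if "m \<ge> N" "n \<ge> N" for m n
    proof -
      have "ip (Z m - Z n) (Z m - Z n) = a (m + m) - 2 * a (m + n) + a (n + n)"
        using Z by (simp add: ip_simps S_diff ipZ add.commute)
      then show ?thesis using N[of "m + m"] N[of "m + n"] N[of "n + n"] that by linarith
    qed
    then show "\<exists>N. \<forall>m\<ge>N. \<forall>n\<ge>N. ip (Z m - Z n) (Z m - Z n) < e" by blast
  qed
  then obtain z where z: "z \<in> S" and lim: "(\<lambda>n. ip (Z n - z) (Z n - z)) \<longlonglongrightarrow> 0" by blast
  have lim: "(\<lambda>n. nrm (Z n - z)) \<longlonglongrightarrow> 0"
    unfolding nrm_def using tendsto_real_sqrt[OF lim] by simp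
  have RZ: "nrm (R (Z n)) \<le> 1 / (real n + 1) * nrm x" for n
  proof -
    have "R (Z n) = pol (pX * pY ^ n) x" using x by (simp add: Z_def)
    also have "nrm \<dots> \<le> 1 / (real n + 1) * nrm x"
    proof (rule pol_bound[OF x])
      fix r :: real assume r: "0 \<le> r" "r \<le> 1"
      \<comment> \<open>Bernoulli together with \<open>(1 - r)^n (1 + r)^n \<le> 1\<close> shows
        \<open>(1 - r)^n \<le> 1 / (1 + n r)\<close>; multiplication by \<open>r\<close> gives at
        most \<open>1 / (n + 1)\<close>.\<close>
      have "1 + real n * r \<le> (1 + r) ^ n"
        using Bernoulli_inequality[of r n] r by (simp add: mult.commute)
      then have "(1 - r) ^ n * (1 + real n * r) \<le> (1 - r) ^ n * (1 + r) ^ n"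
        by (rule mult_left_mono) (use r in simp)
      also have "\<dots> = (1 - r\<^sup>2) ^ n"
        unfolding power_mult_distrib[symmetric] by (simp add: power2_eq_square algebra_simps)
      also have "\<dots> \<le> 1" using r by (intro power_le_one) (auto simp: power_le_one)
      finally have b: "(1 - r) ^ n * (1 + real n * r) \<le> 1" .
      have "r * (1 - r) ^ n * (real n + 1) \<le> (1 - r) ^ n * (1 + real n * r)"
      proof -
        have "r * (real n + 1) \<le> 1 + real n * r" using r by (simp add: algebra_simps)
        then have "(1 - r) ^ n * (r * (real n + 1)) \<le> (1 - r) ^ n * (1 + real n * r)"
          using r by (intro mult_left_mono) auto
        then show ?thesis by (simp add: algebra_simps)
      qed
      then have "r * (1 - r) ^ n \<le> 1 / (real n + 1)" using b by (simp add: field_simps)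
      then show "\<bar>poly (pX * pY ^ n) r\<bar> \<le> 1 / (real n + 1)"
        using r by (simp add: abs_mult poly_power)
    qed
    finally show ?thesis .
  qed
  have "nrm (R z) \<le> 0"
  proof (rule LIMSEQ_le_const)
    show "(\<lambda>n. nrm (Z n - z) + 1 / (real n + 1) * nrm x) \<longlonglongrightarrow> 0"
    proof -
      have "(\<lambda>n. 1 / (real n + 1)) \<longlonglongrightarrow> 0"
        using LIMSEQ_inverse_real_of_nat by (simp add: inverse_eq_divide add.commute)
      from tendsto_add[OF lim tendsto_mult_left_zero[OF this, of "nrm x"]] show ?thesis by simp
    qed
    have "nrm (R z) \<le> nrm (Z n - z) + 1 / (real n + 1) * nrm x" for n
    proof -
      have "R z = R (z - Z n) + R (Z n)" using z Z by (simp add: R_diff)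
      then have "nrm (R z) \<le> nrm (R (z - Z n)) + nrm (R (Z n))"
        using nrm_triangle[of "R (z - Z n)" "R (Z n)"] z Z by auto
      then show ?thesis using R_bound[of "z - Z n"] RZ[of n] nrm_minus_commute[OF z Z[of n]] z Z
        by (smt (verit) S_diff)
    qed
    then show "\<exists>N. \<forall>n\<ge>N. nrm (R z) \<le> nrm (Z n - z) + 1 / (real n + 1) * nrm x" by blast
  qed
  then have z0: "nrm z = 0" using inj[OF z] z by (metis R_in antisym nrm_nonneg)
  obtain n where "norm (nrm (Z n - z) - 0) < e"
    using LIMSEQ_D[OF lim e] by blast
  then have n: "nrm (Z n - z) < e" by simp
  have "nrm (Z n) \<le> nrm (Z n - z) + nrm z"
    using nrm_triangle[of "Z n - z" z] Z z by auto
  then have Zn: "nrm (Z n) < e" using n z0 by simp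
  \<comment> \<open>The quotient \<open>q\<close> supplies the preimage:
    \<open>x - Z n = R (q(R) x)\<close>.\<close>
  have "poly (1 - pY ^ n) 0 = 0" by (simp add: poly_power)
  then have "pX dvd 1 - pY ^ n" using poly_eq_0_iff_dvd[of "1 - pY ^ n" 0] by simp
  then obtain q where q: "1 - pY ^ n = pX * q" by (elim dvdE)
  have "x - Z n = pol (1 - pY ^ n) x"
    using x by (simp add: Z_def pol_diff one_pCons)
  also have "\<dots> = R (pol q x)" unfolding q using x by (simp add: pol_mult)
  finally have "x - R (pol q x) = Z n" by (simp add: algebra_simps)
  then show ?thesis using Zn x by (intro bexI[of _ "pol q x"]) auto
qed

end

section \<open>Square integrable functions\<close>

lemma square_integrable_mult:
  assumes "square_integrable M f" "square_integrable M g"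
  shows "integrable M (\<lambda>x. f x * g x)"
proof (rule Bochner_Integration.integrable_bound)
  show "integrable M (\<lambda>x. (f x)\<^sup>2 + (g x)\<^sup>2)"
    using assms by (auto simp: square_integrable_def)
  show "(\<lambda>x. f x * g x) \<in> borel_measurable M"
    using assms by (auto simp: square_integrable_def)
  have "\<bar>f x * g x\<bar> \<le> (f x)\<^sup>2 + (g x)\<^sup>2" for x
  proof -
    have "2 * (\<bar>f x\<bar> * \<bar>g x\<bar>) \<le> (f x)\<^sup>2 + (g x)\<^sup>2"
      using sum_squares_bound[of "\<bar>f x\<bar>" "\<bar>g x\<bar>"] by (simp add: mult.assoc)
    moreover have "0 \<le> \<bar>f x\<bar> * \<bar>g x\<bar>" by simp
    ultimately show ?thesis unfolding abs_mult by linarith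
  qed
  then show "AE x in M. norm (f x * g x) \<le> norm ((f x)\<^sup>2 + (g x)\<^sup>2)"
    by simp
qed

lemma square_integrable_add:
  assumes "square_integrable M f" "square_integrable M g"
  shows "square_integrable M (\<lambda>x. f x + g x)"
  using assms square_integrable_mult[OF assms]
  by (auto simp: square_integrable_def power2_sum mult.assoc)

lemma square_integrable_scale: "square_integrable M f \<Longrightarrow> square_integrable M (\<lambda>x. c * f x)"
  by (auto simp: square_integrable_def power_mult_distrib)

lemma square_integrable_diff:
  assumes "square_integrable M f" "square_integrable M g"
  shows "square_integrable M (\<lambda>x. f x - g x)"
  using square_integrable_add[OF assms(1) square_integrable_scale[OF assms(2), of "-1"]] by simp

lemma square_integrable_bounded_mult:
  assumes f: "square_integrable M f" and k: "k \<in> borel_measurable M" and K: "\<And>x. x \<in> space M \<Longrightarrow> \<bar>k x\<bar> \<le> K"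
  shows "square_integrable M (\<lambda>x. k x * f x)"
proof -
  have "integrable M (\<lambda>x. (k x * f x)\<^sup>2)"
  proof (rule Bochner_Integration.integrable_bound)
    show "integrable M (\<lambda>x. K\<^sup>2 * (f x)\<^sup>2)" using f by (auto simp: square_integrable_def)
    show "(\<lambda>x. (k x * f x)\<^sup>2) \<in> borel_measurable M" using f k by (auto simp: square_integrable_def)
    have "(k x * f x)\<^sup>2 \<le> K\<^sup>2 * (f x)\<^sup>2" if "x \<in> space M" for x
      using power_mono[OF K[OF that], of 2] by (simp add: power_mult_distrib mult_right_mono)
    then show "AE x in M. norm ((k x * f x)\<^sup>2) \<le> norm (K\<^sup>2 * (f x)\<^sup>2)" by auto
  qed
  then show ?thesis using f k by (auto simp: square_integrable_def)
qed

lemma square_integrable_cong_AE: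
  assumes "AE x in M. f x = g x" "f \<in> borel_measurable M" "square_integrable M g"
  shows "square_integrable M f"
proof -
  have "integrable M (\<lambda>x. (f x)\<^sup>2)"
    by (rule integrable_cong_AE_imp[where g="\<lambda>x. (g x)\<^sup>2"]) (use assms in \<open>auto simp: square_integrable_def\<close>)
  then show ?thesis using assms by (simp add: square_integrable_def)
qed

text \<open>Riesz-Fischer. The subsequence converging almost everywhere is part of the conclusion
  because the limit in the form domain has to be identified pointwise.\<close>

lemma L2_Cauchy_limit:
  fixes X :: "nat \<Rightarrow> 'a \<Rightarrow> real"
  assumes X: "\<And>n. square_integrable M (X n)"
    and C: "\<And>e. e > 0 \<Longrightarrow> \<exists>N. \<forall>m\<ge>N. \<forall>n\<ge>N. (\<integral>x. (X m x - X n x)\<^sup>2 \<partial>M) < e"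
  shows "\<exists>y r. square_integrable M y \<and> (\<lambda>n. \<integral>x. (X n x - y x)\<^sup>2 \<partial>M) \<longlonglongrightarrow> 0 \<and>
    strict_mono r \<and> (AE x in M. (\<lambda>i::nat. X (r i) x) \<longlonglongrightarrow> y x)"
proof -
  have [measurable]: "X n \<in> borel_measurable M" for n
    using X by (simp add: square_integrable_def)
  have D: "integrable M (\<lambda>x. (X m x - X n x)\<^sup>2)" for m n
    using square_integrable_diff[OF X X] by (simp add: square_integrable_def)
  have nnD: "(\<integral>\<^sup>+x. ennreal ((X m x - X n x)\<^sup>2) \<partial>M) = ennreal (\<integral>x. (X m x - X n x)\<^sup>2 \<partial>M)" for m n
    by (intro nn_integral_eq_integral D) simp
  define ok where "ok N i \<longleftrightarrow> (\<forall>m\<ge>N. \<forall>n\<ge>N. (\<integral>x. (X m x - X n x)\<^sup>2 \<partial>M) < (1/8)^i)" for N i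
  have "\<exists>r. \<forall>i. ok (r i) i \<and> r i < r (Suc i)"
  proof (rule dependent_nat_choice)
    show "\<exists>x. ok x 0" using C[of 1] by (auto simp: ok_def)
    fix x i
    obtain N where "ok N (Suc i)" using C[of "(1/8)^Suc i"] by (auto simp: ok_def)
    then have "ok (max N (Suc x)) (Suc i)" unfolding ok_def by simp
    then show "\<exists>y. ok y (Suc i) \<and> x < y" by (intro exI[of _ "max N (Suc x)"]) auto
  qed
  then obtain r where ok: "\<And>i. ok (r i) i" and rS: "\<And>i. r i < r (Suc i)" by blast
  have r: "strict_mono r" using rS by (simp add: strict_mono_Suc_iff)
  let ?d = "\<lambda>i x. X (r (Suc i)) x - X (r i) x"
  \<comment> \<open>The squared increments have integral at most \<open>(1/8)^i\<close>. With the
    weight \<open>4^i\<close> they remain summable, while a finite value \<open>G x\<close> bounds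
    the increments at \<open>x\<close> by \<open>sqrt (G x) (1/2)^i\<close>.\<close>
  define G where "G x = (\<Sum>i. ennreal (4 ^ i) * ennreal ((?d i x)\<^sup>2))" for x
  have "(\<integral>\<^sup>+x. G x \<partial>M) = (\<Sum>i. \<integral>\<^sup>+x. ennreal (4 ^ i) * ennreal ((?d i x)\<^sup>2) \<partial>M)"
    unfolding G_def by (intro nn_integral_suminf) measurable
  also have "\<dots> = (\<Sum>i. ennreal (4 ^ i) * ennreal (\<integral>x. (?d i x)\<^sup>2 \<partial>M))"
    by (intro suminf_cong) (simp add: nn_integral_cmult nnD)
  also have "\<dots> \<le> (\<Sum>i. ennreal ((1/2) ^ i))"
  proof (intro suminf_le summableI)
    fix i
    have "(\<integral>x. (?d i x)\<^sup>2 \<partial>M) \<le> (1/8)^i"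
      using ok[of i] rS[of i] unfolding ok_def by (simp add: less_imp_le)
    then have "ennreal (4 ^ i) * ennreal (\<integral>x. (?d i x)\<^sup>2 \<partial>M) \<le> ennreal (4 ^ i) * ennreal ((1/8)^i)"
      by (intro mult_left_mono ennreal_leI) auto
    also have "\<dots> = ennreal ((1/2)^i)"
      by (simp add: ennreal_mult[symmetric] power_mult_distrib[symmetric])
    finally show "ennreal (4 ^ i) * ennreal (\<integral>x. (?d i x)\<^sup>2 \<partial>M) \<le> ennreal ((1/2)^i)" .
  qed
  also have "\<dots> = ennreal (\<Sum>i. (1/2) ^ i)"
    by (intro suminf_ennreal2) (auto intro: summable_geometric)
  finally have "(\<integral>\<^sup>+x. G x \<partial>M) \<noteq> \<infinity>" by (auto simp: top_unique)
  moreover have "G \<in> borel_measurable M" unfolding G_def by measurable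
  ultimately have "AE x in M. G x \<noteq> \<infinity>" by (intro nn_integral_PInf_AE)
  then have conv: "AE x in M. (\<lambda>i. X (r i) x) \<longlonglongrightarrow> lim (\<lambda>i. X (r i) x)"
  proof eventually_elim
    fix x assume "G x \<noteq> \<infinity>"
    then obtain g where g: "G x = ennreal g" "0 \<le> g" by (cases "G x") auto
    have "norm (?d i x) \<le> sqrt g * (1/2) ^ i" for i
    proof -
      have "ennreal (4 ^ i * (?d i x)\<^sup>2) \<le> G x"
        unfolding G_def ennreal_mult' [of "4 ^ i", simplified]
        using sum_le_suminf[of "\<lambda>i. ennreal (4 ^ i) * ennreal ((?d i x)\<^sup>2)" "{i}"] by (simp add: ennreal_mult)
      then have "4 ^ i * (?d i x)\<^sup>2 \<le> g" using g by simp
      then have "(2 ^ i * \<bar>?d i x\<bar>)\<^sup>2 \<le> g"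
        by (simp add: power_mult_distrib power_mult[symmetric] mult.commute[of _ 2] power_mult)
      then have "2 ^ i * \<bar>?d i x\<bar> \<le> sqrt g" by (rule real_le_rsqrt)
      then show ?thesis by (simp add: power_divide field_simps)
    qed
    then have "summable (\<lambda>i. ?d i x)"
      by (rule summable_comparison_test'[of "\<lambda>i. sqrt g * (1/2) ^ i" 0, rotated])
        (intro summable_mult summable_geometric, simp)
    then have "convergent (\<lambda>n. \<Sum>i<n. ?d i x)" by (simp add: summable_iff_convergent)
    then have "convergent (\<lambda>n. (\<Sum>i<n. ?d i x) + X (r 0) x)"
      by (intro convergent_add convergent_const)
    moreover have "(\<Sum>i<n. ?d i x) + X (r 0) x = X (r n) x" for n
      using sum_lessThan_telescope[of "\<lambda>i. X (r i) x" n] by simp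
    ultimately have "convergent (\<lambda>n. X (r n) x)" by simp
    then show "(\<lambda>i. X (r i) x) \<longlonglongrightarrow> lim (\<lambda>i. X (r i) x)" by (simp add: convergent_LIMSEQ_iff)
  qed
  define y where "y x = lim (\<lambda>i. X (r i) x)" for x
  have [measurable]: "y \<in> borel_measurable M" unfolding y_def by measurable
  have conv: "AE x in M. (\<lambda>i. X (r i) x) \<longlonglongrightarrow> y x" using conv by (simp add: y_def)
  \<comment> \<open>Fatou's lemma along the subsequence: the Cauchy bound between \<open>X n\<close>
    and \<open>X (r i)\<close> survives \<open>i \<rightarrow> \<infinity>\<close>.\<close>
  have le: "(\<integral>\<^sup>+x. ennreal ((X n x - y x)\<^sup>2) \<partial>M) \<le> ennreal e"
    if N: "\<forall>m\<ge>N. \<forall>n\<ge>N. (\<integral>x. (X m x - X n x)\<^sup>2 \<partial>M) < e" and n: "n \<ge> N" for n N e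
  proof -
    have "(\<integral>\<^sup>+x. ennreal ((X n x - y x)\<^sup>2) \<partial>M)
        = (\<integral>\<^sup>+x. liminf (\<lambda>i. ennreal ((X n x - X (r i) x)\<^sup>2)) \<partial>M)"
    proof (rule nn_integral_cong_AE)
      show "AE x in M. ennreal ((X n x - y x)\<^sup>2) = liminf (\<lambda>i. ennreal ((X n x - X (r i) x)\<^sup>2))"
        using conv
      proof eventually_elim
        fix x assume "(\<lambda>i. X (r i) x) \<longlonglongrightarrow> y x"
        then have "(\<lambda>i. ennreal ((X n x - X (r i) x)\<^sup>2)) \<longlonglongrightarrow> ennreal ((X n x - y x)\<^sup>2)"
          by (intro tendsto_intros)
        then show "ennreal ((X n x - y x)\<^sup>2) = liminf (\<lambda>i. ennreal ((X n x - X (r i) x)\<^sup>2))"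
          using lim_imp_Liminf[OF sequentially_bot] by metis
      qed
    qed
    also have "\<dots> \<le> liminf (\<lambda>i. \<integral>\<^sup>+x. ennreal ((X n x - X (r i) x)\<^sup>2) \<partial>M)"
      by (intro nn_integral_liminf) measurable
    also have "\<dots> \<le> ennreal e"
    proof -
      have "\<forall>\<^sub>F i in sequentially. (\<integral>\<^sup>+x. ennreal ((X n x - X (r i) x)\<^sup>2) \<partial>M) \<le> ennreal e"
        using eventually_ge_at_top[of N]
      proof eventually_elim
        fix i assume "N \<le> i"
        then have "N \<le> r i" using seq_suble[OF r, of i] by linarith
        then show "(\<integral>\<^sup>+x. ennreal ((X n x - X (r i) x)\<^sup>2) \<partial>M) \<le> ennreal e"
          unfolding nnD using N n by (intro ennreal_leI) (simp add: less_imp_le)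
      qed
      then have "liminf (\<lambda>i. \<integral>\<^sup>+x. ennreal ((X n x - X (r i) x)\<^sup>2) \<partial>M) \<le> liminf (\<lambda>i::nat. ennreal e)"
        by (intro Liminf_mono)
      then show ?thesis by (simp add: Liminf_const)
    qed
    finally show ?thesis .
  qed
  have sqd: "square_integrable M (\<lambda>x. X n x - y x)" if N: "\<forall>m\<ge>N. \<forall>n\<ge>N. (\<integral>x. (X m x - X n x)\<^sup>2 \<partial>M) < e" and n: "n \<ge> N" for n N e
  proof -
    have "(\<integral>\<^sup>+x. ennreal ((X n x - y x)\<^sup>2) \<partial>M) < \<infinity>"
      using le[OF N n] by (auto simp: less_top[symmetric] top_unique)
    then have "integrable M (\<lambda>x. (X n x - y x)\<^sup>2)"
      by (intro integrableI_bounded) auto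
    then show ?thesis by (simp add: square_integrable_def)
  qed
  obtain N1 where N1: "\<forall>m\<ge>N1. \<forall>n\<ge>N1. (\<integral>x. (X m x - X n x)\<^sup>2 \<partial>M) < 1" using C[of 1] by auto
  have y: "square_integrable M y"
    using square_integrable_diff[OF X[of N1] sqd[OF N1 order_refl]] by simp
  have "(\<lambda>n. \<integral>x. (X n x - y x)\<^sup>2 \<partial>M) \<longlonglongrightarrow> 0"
  proof (rule LIMSEQ_I)
    fix e :: real assume e: "e > 0"
    obtain N where N: "\<forall>m\<ge>N. \<forall>n\<ge>N. (\<integral>x. (X m x - X n x)\<^sup>2 \<partial>M) < e / 2" using C[of "e/2"] e by auto
    have "norm ((\<integral>x. (X n x - y x)\<^sup>2 \<partial>M) - 0) < e" if n: "n \<ge> N" for n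
    proof -
      have "ennreal (\<integral>x. (X n x - y x)\<^sup>2 \<partial>M) = (\<integral>\<^sup>+x. ennreal ((X n x - y x)\<^sup>2) \<partial>M)"
        using sqd[OF N n] by (intro nn_integral_eq_integral[symmetric]) (auto simp: square_integrable_def)
      also have "\<dots> \<le> ennreal (e/2)" by (rule le[OF N n])
      finally have "(\<integral>x. (X n x - y x)\<^sup>2 \<partial>M) \<le> e / 2" using e by (simp add: ennreal_le_iff)
      then show ?thesis using e by simp
    qed
    then show "\<exists>no. \<forall>n\<ge>no. norm ((\<integral>x. (X n x - y x)\<^sup>2 \<partial>M) - 0) < e" by blast
  qed
  with y r conv show ?thesis by blast
qed

section \<open>Square integrable functions as a semi-Hilbert space\<close>

definition L2 :: "'a measure \<Rightarrow> ('a \<Rightarrow> real) set" where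
  "L2 M = {f. square_integrable M f}"

definition L2_ip :: "'a measure \<Rightarrow> ('a \<Rightarrow> real) \<Rightarrow> ('a \<Rightarrow> real) \<Rightarrow> real" where
  "L2_ip M f g = (\<integral>x. f x * g x \<partial>M)"

lemma semi_hilbert_L2: "semi_hilbert (L2 M) (L2_ip M)"
proof
  show "subspace (L2 M)"
    unfolding subspace_def L2_def
    by (auto simp: plus_fun_def zero_fun_def scaleR_fun_def square_integrable_add square_integrable_scale)
      (simp add: square_integrable_def)
  show "L2_ip M (x + y) z = L2_ip M x z + L2_ip M y z" if "x \<in> L2 M" "y \<in> L2 M" "z \<in> L2 M" for x y z
    using that by (simp add: L2_ip_def L2_def distrib_right square_integrable_mult)
  show "L2_ip M (c *\<^sub>R x) z = c * L2_ip M x z" for x z c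
    by (simp add: L2_ip_def mult.assoc)
  show "L2_ip M x y = L2_ip M y x" for x y
    by (simp add: L2_ip_def mult.commute)
  show "0 \<le> L2_ip M x x" for x
    by (simp add: L2_ip_def)
  fix X :: "nat \<Rightarrow> 'a \<Rightarrow> real"
  assume X: "\<And>n. X n \<in> L2 M"
    and C: "\<And>e. e > 0 \<Longrightarrow> \<exists>N. \<forall>m\<ge>N. \<forall>n\<ge>N. L2_ip M (X m - X n) (X m - X n) < e"
  have [simp]: "L2_ip M (x - y) (x - y) = (\<integral>z. (x z - y z)\<^sup>2 \<partial>M)" for x y
    by (simp add: L2_ip_def power2_eq_square fun_diff_def)
  show "\<exists>x\<in>L2 M. (\<lambda>n. L2_ip M (X n - x) (X n - x)) \<longlonglongrightarrow> 0"
    using L2_Cauchy_limit[of M X] X C by (force simp: L2_def)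
qed

interpretation L2: semi_hilbert "L2 M" "L2_ip M" for M
  by (rule semi_hilbert_L2)

lemma L2_nrm_eq: "L2.nrm M f = L2_norm_on M f"
  by (simp add: L2.nrm_def L2_norm_on_def L2_ip_def power2_eq_square)

lemma L2_nrm_eq_0_iff:
  assumes "square_integrable M f"
  shows "L2.nrm M f = 0 \<longleftrightarrow> (AE x in M. f x = 0)"
proof -
  have "L2.nrm M f = 0 \<longleftrightarrow> (\<integral>x. (f x)\<^sup>2 \<partial>M) = 0"
    by (simp add: L2_nrm_eq L2_norm_on_def)
  also have "\<dots> \<longleftrightarrow> (AE x in M. (f x)\<^sup>2 = 0)"
    using assms by (intro integral_nonneg_eq_0_iff_AE) (auto simp: square_integrable_def)
  finally show ?thesis by simp
qed

section \<open>Primitives of locally integrable functions\<close>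

text \<open>Local absolute continuity with the density kept as data. Only increments inside
  \<open>I\<close> matter, and integrability is stated explicitly because the integral of a
  non-integrable function is 0 by convention.\<close>

definition primitive_on :: "real set \<Rightarrow> (real \<Rightarrow> real) \<Rightarrow> (real \<Rightarrow> real) \<Rightarrow> bool" where
  "primitive_on I F f \<longleftrightarrow> (\<forall>x y. x \<le> y \<and> {x..y} \<subseteq> I \<longrightarrow>
     set_integrable lborel {x..y} f \<and> F y - F x = (LBINT z:{x..y}. f z))"

lemma primitive_onD:
  assumes "primitive_on I F f" "x \<le> y" "{x..y} \<subseteq> I"
  shows "set_integrable lborel {x..y} f" "F y - F x = (LBINT z:{x..y}. f z)"
  using assms by (auto simp: primitive_on_def)

lemma Icc_subset_interval: "is_interval I \<Longrightarrow> x \<in> I \<Longrightarrow> y \<in> I \<Longrightarrow> {x..y} \<subseteq> (I::real set)"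
  by (rule subsetI, rule mem_is_interval_1_I[of I x y]) simp_all

lemma L1_loc_on_Icc: "L1_loc_on I f \<Longrightarrow> {x..y} \<subseteq> I \<Longrightarrow> set_integrable lborel {x..y} f"
  by (simp add: L1_loc_on_def)

lemma L1_loc_onI:
  assumes I: "is_interval I" and f: "\<And>x y. x \<le> y \<Longrightarrow> {x..y} \<subseteq> I \<Longrightarrow> set_integrable lborel {x..y} f"
  shows "L1_loc_on I f"
  unfolding L1_loc_on_def
proof (intro allI impI)
  fix K assume K: "compact K \<and> K \<subseteq> I"
  show "set_integrable lborel K f"
  proof (cases "K = {}")
    case False
    obtain c where c: "c \<in> K" "\<And>x. x \<in> K \<Longrightarrow> c \<le> x" using compact_attains_inf[of K] K False by blast
    obtain d where d: "d \<in> K" "\<And>x. x \<in> K \<Longrightarrow> x \<le> d" using compact_attains_sup[of K] K False by blast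
    have "set_integrable lborel {c..d} f"
      using c d K by (intro f Icc_subset_interval I) auto
    then show ?thesis
      by (rule set_integrable_subset) (use c d K in \<open>auto simp: compact_imp_closed\<close>)
  qed (simp add: set_integrable_def)
qed

lemma interval_integral_primitive:
  assumes I: "is_interval I" and f: "L1_loc_on I f" and x0: "x0 \<in> I"
  shows "primitive_on I (\<lambda>x. LBINT z=ereal x0..ereal x. f z) f"
  unfolding primitive_on_def
proof (intro allI impI conjI; elim conjE)
  fix x y :: real assume xy: "x \<le> y" "{x..y} \<subseteq> I"
  show "set_integrable lborel {x..y} f" using f xy(2) by (rule L1_loc_on_Icc)
  define c d where "c = min x0 x" and "d = max x0 y"
  have "{c..d} \<subseteq> I" using xy x0 by (intro Icc_subset_interval I) (auto simp: c_def d_def min_def max_def)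
  then have "set_integrable lborel {c..d} f" by (rule L1_loc_on_Icc[OF f])
  then have "set_integrable lborel (einterval (ereal c) (ereal d)) f"
    by (rule set_integrable_subset) auto
  moreover have "min (ereal x0) (min (ereal x) (ereal y)) = ereal c" "max (ereal x0) (max (ereal x) (ereal y)) = ereal d"
    using xy by (auto simp: c_def d_def min_def max_def)
  moreover have "c \<le> d" using xy by (auto simp: c_def d_def)
  ultimately have "interval_lebesgue_integrable lborel (min (ereal x0) (min (ereal x) (ereal y))) (max (ereal x0) (max (ereal x) (ereal y))) f"
    by (simp add: interval_lebesgue_integrable_def)
  from interval_integral_sum[OF this]
  show "(LBINT z=ereal x0..ereal y. f z) - (LBINT z=ereal x0..ereal x. f z) = (LBINT z:{x..y}. f z)"
    using interval_integral_Icc[OF xy(1), of f] by simp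
qed

lemma primitive_on_lincomb:
  assumes "primitive_on I F f" "primitive_on I G g"
  shows "primitive_on I (\<lambda>x. a * F x + b * G x) (\<lambda>x. a * f x + b * g x)"
  unfolding primitive_on_def
proof (intro allI impI conjI; elim conjE)
  fix x y :: real assume xy: "x \<le> y" "{x..y} \<subseteq> I"
  have f: "set_integrable lborel {x..y} (\<lambda>x. a * f x)" and g: "set_integrable lborel {x..y} (\<lambda>x. b * g x)"
    using primitive_onD(1)[OF assms(1) xy] primitive_onD(1)[OF assms(2) xy] by auto
  then show "set_integrable lborel {x..y} (\<lambda>x. a * f x + b * g x)"
    by (rule set_integral_add(1))
  show "a * F y + b * G y - (a * F x + b * G x) = (LBINT z:{x..y}. a * f z + b * g z)"
    unfolding set_integral_add(2)[OF f g] set_integral_mult_right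
    using primitive_onD(2)[OF assms(1) xy] primitive_onD(2)[OF assms(2) xy]
    by (simp add: algebra_simps flip: right_diff_distrib)
qed

text \<open>The density may change on a null set; measurability of \<open>g\<close> then carries
  integrability across.\<close>

lemma primitive_on_cong:
  assumes F: "primitive_on I F f" and FG: "\<And>x. x \<in> I \<Longrightarrow> F x = G x"
    and fg: "AE x in lborel. x \<in> I \<longrightarrow> f x = g x" and g: "set_borel_measurable borel I g" and I: "I \<in> sets borel"
  shows "primitive_on I G g"
  unfolding primitive_on_def
proof (intro allI impI conjI; elim conjE)
  fix x y :: real assume xy: "x \<le> y" "{x..y} \<subseteq> I"
  have ae: "AE z in lborel. indicator {x..y} z *\<^sub>R f z = indicator {x..y} z *\<^sub>R g z"
    using fg by eventually_elim (use xy in \<open>auto split: split_indicator\<close>)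
  have m: "(\<lambda>z. indicator {x..y} z *\<^sub>R g z) \<in> borel_measurable lborel"
  proof -
    have "(\<lambda>z. indicator {x..y} z *\<^sub>R (indicator I z *\<^sub>R g z)) \<in> borel_measurable lborel"
      using borel_measurable_scaleR[of "indicator {x..y}" lborel "\<lambda>z. indicator I z *\<^sub>R g z"] g
      by (simp add: set_borel_measurable_def)
    moreover have "(\<lambda>z. indicator {x..y} z *\<^sub>R (indicator I z *\<^sub>R g z)) = (\<lambda>z. indicator {x..y} z *\<^sub>R g z)"
      using xy by (auto split: split_indicator simp: fun_eq_iff)
    ultimately show ?thesis by simp
  qed
  have f: "integrable lborel (\<lambda>z. indicator {x..y} z *\<^sub>R f z)"
    using primitive_onD(1)[OF F xy] by (simp add: set_integrable_def)
  show "set_integrable lborel {x..y} g"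
    unfolding set_integrable_def by (rule integrable_cong_AE_imp[OF f m]) (use ae in auto)
  have "(LBINT z:{x..y}. f z) = (LBINT z:{x..y}. g z)"
    unfolding set_lebesgue_integral_def by (rule integral_cong_AE) (use f m ae in auto)
  then show "G y - G x = (LBINT z:{x..y}. g z)"
    using primitive_onD(2)[OF F xy] FG[of x] FG[of y] xy(1) subsetD[OF xy(2), of x] subsetD[OF xy(2), of y]
    by simp
qed

lemma primitive_on_cong_on:
  assumes "primitive_on I F f" "\<And>x. x \<in> I \<Longrightarrow> F x = G x" "\<And>x. x \<in> I \<Longrightarrow> f x = g x"
  shows "primitive_on I G g"
  unfolding primitive_on_def set_integrable_def set_lebesgue_integral_def
proof (intro allI impI; elim conjE)
  fix x y :: real assume xy: "x \<le> y" "{x..y} \<subseteq> I"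
  have "(\<lambda>z. indicator {x..y} z *\<^sub>R g z) = (\<lambda>z. indicator {x..y} z *\<^sub>R f z)"
    using xy assms(3) by (auto simp: fun_eq_iff split: split_indicator)
  moreover have "x \<in> I" "y \<in> I" using xy by auto
  ultimately show "integrable lborel (\<lambda>z. indicator {x..y} z *\<^sub>R g z) \<and> G y - G x = (LBINT z. indicator {x..y} z *\<^sub>R g z)"
    using primitive_onD[OF assms(1) xy] assms(2) by (simp add: set_integrable_def set_lebesgue_integral_def)
qed

text \<open>Transfer to the gauge integral, whose indefinite integrals come with continuity and
  differentiability theorems.\<close>

lemma primitive_on_HK:
  assumes F: "primitive_on I F f" and cd: "{c..d} \<subseteq> I" and x: "c \<le> x" "x \<le> d"
  shows "f integrable_on {c..d}" "F x = F c + integral {c..x} f"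
proof -
  have *: "f integrable_on {c..y} \<and> F y - F c = integral {c..y} f" if y: "c \<le> y" "y \<le> d" for y
  proof -
    have sub: "{c..y} \<subseteq> I" using cd y by auto
    show ?thesis
      using set_borel_integral_eq_integral[OF primitive_onD(1)[OF F y(1) sub]] primitive_onD(2)[OF F y(1) sub] by simp
  qed
  show "f integrable_on {c..d}" "F x = F c + integral {c..x} f"
    using *[of d] *[of x] x by (auto simp: algebra_simps)
qed

lemma primitive_on_continuous_Icc:
  assumes F: "primitive_on I F f" and cd: "{c..d} \<subseteq> I"
  shows "continuous_on {c..d} F"
proof (cases "c \<le> d")
  case True
  have "continuous_on {c..d} (\<lambda>x. F c + integral {c..x} f)"
    using primitive_on_HK(1)[OF F cd True] by (intro continuous_intros indefinite_integral_continuous_1) auto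
  then show ?thesis
    by (rule continuous_on_eq) (rule primitive_on_HK(2)[OF F cd, symmetric], simp_all)
qed auto

lemma open_Icc_nhd:
  assumes "open I" "x \<in> (I::real set)"
  obtains c d where "c < x" "x < d" "{c..d} \<subseteq> I"
proof -
  obtain e where e: "e > 0" "cball x e \<subseteq> I" using assms open_contains_cball by metis
  show ?thesis by (rule that[of "x - e" "x + e"]) (use e in \<open>auto simp: cball_eq_atLeastAtMost\<close>)
qed

lemma primitive_on_continuous:
  assumes F: "primitive_on I F f" and I: "open I"
  shows "continuous_on I F"
proof -
  have "continuous (at x) F" if x: "x \<in> I" for x
  proof -
    obtain c d where cd: "c < x" "x < d" "{c..d} \<subseteq> I" using open_Icc_nhd[OF I x] by blast
    show ?thesis
      by (rule continuous_on_interior[OF primitive_on_continuous_Icc[OF F cd(3)]]) (use cd in auto)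
  qed
  then show ?thesis by (simp add: continuous_at_imp_continuous_on)
qed

lemma primitive_on_DERIV:
  assumes F: "primitive_on I F f" and I: "open I" and f: "continuous_on I f" and x: "x \<in> I"
  shows "(F has_real_derivative f x) (at x)"
proof -
  obtain c d where cd: "c < x" "x < d" "{c..d} \<subseteq> I" using open_Icc_nhd[OF I x] by blast
  have "((\<lambda>x. F c + integral {c..x} f) has_real_derivative f x) (at x within {c..d})"
    using DERIV_add[OF DERIV_const integral_has_real_derivative[OF continuous_on_subset[OF f cd(3)], of x]] cd
    by simp
  then have "(F has_real_derivative f x) (at x within {c..d})"
  proof (rule has_field_derivative_transform_within[OF _ zero_less_one])
    show "x \<in> {c..d}" using cd by simp
    show "F c + integral {c..z} f = F z" if "z \<in> {c..d}" for z
      by (rule primitive_on_HK(2)[OF F cd(3), symmetric]) (use that in auto)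
  qed
  then show ?thesis using cd by (simp add: at_within_Icc_at)
qed

text \<open>Lebesgue differentiation in the form for cubes that have \<open>x\<close> as lower
  corner, which in one dimension controls the right difference quotient.\<close>

lemma AE_right_derivative:
  assumes f: "integrable lborel f"
  shows "AE x in lborel. ((\<lambda>h. (LBINT z:{x..x+h}. f z) / h) \<longlongrightarrow> f x) (at_right (0::real))"
proof -
  have int: "set_integrable lborel S f" if "S \<in> sets lborel" for S
    using integrable_mult_indicator[OF that f] by (simp add: set_integrable_def)
  have "f integrable_on cbox a b" for a b :: real
    using set_borel_integral_eq_integral(1)[OF int, of "cbox a b"] by simp
  then obtain N where N: "negligible N"
    "\<And>x e. \<lbrakk>x \<notin> N; 0 < e\<rbrakk> \<Longrightarrow> \<exists>d>0. \<forall>h. 0 < h \<and> h < d \<longrightarrow>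
       norm (integral (cbox x (x + h *\<^sub>R One)) f /\<^sub>R h ^ DIM(real) - f x) < e"
    using integrable_ccontinuous_explicit[of f] by blast
  have ae: "AE x in lborel. x \<notin> N"
    using N(1) by (subst AE_completion_iff[symmetric]) (auto simp: negligible_iff_null_sets intro: AE_not_in)
  then show ?thesis
  proof eventually_elim
    fix x assume x: "x \<notin> N"
    show "((\<lambda>h. (LBINT z:{x..x+h}. f z) / h) \<longlongrightarrow> f x) (at_right (0::real))"
    proof (rule tendstoI)
      fix e :: real assume "e > 0"
      then obtain d where d: "d > 0" "\<And>h. 0 < h \<Longrightarrow> h < d \<Longrightarrow> norm (integral (cbox x (x + h *\<^sub>R One)) f /\<^sub>R h ^ DIM(real) - f x) < e"
        using N(2)[OF x] by metis
      have "\<forall>\<^sub>F h in at_right (0::real). h \<in> {0<..<d}" using d(1) by (rule eventually_at_right_real)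
      then show "\<forall>\<^sub>F h in at_right 0. dist ((LBINT z:{x..x+h}. f z) / h) (f x) < e"
      proof eventually_elim
        fix h assume h: "h \<in> {0<..<d}"
        show "dist ((LBINT z:{x..x+h}. f z) / h) (f x) < e"
          using d(2)[of h] h set_borel_integral_eq_integral(2)[OF int, of "{x..x+h}"]
          by (simp add: dist_real_def divide_inverse mult.commute)
      qed
    qed
  qed
qed

lemma AE_lborel_uminus:
  assumes "AE x in lborel. P (x::real)"
  shows "AE x in lborel. P (- x)"
proof -
  obtain N where N: "N \<in> null_sets lborel" "{x. \<not> P x} \<subseteq> N"
    using assms by (auto elim: AE_E simp: null_sets_def)
  have m: "uminus \<in> measurable lborel (borel :: real measure)" by measurable
  have "emeasure lborel (uminus -` N) = emeasure (distr lborel borel uminus) N"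
    using N by (subst emeasure_distr) auto
  also have "\<dots> = 0" using N by (simp add: lborel_distr_uminus null_sets_def)
  finally have "uminus -` N \<in> null_sets lborel"
    using measurable_sets[OF m, of N] N by (auto simp: null_sets_def)
  then show ?thesis by (rule AE_I') (use N in auto)
qed

text \<open>Cutting \<open>f\<close> off to \<open>{c..d}\<close> makes it integrable on the whole
  line. The right derivative is then \<open>AE_right_derivative\<close>; the left one is the same
  fact for the reflected function \<open>z \<mapsto> g (- z)\<close> at \<open>- x\<close>.\<close>

lemma primitive_on_AE_DERIV_Icc:
  assumes F: "primitive_on I F f" and cd: "{c..d} \<subseteq> I"
  shows "AE x in lborel. c < x \<and> x < d \<longrightarrow> (F has_real_derivative f x) (at x)"
proof (cases "c \<le> d")
  case True
  define g where "g z = indicator {c..d} z * f z" for z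
  have g: "integrable lborel g"
    using primitive_onD(1)[OF F True cd] by (simp add: g_def[abs_def] set_integrable_def)
  have g': "integrable lborel (\<lambda>z. g (- z))"
    using lborel_integrable_real_affine[OF g, of "-1" 0] by simp
  have FI: "F y - F x = (LBINT z:{x..y}. g z)" if "c \<le> x" "x \<le> y" "y \<le> d" for x y
  proof -
    have "F y - F x = (LBINT z:{x..y}. f z)" using that cd by (intro primitive_onD(2)[OF F]) auto
    also have "\<dots> = (LBINT z:{x..y}. g z)"
      using that by (intro set_lebesgue_integral_cong) (auto simp: g_def)
    finally show ?thesis .
  qed
  have "AE x in lborel. ((\<lambda>h. (LBINT z:{x..x+h}. g (- z)) / h) \<longlongrightarrow> g (- x)) (at_right 0)"
    by (rule AE_right_derivative[OF g'])
  from AE_lborel_uminus[OF this]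
  have L: "AE x in lborel. ((\<lambda>h. (LBINT z:{-x..-x+h}. g (- z)) / h) \<longlongrightarrow> g x) (at_right 0)" by simp
  have R: "AE x in lborel. ((\<lambda>h. (LBINT z:{x..x+h}. g z) / h) \<longlongrightarrow> g x) (at_right 0)"
    by (rule AE_right_derivative[OF g])
  show ?thesis
    using L R
  proof eventually_elim
    fix x
    assume L: "((\<lambda>h. (LBINT z:{-x..-x+h}. g (- z)) / h) \<longlongrightarrow> g x) (at_right 0)"
      and R: "((\<lambda>h. (LBINT z:{x..x+h}. g z) / h) \<longlongrightarrow> g x) (at_right 0)"
    show "c < x \<and> x < d \<longrightarrow> (F has_real_derivative f x) (at x)"
    proof
      assume x: "c < x \<and> x < d"
      then have gx: "g x = f x" by (simp add: g_def)
      have "((\<lambda>h. (F (x + h) - F x) / h) \<longlongrightarrow> g x) (at_right 0)"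
      proof (rule Lim_transform_eventually[OF R])
        have "\<forall>\<^sub>F h in at_right (0::real). h \<in> {0<..<d - x}" using x by (intro eventually_at_right_real) simp
        then show "\<forall>\<^sub>F h in at_right 0. (LBINT z:{x..x + h}. g z) / h = (F (x + h) - F x) / h"
          by eventually_elim (use x in \<open>simp add: FI\<close>)
      qed
      moreover have "((\<lambda>h. (F (x + h) - F x) / h) \<longlongrightarrow> g x) (at_left 0)"
      proof -
        have "((\<lambda>h. (F (x - h) - F x) / (- h)) \<longlongrightarrow> g x) (at_right 0)"
        proof (rule Lim_transform_eventually[OF L])
          have "\<forall>\<^sub>F h in at_right (0::real). h \<in> {0<..<x - c}" using x by (intro eventually_at_right_real) simp
          then show "\<forall>\<^sub>F h in at_right 0. (LBINT z:{-x..-x + h}. g (- z)) / h = (F (x - h) - F x) / (- h)"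
          proof eventually_elim
            fix h assume h: "h \<in> {0<..<x - c}"
            have "(LBINT z:{x-h..x}. g z) = (\<integral>z. indicator {x-h..x} (- z) *\<^sub>R g (- z) \<partial>lborel)"
              unfolding set_lebesgue_integral_def
              using lborel_integral_real_affine[of "-1" "\<lambda>z. indicator {x-h..x} z *\<^sub>R g z" 0] by simp
            also have "\<dots> = (LBINT z:{-x..-x+h}. g (- z))"
              unfolding set_lebesgue_integral_def
              by (intro Bochner_Integration.integral_cong) (auto split: split_indicator)
            finally have "F x - F (x - h) = (LBINT z:{-x..-x + h}. g (- z))"
              using FI[of "x - h" x] h x by simp
            then have "(LBINT z:{-x..-x + h}. g (- z)) = - (F (x - h) - F x)" by simp
            then show "(LBINT z:{-x..-x + h}. g (- z)) / h = (F (x - h) - F x) / (- h)"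
              by (simp only: minus_divide_left minus_divide_right)
          qed
        qed
        then show ?thesis
          unfolding at_left_minus[of 0] filterlim_filtermap by simp
      qed
      ultimately have "((\<lambda>h. (F (x + h) - F x) / h) \<longlongrightarrow> g x) (at 0)"
        using filterlim_split_at by blast
      then show "(F has_real_derivative f x) (at x)"
        unfolding gx by (simp add: DERIV_def)
    qed
  qed
qed auto

text \<open>Intervals with rational ends are countably many and every point of \<open>I\<close> is
  interior to one of them inside \<open>I\<close>, so countably many null sets are united.\<close>

lemma AE_open_Icc:
  assumes I: "open I" and Q: "\<And>c d. {c..d} \<subseteq> I \<Longrightarrow> AE x in lborel. c < x \<and> x < d \<longrightarrow> Q x"
  shows "AE x::real in lborel. x \<in> I \<longrightarrow> Q x"
proof -
  define A where "A = {(c, d). c \<in> \<rat> \<and> d \<in> \<rat> \<and> {c..d} \<subseteq> I}"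
  have "countable A"
    by (rule countable_subset[of _ "\<rat> \<times> \<rat>"]) (auto simp: A_def countable_rat)
  then have "AE x in lborel. \<forall>p\<in>A. fst p < x \<and> x < snd p \<longrightarrow> Q x"
    by (subst AE_ball_countable) (auto simp: A_def intro: Q)
  then show ?thesis
  proof eventually_elim
    fix x assume *: "\<forall>p\<in>A. fst p < x \<and> x < snd p \<longrightarrow> Q x"
    show "x \<in> I \<longrightarrow> Q x"
    proof
      assume "x \<in> I"
      then obtain c d where cd: "c < x" "x < d" "{c..d} \<subseteq> I" using open_Icc_nhd[OF I] by blast
      obtain c' where c': "c' \<in> \<rat>" "c < c'" "c' < x" using Rats_dense_in_real[OF cd(1)] by blast
      obtain d' where d': "d' \<in> \<rat>" "x < d'" "d' < d" using Rats_dense_in_real[OF cd(2)] by blast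
      have "(c', d') \<in> A" using c' d' cd by (auto simp: A_def)
      then show "Q x" using * c' d' by force
    qed
  qed
qed

lemma primitive_on_AE_DERIV:
  assumes F: "primitive_on I F f" and I: "open I"
  shows "AE x in lborel. x \<in> I \<longrightarrow> (F has_real_derivative f x) (at x)"
  by (intro AE_open_Icc I primitive_on_AE_DERIV_Icc[OF F])

text \<open>Truncate the absolute density at a level \<open>N\<close>: the excess has integral below
  \<open>e / 2\<close> by dominated convergence, whatever the intervals, and the bounded part
  contributes at most \<open>N\<close> times the total length.\<close>

lemma primitive_on_AC:
  assumes F: "primitive_on I F f"
  shows "AC_loc_on I F"
  unfolding AC_loc_on_def abs_continuous_on_def
proof (intro allI impI; elim conjE)
  fix c d e :: real assume cd: "c \<le> d" "{c..d} \<subseteq> I" and e: "e > 0"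
  define g where "g z = indicator {c..d} z * \<bar>f z\<bar>" for z
  have g: "integrable lborel g"
    using integrable_abs[OF primitive_onD(1)[OF F cd, unfolded set_integrable_def]]
    by (simp add: g_def[abs_def] abs_mult)
  have [measurable]: "g \<in> borel_measurable lborel" using g by auto
  have g0: "0 \<le> g z" for z by (simp add: g_def)
  have intm: "integrable lborel (\<lambda>z. g z - min (g z) (real N))" for N
    by (rule Bochner_Integration.integrable_bound[OF g]) (use g0 in auto)
  have "(\<lambda>N. \<integral>z. g z - min (g z) (real N) \<partial>lborel) \<longlonglongrightarrow> (\<integral>z. 0 \<partial>(lborel :: real measure))"
  proof (rule integral_dominated_convergence[where w=g])
    show "AE z in lborel. (\<lambda>N. g z - min (g z) (real N)) \<longlonglongrightarrow> 0"
    proof (rule AE_I2)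
      fix z
      obtain M :: nat where "g z \<le> real M" using real_arch_simple by blast
      then have "\<forall>N\<ge>M. g z - min (g z) (real N) = 0" by (auto simp: min_def)
      then show "(\<lambda>N. g z - min (g z) (real N)) \<longlonglongrightarrow> 0"
        by (intro tendsto_eventually) (auto simp: eventually_sequentially)
    qed
    show "AE z in lborel. norm (g z - min (g z) (real N)) \<le> g z" for N
      using g0 by (auto simp: min_def)
  qed (use g in auto)
  then obtain N :: nat where "\<bar>\<integral>z. g z - min (g z) (real N) \<partial>lborel\<bar> < e / 2"
    using LIMSEQ_D[of _ 0 "e/2"] e by fastforce
  then have N: "(\<integral>z. g z - min (g z) (real N) \<partial>lborel) < e / 2" by simp
  \<comment> \<open>\<open>N + 1\<close> in place of \<open>N\<close> avoids division by 0.\<close>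
  define \<delta> where "\<delta> = e / (2 * (real N + 1))"
  have \<delta>: "\<delta> > 0" using e by (simp add: \<delta>_def)
  show "\<exists>\<delta>>0. \<forall>(n::nat) y z. (\<forall>i<n. c \<le> y i \<and> y i \<le> z i \<and> z i \<le> d) \<and>
          disjoint_family_on (\<lambda>i. {y i<..<z i}) {..<n} \<and> (\<Sum>i<n. z i - y i) < \<delta> \<longrightarrow>
          (\<Sum>i<n. \<bar>F (z i) - F (y i)\<bar>) < e"
  proof (intro exI[of _ \<delta>] conjI \<delta> allI impI; elim conjE)
    fix n :: nat and y z :: "nat \<Rightarrow> real"
    assume yz: "\<forall>i<n. c \<le> y i \<and> y i \<le> z i \<and> z i \<le> d"
      and dj: "disjoint_family_on (\<lambda>i. {y i<..<z i}) {..<n}" and le: "(\<Sum>i<n. z i - y i) < \<delta>"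
    let ?h = "\<lambda>z. g z - min (g z) (real N)"
    have hint: "integrable lborel (\<lambda>w. indicator {y i<..<z i} w * ?h w)" for i
      using integrable_mult_indicator[OF _ intm, of "{y i<..<z i}" N] by simp
    have one: "\<bar>F (z i) - F (y i)\<bar> \<le> (\<integral>w. indicator {y i<..<z i} w * ?h w \<partial>lborel) + real N * (z i - y i)"
      if i: "i < n" for i
    proof -
      have yzi: "y i \<le> z i" "{y i..z i} \<subseteq> {c..d}" using yz i by auto
      then have yzi: "y i \<le> z i" "{y i..z i} \<subseteq> I" using cd(2) by blast+
      have "F (z i) - F (y i) = (LBINT w:{y i..z i}. f w)" by (rule primitive_onD(2)[OF F yzi])
      also have "\<dots> = (LBINT w:{y i<..<z i}. f w)"
        by (intro set_integral_discrete_difference[where X="{y i, z i}"]) auto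
      finally have "\<bar>F (z i) - F (y i)\<bar> = \<bar>LBINT w:{y i<..<z i}. f w\<bar>" by simp
      also have "\<dots> \<le> (\<integral>w. \<bar>indicator {y i<..<z i} w *\<^sub>R f w\<bar> \<partial>lborel)"
        unfolding set_lebesgue_integral_def by (rule integral_abs_bound)
      also have "\<dots> \<le> (\<integral>w. indicator {y i<..<z i} w * ?h w + real N * indicator {y i<..<z i} w \<partial>lborel)"
      proof (rule integral_mono)
        have "set_integrable lborel {y i<..<z i} f"
          by (rule set_integrable_subset[OF primitive_onD(1)[OF F yzi]]) auto
        then show "integrable lborel (\<lambda>w. \<bar>indicator {y i<..<z i} w *\<^sub>R f w\<bar>)"
          unfolding set_integrable_def by (rule integrable_abs)
        show "integrable lborel (\<lambda>w. indicator {y i<..<z i} w * ?h w + real N * indicator {y i<..<z i} w)"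
          using yzi by (intro Bochner_Integration.integrable_add hint integrable_mult_right) auto
        show "\<bar>indicator {y i<..<z i} w *\<^sub>R f w\<bar> \<le> indicator {y i<..<z i} w * ?h w + real N * indicator {y i<..<z i} w" for w
          using yz i by (force simp: g_def split: split_indicator)
      qed
      also have "\<dots> = (\<integral>w. indicator {y i<..<z i} w * ?h w \<partial>lborel) + real N * (z i - y i)"
        using hint[of i] yzi by (subst Bochner_Integration.integral_add) auto
      finally show ?thesis .
    qed
    have "(\<Sum>i<n. \<bar>F (z i) - F (y i)\<bar>) \<le> (\<Sum>i<n. (\<integral>w. indicator {y i<..<z i} w * ?h w \<partial>lborel) + real N * (z i - y i))"
      using one by (intro sum_mono) auto
    also have "\<dots> = (\<integral>w. (\<Sum>i<n. indicator {y i<..<z i} w) * ?h w \<partial>lborel) + real N * (\<Sum>i<n. z i - y i)"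
      unfolding sum.distrib sum_distrib_right
      by (subst Bochner_Integration.integral_sum[OF hint]) (simp add: sum_distrib_left)
    also have "(\<integral>w. (\<Sum>i<n. indicator {y i<..<z i} w) * ?h w \<partial>lborel) \<le> (\<integral>w. ?h w \<partial>lborel)"
    proof (rule integral_mono[OF _ intm])
      show "integrable lborel (\<lambda>w. (\<Sum>i<n. indicator {y i<..<z i} w) * ?h w)"
        unfolding sum_distrib_right by (intro Bochner_Integration.integrable_sum hint)
      fix w
      have "(\<Sum>i<n. indicator {y i<..<z i} w) = (indicator (\<Union>i<n. {y i<..<z i}) w :: real)"
        by (rule indicator_UN_disjoint[OF _ dj, symmetric]) simp
      also have "\<dots> \<le> 1" by (simp add: indicator_le_1)
      finally show "(\<Sum>i<n. indicator {y i<..<z i} w) * ?h w \<le> ?h w"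
        using g0 by (intro mult_left_le_one_le) (auto intro: sum_nonneg)
    qed
    also note N
    also have "real N * (\<Sum>i<n. z i - y i) \<le> e / 2"
    proof -
      have "real N * (\<Sum>i<n. z i - y i) \<le> real N * \<delta>" using le by (intro mult_left_mono) auto
      also have "\<dots> \<le> (real N + 1) * \<delta>" using \<delta> by (intro mult_right_mono) auto
      also have "\<dots> = e / 2"
      proof -
        have "real N + 1 \<noteq> 0" by linarith
        then show ?thesis unfolding \<delta>_def by (metis mult.commute nonzero_mult_divide_mult_cancel_left times_divide_eq_right)
      qed
      finally show ?thesis .
    qed
    finally show "(\<Sum>i<n. \<bar>F (z i) - F (y i)\<bar>) < e" by simp
  qed
qed

text \<open>\<open>F\<close> and \<open>G\<close> are only absolutely continuous, so the product
  rule is replaced by Fubini: the integral of \<open>f x * g y\<close> over the square is split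
  along the diagonal. \<open>A\<close> takes the triangle with the diagonal and \<open>B\<close> the
  rest, hence the half-open interval in the integral of \<open>B\<close>.\<close>

lemma primitive_on_by_parts:
  assumes F: "primitive_on I F f" and G: "primitive_on I G g" and cd: "c \<le> d" "{c..d} \<subseteq> I"
  shows "F d * G d - F c * G c = (LBINT z:{c..d}. f z * G z) + (LBINT z:{c..d}. F z * g z)"
proof -
  define f' g' where "f' z = indicator {c..d} z * f z" and "g' z = indicator {c..d} z * g z" for z
  have f': "integrable lborel f'" and g': "integrable lborel g'"
    using primitive_onD(1)[OF F cd] primitive_onD(1)[OF G cd] by (simp_all add: f'_def[abs_def] g'_def[abs_def] set_integrable_def)
  have [measurable]: "f' \<in> borel_measurable borel" "g' \<in> borel_measurable borel" using f' g' by auto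
  have P: "integrable (lborel \<Otimes>\<^sub>M lborel) (\<lambda>(x, y). f' x * g' y)"
  proof (rule lborel_pair.Fubini_integrable)
    show "integrable lborel (\<lambda>x. \<integral>y. norm (case (x, y) of (x, y) \<Rightarrow> f' x * g' y) \<partial>lborel)"
      using f' by (simp add: abs_mult)
    show "AE x in lborel. integrable lborel (\<lambda>y. case (x, y) of (x, y) \<Rightarrow> f' x * g' y)"
      using g' by simp
  qed measurable
  define A where "A x y = (if y \<le> x then f' x * g' y else 0)" for x y
  define B where "B x y = (if y \<le> x then 0 else f' x * g' y)" for x y
  have [measurable]: "(\<lambda>(x, y). A x y) \<in> borel_measurable (lborel \<Otimes>\<^sub>M lborel)"
    "(\<lambda>(x, y). B x y) \<in> borel_measurable (lborel \<Otimes>\<^sub>M lborel)"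
    unfolding A_def B_def by measurable
  have A: "integrable (lborel \<Otimes>\<^sub>M lborel) (case_prod A)"
    by (rule Bochner_Integration.integrable_bound[OF P]) (auto simp: A_def)
  have B: "integrable (lborel \<Otimes>\<^sub>M lborel) (case_prod B)"
    by (rule Bochner_Integration.integrable_bound[OF P]) (auto simp: B_def)
  have Fz: "F z - F c = (LBINT w:{c..z}. f w)" "G z - G c = (LBINT w:{c..z}. g w)" if "z \<in> {c..d}" for z
    using that cd by (auto intro!: primitive_onD(2)[OF F] primitive_onD(2)[OF G])
  have iA: "(\<integral>y. A x y \<partial>lborel) = f' x * (G x - G c)" for x
  proof (cases "x \<in> {c..d}")
    case True
    have "(\<integral>y. A x y \<partial>lborel) = (\<integral>y. f' x * (indicator {c..x} y * g y) \<partial>lborel)"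
      using True by (intro Bochner_Integration.integral_cong) (auto simp: A_def g'_def split: split_indicator)
    then show ?thesis using Fz(2)[OF True] by (simp add: set_lebesgue_integral_def)
  next
    case False
    then have "f' x = 0" by (simp add: f'_def)
    then show ?thesis by (simp add: A_def cong: if_cong)
  qed
  have iB: "(\<integral>x. B x y \<partial>lborel) = g' y * (F y - F c)" if "y \<in> {c..d}" for y
  proof -
    have "(\<integral>x. B x y \<partial>lborel) = (\<integral>x. g' y * (indicator {c..<y} x * f x) \<partial>lborel)"
      using that by (intro Bochner_Integration.integral_cong) (auto simp: B_def f'_def split: split_indicator)
    also have "\<dots> = g' y * (LBINT x:{c..<y}. f x)" by (simp add: set_lebesgue_integral_def)
    also have "(LBINT x:{c..<y}. f x) = (LBINT x:{c..y}. f x)"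
      by (intro set_integral_discrete_difference[where X="{y}"]) auto
    finally show ?thesis using Fz(1)[OF that] by simp
  qed
  have iB: "(\<integral>x. B x y \<partial>lborel) = g' y * (F y - F c)" for y
    by (cases "y \<in> {c..d}") (auto simp: iB, auto simp: B_def g'_def cong: if_cong)
  have 1: "integrable lborel (\<lambda>x. f' x * (G x - G c))"
    using lborel_pair.integrable_fst[OF A] by (simp add: iA)
  have 2: "integrable lborel (\<lambda>y. g' y * (F y - F c))"
    using lborel_pair.integrable_snd[OF B] by (simp add: iB)
  have "(F d - F c) * (G d - G c) = (\<integral>x. f' x \<partial>lborel) * (\<integral>y. g' y \<partial>lborel)"
    using Fz[of d] cd by (simp add: f'_def g'_def set_lebesgue_integral_def)
  also have "\<dots> = (\<integral>x. (\<integral>y. f' x * g' y \<partial>lborel) \<partial>lborel)" by simp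
  also have "\<dots> = (\<integral>p. (case p of (x, y) \<Rightarrow> f' x * g' y) \<partial>(lborel \<Otimes>\<^sub>M lborel))"
    by (rule lborel_pair.integral_fst[OF P])
  also have "\<dots> = (\<integral>p. case_prod A p + case_prod B p \<partial>(lborel \<Otimes>\<^sub>M lborel))"
    by (intro Bochner_Integration.integral_cong) (auto simp: A_def B_def)
  also have "\<dots> = (\<integral>x. (\<integral>y. A x y \<partial>lborel) \<partial>lborel) + (\<integral>y. (\<integral>x. B x y \<partial>lborel) \<partial>lborel)"
    unfolding lborel_pair.integral_fst[OF A] lborel_pair.integral_snd[OF B]
    by (rule Bochner_Integration.integral_add[OF A B])
  also have "\<dots> = (\<integral>x. f' x * (G x - G c) \<partial>lborel) + (\<integral>y. g' y * (F y - F c) \<partial>lborel)"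
    by (simp add: iA iB)
  also have "(\<integral>x. f' x * (G x - G c) \<partial>lborel) = (LBINT z:{c..d}. f z * G z) - G c * (F d - F c)"
  proof -
    have "integrable lborel (\<lambda>x. f' x * (G x - G c) + G c * f' x)"
      by (intro Bochner_Integration.integrable_add 1 integrable_mult_right f')
    moreover have "f' x * (G x - G c) + G c * f' x = f' x * G x" for x by (simp add: algebra_simps)
    ultimately have fG: "integrable lborel (\<lambda>x. f' x * G x)" by simp
    have "(\<integral>x. f' x * (G x - G c) \<partial>lborel) = (\<integral>x. f' x * G x - G c * f' x \<partial>lborel)"
      by (intro Bochner_Integration.integral_cong) (auto simp: algebra_simps)
    also have "\<dots> = (\<integral>x. f' x * G x \<partial>lborel) - G c * (\<integral>x. f' x \<partial>lborel)"
      using fG f' by simp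
    finally show ?thesis using Fz(1)[of d] cd by (simp add: f'_def set_lebesgue_integral_def mult.assoc)
  qed
  also have "(\<integral>y. g' y * (F y - F c) \<partial>lborel) = (LBINT z:{c..d}. F z * g z) - F c * (G d - G c)"
  proof -
    have "integrable lborel (\<lambda>x. g' x * (F x - F c) + F c * g' x)"
      by (intro Bochner_Integration.integrable_add 2 integrable_mult_right g')
    moreover have "g' x * (F x - F c) + F c * g' x = g' x * F x" for x by (simp add: algebra_simps)
    ultimately have gF: "integrable lborel (\<lambda>x. g' x * F x)" by simp
    have "(\<integral>x. g' x * (F x - F c) \<partial>lborel) = (\<integral>x. g' x * F x - F c * g' x \<partial>lborel)"
      by (intro Bochner_Integration.integral_cong) (auto simp: algebra_simps)
    also have "\<dots> = (\<integral>x. g' x * F x \<partial>lborel) - F c * (\<integral>x. g' x \<partial>lborel)"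
      using gF g' by simp
    finally show ?thesis using Fz(2)[of d] cd
      by (simp add: g'_def set_lebesgue_integral_def mult.assoc mult.commute mult.left_commute)
  qed
  finally show ?thesis by (simp add: algebra_simps)
qed

section \<open>The energy form of a Sturm-Liouville operator\<close>

text \<open>Common form of two measures: with weight \<open>m\<close> it is the speed measure, with
  weight \<open>\<rho>\<close> the scale measure, in which the flux is square integrable.\<close>

definition weighted :: "real set \<Rightarrow> (real \<Rightarrow> real) \<Rightarrow> real measure" where
  "weighted I w = density (restrict_space lborel I) (\<lambda>x. ennreal (w x))"

locale weight =
  fixes I :: "real set" and w :: "real \<Rightarrow> real"
  assumes open_I: "open I" and interval_I: "is_interval I"
    and w_meas: "w \<in> borel_measurable (restrict_space borel I)"
    and w_pos: "\<And>x. x \<in> I \<Longrightarrow> 0 < w x"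
    and w_loc: "L1_loc_on I w"
begin

lemma I_borel [measurable, simp]: "I \<in> sets borel"
  using open_I by simp

lemma Icc_sub: "x \<in> I \<Longrightarrow> y \<in> I \<Longrightarrow> {x..y} \<subseteq> I"
  by (rule Icc_subset_interval[OF interval_I])

lemma space_weighted [simp]: "space (weighted I w) = I"
  by (simp add: weighted_def space_restrict_space)

lemma measurable_weighted [simp]:
  "borel_measurable (weighted I w) = borel_measurable (restrict_space borel I)"
  unfolding weighted_def by (intro measurable_cong_sets) (auto simp: sets_restrict_space)

lemma measurable_restrict_lborel:
  "borel_measurable (restrict_space lborel I) = borel_measurable (restrict_space borel I)"
  by (intro measurable_cong_sets) (auto simp: sets_restrict_space)

lemma w_meas_lborel: "w \<in> borel_measurable (restrict_space lborel I)"
  using w_meas by (simp only: measurable_restrict_lborel)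

lemma AE_weighted: "(AE x in weighted I w. P x) \<longleftrightarrow> (AE x in lborel. x \<in> I \<longrightarrow> P x)"
proof -
  have "(AE x in weighted I w. P x) \<longleftrightarrow> (AE x in restrict_space lborel I. 0 < ennreal (w x) \<longrightarrow> P x)"
    unfolding weighted_def by (intro AE_density measurable_compose[OF w_meas_lborel measurable_ennreal])
  also have "\<dots> \<longleftrightarrow> (AE x in lborel. x \<in> I \<longrightarrow> 0 < ennreal (w x) \<longrightarrow> P x)"
    by (intro AE_restrict_space_iff) simp
  also have "\<dots> \<longleftrightarrow> (AE x in lborel. x \<in> I \<longrightarrow> P x)"
    by (intro AE_cong) (auto simp: w_pos)
  finally show ?thesis .
qed

lemma
  assumes f: "f \<in> borel_measurable (restrict_space borel I)"
  shows integrable_weighted: "integrable (weighted I w) f \<longleftrightarrow> set_integrable lborel I (\<lambda>x. w x * f x)"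
    and integral_weighted: "integral\<^sup>L (weighted I w) f = (LBINT x:I. w x * f x)"
proof -
  have f': "f \<in> borel_measurable (restrict_space lborel I)"
    using f by (simp only: measurable_restrict_lborel)
  have nn: "AE x in restrict_space lborel I. 0 \<le> w x"
    by (rule AE_I2) (auto simp: space_restrict_space less_imp_le w_pos)
  show "integrable (weighted I w) f \<longleftrightarrow> set_integrable lborel I (\<lambda>x. w x * f x)"
    unfolding weighted_def integrable_real_density[OF w_meas_lborel nn f']
    by (simp add: integrable_restrict_space set_integrable_def)
  show "integral\<^sup>L (weighted I w) f = (LBINT x:I. w x * f x)"
    unfolding weighted_def integral_real_density[OF w_meas_lborel nn f']
    by (simp add: integral_restrict_space set_lebesgue_integral_def)
qed

lemma square_integrable_Icc:
  assumes cd: "{c..d} \<subseteq> I" and B: "\<And>x. x \<in> {c..d} \<Longrightarrow> \<bar>f x\<bar> \<le> B"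
    and f: "f \<in> borel_measurable (restrict_space borel I)"
  shows "square_integrable (weighted I w) (\<lambda>x. indicator {c..d} x * f x)"
proof -
  have ind: "indicat_real {c..d} \<in> borel_measurable (restrict_space borel I)"
    by (intro measurable_restrict_space1) auto
  have "square_integrable (weighted I w) (indicat_real {c..d})"
  proof -
    have "set_integrable lborel I (\<lambda>x. w x * (indicator {c..d} x)\<^sup>2)"
    proof -
      have "set_integrable lborel {c..d} w" by (rule L1_loc_on_Icc[OF w_loc cd])
      moreover have "(\<lambda>x. indicator I x *\<^sub>R (w x * (indicator {c..d} x)\<^sup>2)) = (\<lambda>x. indicator {c..d} x *\<^sub>R w x)"
        using cd by (auto simp: fun_eq_iff split: split_indicator)
      ultimately show ?thesis by (simp add: set_integrable_def)
    qed
    then show ?thesis using ind by (simp add: square_integrable_def integrable_weighted borel_measurable_power)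
  qed
  then have "square_integrable (weighted I w) (\<lambda>x. (indicator {c..d} x * f x) * indicator {c..d} x)"
  proof (rule square_integrable_bounded_mult)
    show "(\<lambda>x. indicator {c..d} x * f x) \<in> borel_measurable (weighted I w)"
      using ind f by simp
    show "\<bar>indicator {c..d} x * f x\<bar> \<le> \<bar>B\<bar>" for x
      using B[of x] by (auto split: split_indicator)
  qed
  moreover have "(\<lambda>x. (indicator {c..d} x * f x) * indicator {c..d} x) = (\<lambda>x. indicator {c..d} x * f x)"
    by (auto simp: fun_eq_iff split: split_indicator)
  ultimately show ?thesis by simp
qed

lemma indicator_L2: "{c..d} \<subseteq> I \<Longrightarrow> indicat_real {c..d} \<in> L2 (weighted I w)"
  using square_integrable_Icc[of c d "\<lambda>_. 1" 1] by (simp add: L2_def)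

lemma
  assumes cd: "{c..d} \<subseteq> I" and f: "f \<in> L2 (weighted I w)"
  shows set_integrable_L2: "set_integrable lborel {c..d} (\<lambda>x. w x * f x)"
    and set_integral_L2: "(LBINT x:{c..d}. w x * f x) = L2_ip (weighted I w) (indicator {c..d}) f"
proof -
  have fm: "f \<in> borel_measurable (restrict_space borel I)"
    using f by (simp add: L2_def square_integrable_def)
  have ind: "indicat_real {c..d} \<in> borel_measurable (restrict_space borel I)"
    by (intro measurable_restrict_space1) auto
  have m: "(\<lambda>x. indicator {c..d} x * f x) \<in> borel_measurable (restrict_space borel I)"
    using ind fm by simp
  have e: "(\<lambda>x. indicator I x *\<^sub>R (w x * (indicator {c..d} x * f x))) = (\<lambda>x. indicator {c..d} x *\<^sub>R (w x * f x))"
    using cd by (auto simp: fun_eq_iff split: split_indicator)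
  have "integrable (weighted I w) (\<lambda>x. indicator {c..d} x * f x)"
    using indicator_L2[OF cd] f by (intro square_integrable_mult) (auto simp: L2_def)
  then show "set_integrable lborel {c..d} (\<lambda>x. w x * f x)"
    unfolding integrable_weighted[OF m] set_integrable_def e .
  show "(LBINT x:{c..d}. w x * f x) = L2_ip (weighted I w) (indicator {c..d}) f"
    unfolding L2_ip_def integral_weighted[OF m] set_lebesgue_integral_def e ..
qed

lemma L1_loc_on_L2: "f \<in> L2 (weighted I w) \<Longrightarrow> L1_loc_on I (\<lambda>x. w x * f x)"
  by (intro L1_loc_onI interval_I set_integrable_L2)

lemma nrm_indicator_sq: "{c..d} \<subseteq> I \<Longrightarrow> (L2.nrm (weighted I w) (indicator {c..d}))\<^sup>2 = (LBINT x:{c..d}. w x)"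
  using set_integral_L2[OF _ indicator_L2, of c d c d]
  by (subst L2.nrm_sq[OF indicator_L2])
    (auto simp: set_lebesgue_integral_def mult.left_commute mult.commute indicator_inter_arith[symmetric])

lemma set_integral_L2_bound:
  assumes cd: "{c..d} \<subseteq> I" and f: "f \<in> L2 (weighted I w)"
  shows "\<bar>LBINT x:{c..d}. w x * f x\<bar> \<le> sqrt (LBINT x:{c..d}. w x) * L2.nrm (weighted I w) f"
proof -
  have "\<bar>LBINT x:{c..d}. w x * f x\<bar> \<le> L2.nrm (weighted I w) (indicator {c..d}) * L2.nrm (weighted I w) f"
    unfolding set_integral_L2[OF cd f] by (rule L2.Cauchy_Schwarz[OF indicator_L2[OF cd] f])
  also have "L2.nrm (weighted I w) (indicator {c..d}) = sqrt (LBINT x:{c..d}. w x)"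
    by (rule real_sqrt_unique[symmetric]) (use indicator_L2[OF cd] nrm_indicator_sq[OF cd] in simp_all)
  finally show ?thesis .
qed

lemma set_integral_pos:
  assumes cd: "c < d" "{c..d} \<subseteq> I"
  shows "0 < (LBINT x:{c..d}. w x)"
proof -
  have int: "integrable lborel (\<lambda>x. indicator {c..d} x *\<^sub>R w x)"
    using L1_loc_on_Icc[OF w_loc cd(2)] by (simp add: set_integrable_def)
  have nn: "0 \<le> indicator {c..d} x *\<^sub>R w x" for x
    using cd w_pos by (auto split: split_indicator intro!: less_imp_le[OF w_pos])
  have "(LBINT x:{c..d}. w x) \<noteq> 0"
  proof
    assume "(LBINT x:{c..d}. w x) = 0"
    then have "AE x in lborel. indicator {c..d} x *\<^sub>R w x = 0"
      using integral_nonneg_eq_0_iff_AE[OF int] nn by (simp add: set_lebesgue_integral_def)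
    then have "AE x in lborel. x \<notin> {c..d}"
      by eventually_elim (use cd w_pos in \<open>force split: split_indicator_asm\<close>)
    then have "emeasure lborel {c..d} = 0"
      by (subst (asm) AE_iff_measurable[of "{c..d}"]) auto
    then show False using cd(1) by simp
  qed
  moreover have "0 \<le> (LBINT x:{c..d}. w x)"
    unfolding set_lebesgue_integral_def by (rule Bochner_Integration.integral_nonneg) (rule nn)
  ultimately show ?thesis by simp
qed

text \<open>Comparison with \<open>a\<close> times the indicator of the interval. Together with a
  bound on the oscillation it turns norm bounds into pointwise bounds.\<close>

lemma nrm_ge_on_Icc:
  assumes cd: "c < d" "{c..d} \<subseteq> I" and f: "f \<in> L2 (weighted I w)" and a: "0 \<le> a"
    and le: "\<And>x. x \<in> {c..d} \<Longrightarrow> a \<le> \<bar>f x\<bar>"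
  shows "a \<le> L2.nrm (weighted I w) f / sqrt (LBINT x:{c..d}. w x)"
proof -
  let ?M = "weighted I w"
  have "(L2.nrm ?M (a *\<^sub>R indicator {c..d}))\<^sup>2 \<le> (L2.nrm ?M f)\<^sup>2"
    unfolding L2.nrm_sq[OF L2.S_scale[OF indicator_L2[OF cd(2)]]] L2.nrm_sq[OF f] L2_ip_def
  proof (rule integral_mono)
    show "integrable ?M (\<lambda>x. (a *\<^sub>R indicat_real {c..d}) x * (a *\<^sub>R indicat_real {c..d}) x)"
      using L2.S_scale[OF indicator_L2[OF cd(2)], of a] by (intro square_integrable_mult) (simp_all only: L2_def mem_Collect_eq)
    show "integrable ?M (\<lambda>x. f x * f x)"
      using f by (intro square_integrable_mult) (auto simp: L2_def)
    show "(a *\<^sub>R indicator {c..d}) x * (a *\<^sub>R indicator {c..d}) x \<le> f x * f x" for x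
      using power_mono[OF le a, of x 2] by (auto split: split_indicator simp: power2_eq_square)
  qed
  then have "L2.nrm ?M (a *\<^sub>R indicator {c..d}) \<le> L2.nrm ?M f"
    using f by (auto intro: power2_le_imp_le)
  moreover have "L2.nrm ?M (a *\<^sub>R indicator {c..d}) = a * sqrt (LBINT x:{c..d}. w x)"
  proof -
    have "L2.nrm ?M (indicator {c..d}) = sqrt (LBINT x:{c..d}. w x)"
      by (rule real_sqrt_unique[symmetric]) (use indicator_L2[OF cd(2)] nrm_indicator_sq[OF cd(2)] in simp_all)
    then show ?thesis using indicator_L2[OF cd(2)] a by (simp add: L2.nrm_scale)
  qed
  ultimately show ?thesis
    using set_integral_pos[OF cd] by (simp add: pos_le_divide_eq)
qed

text \<open>A nonzero value of a continuous function persists on an interval, which has positive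
  length. This is the passage from classes of functions to values.\<close>

lemma continuous_AE_zero:
  assumes f: "continuous_on I f" and ae: "AE x in lborel. x \<in> I \<longrightarrow> f x = 0" and x: "x \<in> I"
  shows "f x = (0::real)"
proof (rule ccontr)
  assume "f x \<noteq> 0"
  have "open (f -` (- {0}) \<inter> I)"
    using f open_I by (simp add: continuous_on_open_vimage open_Compl)
  moreover have "x \<in> f -` (- {0}) \<inter> I" using x \<open>f x \<noteq> 0\<close> by simp
  ultimately obtain c d where cd: "c < x" "x < d" "{c..d} \<subseteq> f -` (- {0}) \<inter> I"
    using open_Icc_nhd by blast
  have "AE x in lborel. x \<notin> {c..d}"
    using ae by eventually_elim (use cd(3) in auto)
  then have "emeasure lborel {c..d} = 0"
    by (subst (asm) AE_iff_measurable[of "{c..d}"]) auto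
  then show False using cd by simp
qed

end

text \<open>The operator behind the data is \<open>v \<mapsto> - (v' / \<rho>)' / m + k v\<close>.
  In the application it is \<open>L - A\<close> with \<open>k = q + L\<close>, and the lower bound 1
  for \<open>k\<close> makes its form dominate the norm.\<close>

locale sturm_liouville = \<mu>: weight I m + \<nu>: weight I \<rho>
  for I m \<rho> +
  fixes s k :: "real \<Rightarrow> real" and K :: real
  assumes \<rho>_cont: "continuous_on I \<rho>" and s_prim: "primitive_on I s \<rho>"
    and k_meas: "k \<in> borel_measurable (restrict_space borel I)"
    and k_ge: "\<And>x. x \<in> I \<Longrightarrow> 1 \<le> k x" and k_le: "\<And>x. x \<in> I \<Longrightarrow> k x \<le> K"
    and I_ne: "I \<noteq> {}"
begin

abbreviation \<mu> where "\<mu> \<equiv> weighted I m"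
abbreviation \<nu> where "\<nu> \<equiv> weighted I \<rho>"

lemmas open_I = \<mu>.open_I and interval_I = \<mu>.interval_I and Icc_sub = \<mu>.Icc_sub

lemma s_diff: "x \<le> y \<Longrightarrow> {x..y} \<subseteq> I \<Longrightarrow> s y - s x = (LBINT z:{x..y}. \<rho> z)"
  using primitive_onD(2)[OF s_prim] .

lemma s_strict_mono: "x \<in> I \<Longrightarrow> y \<in> I \<Longrightarrow> x < y \<Longrightarrow> s x < s y"
  using \<nu>.set_integral_pos[of x y] s_diff[of x y] Icc_sub[of x y] by simp

lemma s_mono: "x \<in> I \<Longrightarrow> y \<in> I \<Longrightarrow> x \<le> y \<Longrightarrow> s x \<le> s y"
  using s_strict_mono[of x y] by (cases "x = y") auto

text \<open>The accessible ends are those where \<open>s\<close> stays bounded; no condition is imposed at the other ends.\<close>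
definition vanish :: "(real \<Rightarrow> real) \<Rightarrow> bool" where
  "vanish v \<longleftrightarrow>
     (bdd_below (s ` I) \<longrightarrow> (\<forall>e>0. \<exists>c\<in>I. \<forall>x\<in>I. x \<le> c \<longrightarrow> \<bar>v x\<bar> \<le> e)) \<and>
     (bdd_above (s ` I) \<longrightarrow> (\<forall>e>0. \<exists>c\<in>I. \<forall>x\<in>I. c \<le> x \<longrightarrow> \<bar>v x\<bar> \<le> e))"

text \<open>An element carries the function and its derivative with respect to the scale, so that
  the energy, the integral of \<open>v'^2 / \<rho>\<close>, is simply the squared norm of the second
  component in \<open>\<nu>\<close>. The pair type also inherits its vector space structure.\<close>

definition Dom :: "((real \<Rightarrow> real) \<times> (real \<Rightarrow> real)) set" where
  "Dom = {(v, p). v \<in> L2 \<mu> \<and> p \<in> L2 \<nu> \<and> primitive_on I v (\<lambda>x. \<rho> x * p x) \<and> vanish v}"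

definition form :: "(real \<Rightarrow> real) \<times> (real \<Rightarrow> real) \<Rightarrow> (real \<Rightarrow> real) \<times> (real \<Rightarrow> real) \<Rightarrow> real" where
  "form y z = L2_ip \<mu> (\<lambda>x. k x * fst y x) (fst z) + L2_ip \<nu> (snd y) (snd z)"

lemma abs_k_le: "x \<in> I \<Longrightarrow> \<bar>k x\<bar> \<le> K"
  using k_ge[of x] k_le[of x] by linarith

lemma k_mult_L2: "v \<in> L2 \<mu> \<Longrightarrow> (\<lambda>x. k x * v x) \<in> L2 \<mu>"
  unfolding L2_def mem_Collect_eq
  by (rule square_integrable_bounded_mult[where K = "K"])
    (use k_meas abs_k_le in auto)

lemma vanish_leftD: "vanish v \<Longrightarrow> bdd_below (s ` I) \<Longrightarrow> e > 0 \<Longrightarrow> \<exists>c\<in>I. \<forall>x\<in>I. x \<le> c \<longrightarrow> \<bar>v x\<bar> \<le> e"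
  and vanish_rightD: "vanish v \<Longrightarrow> bdd_above (s ` I) \<Longrightarrow> e > 0 \<Longrightarrow> \<exists>c\<in>I. \<forall>x\<in>I. c \<le> x \<longrightarrow> \<bar>v x\<bar> \<le> e"
  by (simp_all add: vanish_def)

lemma vanish_lincomb:
  assumes v: "vanish v" and w: "vanish w"
  shows "vanish (\<lambda>x. a * v x + b * w x)"
proof -
  have small: "\<bar>a * x + b * y\<bar> \<le> e" if "\<bar>x\<bar> \<le> e / (\<bar>a\<bar> + \<bar>b\<bar> + 1)" "\<bar>y\<bar> \<le> e / (\<bar>a\<bar> + \<bar>b\<bar> + 1)" "e > 0" for x y e
  proof -
    define d where "d = e / (\<bar>a\<bar> + \<bar>b\<bar> + 1)"
    have d: "\<bar>x\<bar> \<le> d" "\<bar>y\<bar> \<le> d" "0 < d" using that by (simp_all add: d_def)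
    have "\<bar>a * x + b * y\<bar> \<le> \<bar>a\<bar> * \<bar>x\<bar> + \<bar>b\<bar> * \<bar>y\<bar>" by (metis abs_mult abs_triangle_ineq)
    also have "\<dots> \<le> \<bar>a\<bar> * d + \<bar>b\<bar> * d" using d by (intro add_mono mult_left_mono) auto
    also have "\<dots> \<le> (\<bar>a\<bar> + \<bar>b\<bar> + 1) * d" using d by (simp add: distrib_right)
    also have "\<dots> = e"
    proof -
      have "\<bar>a\<bar> + \<bar>b\<bar> + 1 \<noteq> 0" by linarith
      then show ?thesis by (simp add: d_def)
    qed
    finally show ?thesis .
  qed
  have d: "e / (\<bar>a\<bar> + \<bar>b\<bar> + 1) > 0" if "e > 0" for e using that by simp
  show ?thesis
    unfolding vanish_def
  proof (intro conjI impI allI)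
    fix e :: real assume e: "e > 0" and bd: "bdd_below (s ` I)"
    obtain c where c: "c \<in> I" "\<And>x. x \<in> I \<Longrightarrow> x \<le> c \<Longrightarrow> \<bar>v x\<bar> \<le> e / (\<bar>a\<bar> + \<bar>b\<bar> + 1)"
      using vanish_leftD[OF v bd d[OF e]] by metis
    obtain c' where c': "c' \<in> I" "\<And>x. x \<in> I \<Longrightarrow> x \<le> c' \<Longrightarrow> \<bar>w x\<bar> \<le> e / (\<bar>a\<bar> + \<bar>b\<bar> + 1)"
      using vanish_leftD[OF w bd d[OF e]] by metis
    show "\<exists>c\<in>I. \<forall>x\<in>I. x \<le> c \<longrightarrow> \<bar>a * v x + b * w x\<bar> \<le> e"
      by (rule bexI[of _ "min c c'"]) (use c c' e in \<open>auto intro: small simp: min_def\<close>)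
  next
    fix e :: real assume e: "e > 0" and bd: "bdd_above (s ` I)"
    obtain c where c: "c \<in> I" "\<And>x. x \<in> I \<Longrightarrow> c \<le> x \<Longrightarrow> \<bar>v x\<bar> \<le> e / (\<bar>a\<bar> + \<bar>b\<bar> + 1)"
      using vanish_rightD[OF v bd d[OF e]] by metis
    obtain c' where c': "c' \<in> I" "\<And>x. x \<in> I \<Longrightarrow> c' \<le> x \<Longrightarrow> \<bar>w x\<bar> \<le> e / (\<bar>a\<bar> + \<bar>b\<bar> + 1)"
      using vanish_rightD[OF w bd d[OF e]] by metis
    show "\<exists>c\<in>I. \<forall>x\<in>I. c \<le> x \<longrightarrow> \<bar>a * v x + b * w x\<bar> \<le> e"
      by (rule bexI[of _ "max c c'"]) (use c c' e in \<open>auto intro: small simp: max_def\<close>)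
  qed
qed

lemma mem_Dom:
  "z \<in> Dom \<longleftrightarrow> fst z \<in> L2 \<mu> \<and> snd z \<in> L2 \<nu> \<and> primitive_on I (fst z) (\<lambda>x. \<rho> x * snd z x) \<and> vanish (fst z)"
  unfolding Dom_def mem_Collect_eq case_prod_beta by (rule refl)

lemma Dom_D:
  assumes "z \<in> Dom"
  shows "fst z \<in> L2 \<mu>" "snd z \<in> L2 \<nu>" "primitive_on I (fst z) (\<lambda>x. \<rho> x * snd z x)" "vanish (fst z)"
  using assms by (simp_all add: mem_Dom)

lemma Dom_lincomb:
  assumes y: "y \<in> Dom" and z: "z \<in> Dom"
  shows "a *\<^sub>R y + b *\<^sub>R z \<in> Dom"
proof -
  have "primitive_on I (\<lambda>x. a * fst y x + b * fst z x) (\<lambda>x. a * (\<rho> x * snd y x) + b * (\<rho> x * snd z x))"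
    by (intro primitive_on_lincomb Dom_D y z)
  moreover have "a * (\<rho> x * snd y x) + b * (\<rho> x * snd z x) = \<rho> x * (a * snd y x + b * snd z x)" for x
    by (simp add: algebra_simps)
  ultimately have "primitive_on I (fst (a *\<^sub>R y + b *\<^sub>R z)) (\<lambda>x. \<rho> x * snd (a *\<^sub>R y + b *\<^sub>R z) x)"
    by (simp add: plus_fun_def scaleR_fun_def)
  moreover have "vanish (fst (a *\<^sub>R y + b *\<^sub>R z))"
    using vanish_lincomb[OF Dom_D(4)[OF y] Dom_D(4)[OF z], of a b] by (simp add: plus_fun_def scaleR_fun_def)
  moreover have "fst (a *\<^sub>R y + b *\<^sub>R z) \<in> L2 \<mu>" "snd (a *\<^sub>R y + b *\<^sub>R z) \<in> L2 \<nu>"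
    using Dom_D(1,2)[OF y] Dom_D(1,2)[OF z] by (auto intro!: L2.S_add L2.S_scale)
  ultimately show ?thesis by (simp only: mem_Dom)
qed

lemma zero_in_Dom: "0 \<in> Dom"
proof -
  have "primitive_on I 0 (\<lambda>x. \<rho> x * 0 x)"
    by (auto simp: primitive_on_def set_integrable_def set_lebesgue_integral_def)
  then show ?thesis using \<mu>.I_borel I_ne by (auto simp: Dom_def vanish_def zero_prod_def)
qed

lemma subspace_Dom: "subspace Dom"
  using zero_in_Dom Dom_lincomb[of _ _ 1 1] Dom_lincomb[OF _ zero_in_Dom] by (auto simp: subspace_def)

lemma Dom_diff: "y \<in> Dom \<Longrightarrow> z \<in> Dom \<Longrightarrow> y - z \<in> Dom"
  using subspace_Dom by (rule subspace_diff)

text \<open>Cauchy-Schwarz in \<open>\<nu>\<close> for the increment, the integral of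
  \<open>\<rho> p\<close>; the \<open>\<nu>\<close>-mass of the interval is the increment of
  \<open>s\<close>.\<close>

lemma energy_bound:
  assumes v: "primitive_on I v (\<lambda>x. \<rho> x * p x)" and p: "p \<in> L2 \<nu>" and xy: "x \<in> I" "y \<in> I"
  shows "\<bar>v y - v x\<bar> \<le> sqrt \<bar>s y - s x\<bar> * L2.nrm \<nu> p"
proof -
  have *: "\<bar>v y - v x\<bar> \<le> sqrt (s y - s x) * L2.nrm \<nu> p" if xy: "x \<in> I" "y \<in> I" "x \<le> y" for x y
    using primitive_onD(2)[OF v xy(3) Icc_sub[OF xy(1,2)]] s_diff[OF xy(3) Icc_sub[OF xy(1,2)]]
      \<nu>.set_integral_L2_bound[OF Icc_sub[OF xy(1,2)] p] by simp
  show ?thesis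
  proof (cases "x \<le> y")
    case True
    then show ?thesis using *[OF xy] s_mono[OF xy] by simp
  next
    case False
    then show ?thesis using *[OF xy(2,1)] s_mono[OF xy(2,1)] by (simp add: abs_minus_commute)
  qed
qed

text \<open>\<open>energy_bound\<close> with the other point moved towards an accessible end. Unlike
  \<open>vanish\<close> itself, this quantitative form is preserved by pointwise limits with bounded
  energy; \<open>vanishI\<close> leads back.\<close>

lemma end_bound:
  assumes z: "z \<in> Dom" and y: "y \<in> I"
  shows "bdd_below (s ` I) \<Longrightarrow> \<bar>fst z y\<bar> \<le> sqrt (s y - Inf (s ` I)) * L2.nrm \<nu> (snd z)"
    and "bdd_above (s ` I) \<Longrightarrow> \<bar>fst z y\<bar> \<le> sqrt (Sup (s ` I) - s y) * L2.nrm \<nu> (snd z)"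
proof -
  have n: "0 \<le> L2.nrm \<nu> (snd z)" using Dom_D(2)[OF z] by simp
  show "\<bar>fst z y\<bar> \<le> sqrt (s y - Inf (s ` I)) * L2.nrm \<nu> (snd z)" if bd: "bdd_below (s ` I)"
  proof (rule field_le_epsilon)
    fix e :: real assume "e > 0"
    then obtain c where c: "c \<in> I" "\<And>x. x \<in> I \<Longrightarrow> x \<le> c \<Longrightarrow> \<bar>fst z x\<bar> \<le> e"
      using vanish_leftD[OF Dom_D(4)[OF z] bd] by metis
    let ?x = "min c y"
    have x: "?x \<in> I" using c y by (simp add: min_def)
    have "\<bar>fst z y\<bar> \<le> \<bar>fst z y - fst z ?x\<bar> + \<bar>fst z ?x\<bar>" by linarith
    also have "\<dots> \<le> sqrt \<bar>s y - s ?x\<bar> * L2.nrm \<nu> (snd z) + e"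
      using c(2)[OF x] by (intro add_mono energy_bound Dom_D z x y) auto
    also have "sqrt \<bar>s y - s ?x\<bar> \<le> sqrt (s y - Inf (s ` I))"
      using s_mono[OF x y] cInf_lower[OF imageI[OF x] bd] by simp
    finally show "\<bar>fst z y\<bar> \<le> sqrt (s y - Inf (s ` I)) * L2.nrm \<nu> (snd z) + e"
      using n by (simp add: mult_right_mono)
  qed
  show "\<bar>fst z y\<bar> \<le> sqrt (Sup (s ` I) - s y) * L2.nrm \<nu> (snd z)" if bd: "bdd_above (s ` I)"
  proof (rule field_le_epsilon)
    fix e :: real assume "e > 0"
    then obtain c where c: "c \<in> I" "\<And>x. x \<in> I \<Longrightarrow> c \<le> x \<Longrightarrow> \<bar>fst z x\<bar> \<le> e"
      using vanish_rightD[OF Dom_D(4)[OF z] bd] by metis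
    let ?x = "max c y"
    have x: "?x \<in> I" using c y by (simp add: max_def)
    have "\<bar>fst z y\<bar> \<le> \<bar>fst z y - fst z ?x\<bar> + \<bar>fst z ?x\<bar>" by linarith
    also have "\<dots> \<le> sqrt \<bar>s y - s ?x\<bar> * L2.nrm \<nu> (snd z) + e"
      using c(2)[OF x] by (intro add_mono energy_bound Dom_D z x y) auto
    also have "sqrt \<bar>s y - s ?x\<bar> \<le> sqrt (Sup (s ` I) - s y)"
      using s_mono[OF y x] cSup_upper[OF imageI[OF x] bd] by simp
    finally show "\<bar>fst z y\<bar> \<le> sqrt (Sup (s ` I) - s y) * L2.nrm \<nu> (snd z) + e"
      using n by (simp add: mult_right_mono)
  qed
qed

lemma vanishI:
  assumes l: "bdd_below (s ` I) \<Longrightarrow> (\<And>y. y \<in> I \<Longrightarrow> \<bar>v y\<bar> \<le> sqrt (s y - Inf (s ` I)) * C)"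
    and r: "bdd_above (s ` I) \<Longrightarrow> (\<And>y. y \<in> I \<Longrightarrow> \<bar>v y\<bar> \<le> sqrt (Sup (s ` I) - s y) * C)"
    and C: "0 \<le> C"
  shows "vanish v"
  unfolding vanish_def
proof (intro conjI impI allI)
  \<comment> \<open>The divisor \<open>C + 1\<close> is positive even when
    \<open>C = 0\<close>.\<close>
  have small: "sqrt a * C \<le> e" if "a \<le> (e / (C + 1))\<^sup>2" "e > 0" for a e
  proof -
    have "sqrt a \<le> e / (C + 1)" using that C by (intro real_le_lsqrt) auto
    then have "sqrt a * C \<le> e / (C + 1) * C" using C by (rule mult_right_mono)
    also have "\<dots> \<le> e" using that C by (simp add: field_simps)
    finally show ?thesis .
  qed
  fix e :: real assume e: "e > 0"
  have d: "0 < (e / (C + 1))\<^sup>2" using e C by simp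
  show "\<exists>c\<in>I. \<forall>x\<in>I. x \<le> c \<longrightarrow> \<bar>v x\<bar> \<le> e" if bd: "bdd_below (s ` I)"
  proof -
    obtain c where c: "c \<in> I" "s c < Inf (s ` I) + (e / (C + 1))\<^sup>2"
      using cInf_lessD[of "s ` I" "Inf (s ` I) + (e / (C + 1))\<^sup>2"] d I_ne by auto
    have "\<bar>v x\<bar> \<le> e" if "x \<in> I" "x \<le> c" for x
      using order_trans[OF l[OF bd that(1)] small[OF _ e]] s_mono[OF that(1) c(1) that(2)] c(2) by simp
    then show ?thesis using c(1) by blast
  qed
  show "\<exists>c\<in>I. \<forall>x\<in>I. c \<le> x \<longrightarrow> \<bar>v x\<bar> \<le> e" if bd: "bdd_above (s ` I)"
  proof -
    obtain c where c: "c \<in> I" "Sup (s ` I) - (e / (C + 1))\<^sup>2 < s c"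
      using less_cSupD[of "s ` I" "Sup (s ` I) - (e / (C + 1))\<^sup>2"] d I_ne by auto
    have "\<bar>v x\<bar> \<le> e" if "x \<in> I" "c \<le> x" for x
      using order_trans[OF r[OF bd that(1)] small[OF _ e]] s_mono[OF c(1) that(1) that(2)] c(2) by simp
    then show ?thesis using c(1) by blast
  qed
qed

lemma form_add: "x \<in> Dom \<Longrightarrow> y \<in> Dom \<Longrightarrow> z \<in> Dom \<Longrightarrow> form (x + y) z = form x z + form y z"
  using L2.ip_add[OF k_mult_L2 k_mult_L2, of "fst x" "fst y" "fst z"] L2.ip_add[of "snd x" \<nu> "snd y" "snd z"]
    Dom_D(1,2)[of x] Dom_D(1,2)[of y] Dom_D(1,2)[of z]
  by (simp add: form_def plus_fun_def distrib_left)

lemma form_scale: "form (c *\<^sub>R x) z = c * form x z"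
  by (simp add: form_def L2_ip_def distrib_left mult.assoc mult.left_commute[of _ c])

lemma form_sym: "form x y = form y x"
  by (simp add: form_def L2_ip_def mult.commute mult.left_commute)

lemma
  assumes z: "z \<in> Dom"
  shows form_ge: "L2_ip \<mu> (fst z) (fst z) + L2_ip \<nu> (snd z) (snd z) \<le> form z z"
    and form_le: "form z z \<le> K * L2_ip \<mu> (fst z) (fst z) + L2_ip \<nu> (snd z) (snd z)"
proof -
  have z1: "square_integrable \<mu> (fst z)" and kz: "square_integrable \<mu> (\<lambda>x. k x * fst z x)"
    using Dom_D(1)[OF z] k_mult_L2 by (auto simp: L2_def)
  have *: "fst z x * fst z x \<le> k x * fst z x * fst z x" "k x * fst z x * fst z x \<le> K * (fst z x * fst z x)"
    if "x \<in> I" for x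
    using mult_right_mono[OF k_ge[OF that], of "fst z x * fst z x"]
      mult_right_mono[OF k_le[OF that], of "fst z x * fst z x"] by (simp_all add: mult.assoc)
  have "L2_ip \<mu> (fst z) (fst z) \<le> L2_ip \<mu> (\<lambda>x. k x * fst z x) (fst z)"
    unfolding L2_ip_def by (intro integral_mono square_integrable_mult z1 kz) (use * in simp)
  then show "L2_ip \<mu> (fst z) (fst z) + L2_ip \<nu> (snd z) (snd z) \<le> form z z" by (simp add: form_def)
  have "L2_ip \<mu> (\<lambda>x. k x * fst z x) (fst z) \<le> (\<integral>x. K * (fst z x * fst z x) \<partial>\<mu>)"
    unfolding L2_ip_def
    by (intro integral_mono square_integrable_mult z1 kz Bochner_Integration.integrable_mult_right) (use * in simp)
  then show "form z z \<le> K * L2_ip \<mu> (fst z) (fst z) + L2_ip \<nu> (snd z) (snd z)"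
    by (simp add: form_def L2_ip_def)
qed

lemma form_nonneg: "z \<in> Dom \<Longrightarrow> 0 \<le> form z z"
  using form_ge[of z] L2.ip_nonneg[OF Dom_D(1), of z] L2.ip_nonneg[OF Dom_D(2), of z] by linarith

lemma K_ge: "1 \<le> K"
proof -
  obtain x where "x \<in> I" using I_ne by blast
  then show ?thesis using k_ge[of x] k_le[of x] by linarith
qed

text \<open>Both components converge in their L2 spaces. The limit function is rebuilt as the
  primitive of \<open>\<rho> p'\<close>, anchored at one point where a subsequence of the
  \<open>v n\<close> converges; \<open>energy_bound\<close> makes that subsequence converge
  everywhere, so the primitive agrees with the L2 limit almost everywhere. The end conditions
  survive because the energies are bounded.\<close>

lemma form_complete:
  assumes X: "\<And>n::nat. X n \<in> Dom"
    and C: "\<And>e. e > 0 \<Longrightarrow> \<exists>N. \<forall>i\<ge>N. \<forall>n\<ge>N. form (X i - X n) (X i - X n) < e"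
  shows "\<exists>x\<in>Dom. (\<lambda>n. form (X n - x) (X n - x)) \<longlonglongrightarrow> 0"
proof -
  define v p where "v n = fst (X n)" and "p n = snd (X n)" for n
  have vL: "v n \<in> L2 \<mu>" and pL: "p n \<in> L2 \<nu>" and prim: "primitive_on I (v n) (\<lambda>x. \<rho> x * p n x)" for n
    using Dom_D[OF X[of n]] by (auto simp: v_def p_def)
  have sq: "L2_ip M (f - g) (f - g) = (\<integral>x. (f x - g x)\<^sup>2 \<partial>M)" for M :: "real measure" and f g
    by (simp add: L2_ip_def power2_eq_square fun_diff_def)
  have ge: "(\<integral>x. (v i x - v n x)\<^sup>2 \<partial>\<mu>) + (\<integral>x. (p i x - p n x)\<^sup>2 \<partial>\<nu>) \<le> form (X i - X n) (X i - X n)" for i n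
    using form_ge[OF Dom_diff[OF X X], of i n] by (simp add: v_def p_def sq)
  have nn: "0 \<le> (\<integral>x. (v i x - v n x)\<^sup>2 \<partial>\<mu>)" "0 \<le> (\<integral>x. (p i x - p n x)\<^sup>2 \<partial>\<nu>)" for i n by simp_all
  have "\<exists>N. \<forall>i\<ge>N. \<forall>n\<ge>N. (\<integral>x. (v i x - v n x)\<^sup>2 \<partial>\<mu>) < e" if "e > 0" for e
  proof -
    have "(\<integral>x. (v i x - v n x)\<^sup>2 \<partial>\<mu>) \<le> form (X i - X n) (X i - X n)" for i n
      using ge[of i n] nn(2)[of i n] by linarith
    then show ?thesis using C[OF that] by (meson order.strict_trans1)
  qed
  then obtain v' r where v': "square_integrable \<mu> v'" "(\<lambda>n. \<integral>x. (v n x - v' x)\<^sup>2 \<partial>\<mu>) \<longlonglongrightarrow> 0"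
    "strict_mono r" "AE x in \<mu>. (\<lambda>i. v (r i) x) \<longlonglongrightarrow> v' x"
    using L2_Cauchy_limit[of \<mu> v] vL by (auto simp: L2_def)
  have "\<exists>N. \<forall>i\<ge>N. \<forall>n\<ge>N. (\<integral>x. (p i x - p n x)\<^sup>2 \<partial>\<nu>) < e" if "e > 0" for e
  proof -
    have "(\<integral>x. (p i x - p n x)\<^sup>2 \<partial>\<nu>) \<le> form (X i - X n) (X i - X n)" for i n
      using ge[of i n] nn(1)[of i n] by linarith
    then show ?thesis using C[OF that] by (meson order.strict_trans1)
  qed
  then obtain p' where p': "square_integrable \<nu> p'" "(\<lambda>n. \<integral>x. (p n x - p' x)\<^sup>2 \<partial>\<nu>) \<longlonglongrightarrow> 0"
    using L2_Cauchy_limit[of \<nu> p] pL by (auto simp: L2_def)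
  have p'L: "p' \<in> L2 \<nu>" using p' by (simp add: L2_def)
  have pn: "(\<lambda>n. L2.nrm \<nu> (p n - p')) \<longlonglongrightarrow> 0"
    using tendsto_real_sqrt[OF p'(2)] by (simp add: L2.nrm_def sq)
  have ae: "AE x in lborel. x \<in> I \<longrightarrow> (\<lambda>i. v (r i) x) \<longlonglongrightarrow> v' x"
    using v'(4) by (simp add: \<mu>.AE_weighted)
  \<comment> \<open>Convergence holds almost everywhere and the nonempty open set \<open>I\<close>
    is not a null set.\<close>
  have "\<exists>x1\<in>I. (\<lambda>i. v (r i) x1) \<longlonglongrightarrow> v' x1"
  proof (rule ccontr)
    assume no: "\<not> ?thesis"
    have "AE x in lborel. x \<in> I \<longrightarrow> (1::real) = 0" using ae by eventually_elim (use no in blast)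
    then show False using \<mu>.continuous_AE_zero[of "\<lambda>_. 1"] I_ne by auto
  qed
  then obtain x1 where x1: "x1 \<in> I" "(\<lambda>i. v (r i) x1) \<longlonglongrightarrow> v' x1" by blast
  define V where "V x = v' x1 + (LBINT z=ereal x1..ereal x. \<rho> z * p' z)" for x
  have prim0: "primitive_on I (\<lambda>x. LBINT z=ereal x1..ereal x. \<rho> z * p' z) (\<lambda>x. \<rho> x * p' x)"
    by (intro interval_integral_primitive interval_I \<nu>.L1_loc_on_L2 p'L x1)
  then have Vprim: "primitive_on I V (\<lambda>x. \<rho> x * p' x)"
    unfolding primitive_on_def V_def by simp
  have V1: "V x1 = v' x1" by (simp add: V_def)
  have lim: "(\<lambda>i. v (r i) x) \<longlonglongrightarrow> V x" if x: "x \<in> I" for x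
  proof -
    have b: "\<bar>v i x - V x\<bar> \<le> \<bar>v i x1 - v' x1\<bar> + sqrt \<bar>s x - s x1\<bar> * L2.nrm \<nu> (p i - p')" for i
    proof -
      have "primitive_on I (\<lambda>x. 1 * v i x + (-1) * V x) (\<lambda>x. 1 * (\<rho> x * p i x) + (-1) * (\<rho> x * p' x))"
        by (intro primitive_on_lincomb prim Vprim)
      then have "primitive_on I (\<lambda>x. v i x - V x) (\<lambda>x. \<rho> x * (p i - p') x)"
        by (simp add: right_diff_distrib)
      from energy_bound[OF this L2.S_diff[OF pL p'L] x1(1) x]
      show ?thesis using V1 by linarith
    qed
    have "(\<lambda>i. v (r i) x - V x) \<longlonglongrightarrow> 0"
    proof (rule Lim_null_comparison)
      show "\<forall>\<^sub>F i in sequentially. norm (v (r i) x - V x)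
          \<le> \<bar>v (r i) x1 - v' x1\<bar> + sqrt \<bar>s x - s x1\<bar> * L2.nrm \<nu> (p (r i) - p')"
        using b by simp
      have "(\<lambda>i. \<bar>v (r i) x1 - v' x1\<bar> + sqrt \<bar>s x - s x1\<bar> * L2.nrm \<nu> (p (r i) - p'))
          \<longlonglongrightarrow> \<bar>v' x1 - v' x1\<bar> + sqrt \<bar>s x - s x1\<bar> * 0"
        by (intro tendsto_intros x1 LIMSEQ_subseq_LIMSEQ[OF pn v'(3), unfolded o_def])
      then show "(\<lambda>i. \<bar>v (r i) x1 - v' x1\<bar> + sqrt \<bar>s x - s x1\<bar> * L2.nrm \<nu> (p (r i) - p')) \<longlonglongrightarrow> 0" by simp
    qed
    then show ?thesis by (simp add: LIM_zero_iff)
  qed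
  have Vv': "AE x in \<mu>. V x = v' x"
    unfolding \<mu>.AE_weighted using ae by eventually_elim (auto dest: LIMSEQ_unique[OF lim])
  have Vm: "V \<in> borel_measurable (restrict_space borel I)"
    by (intro borel_measurable_continuous_on_restrict primitive_on_continuous[OF Vprim open_I])
  have VL: "V \<in> L2 \<mu>"
    using square_integrable_cong_AE[OF Vv' _ v'(1)] Vm by (simp add: L2_def)
  have "convergent (\<lambda>n. L2.nrm \<nu> (p n))"
  proof -
    have "(\<lambda>n. L2.nrm \<nu> (p n) - L2.nrm \<nu> p') \<longlonglongrightarrow> 0"
    proof (rule Lim_null_comparison[OF _ pn], rule always_eventually, rule allI)
      fix n
      show "norm (L2.nrm \<nu> (p n) - L2.nrm \<nu> p') \<le> L2.nrm \<nu> (p n - p')"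
        using L2.nrm_triangle[OF L2.S_diff[OF pL[of n] p'L] p'L] L2.nrm_triangle[OF L2.S_diff[OF p'L pL[of n]] pL[of n]]
          L2.nrm_minus_commute[OF p'L pL[of n]] by simp
    qed
    then show ?thesis by (auto simp: convergent_def LIM_zero_iff)
  qed
  then obtain C where C: "\<And>n. L2.nrm \<nu> (p n) \<le> C"
    using convergent_imp_Bseq by (metis Bseq_def abs_le_D1 real_norm_def)
  have C0: "0 \<le> C" using C[of 0] pL[of 0] by (meson L2.nrm_nonneg order_trans)
  have "vanish V"
  proof (rule vanishI[OF _ _ C0])
    fix y assume bd: "bdd_below (s ` I)" and y: "y \<in> I"
    have "\<bar>v n y\<bar> \<le> sqrt (s y - Inf (s ` I)) * C" for n
    proof -
      have "\<bar>v n y\<bar> \<le> sqrt (s y - Inf (s ` I)) * L2.nrm \<nu> (p n)"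
        using end_bound(1)[OF X[of n] y bd] by (simp add: v_def p_def)
      also have "\<dots> \<le> sqrt (s y - Inf (s ` I)) * C"
        using cInf_lower[OF imageI[OF y] bd] by (intro mult_left_mono C) simp
      finally show ?thesis .
    qed
    then show "\<bar>V y\<bar> \<le> sqrt (s y - Inf (s ` I)) * C"
      by (intro LIMSEQ_le_const2[OF tendsto_rabs[OF lim[OF y]]]) auto
  next
    fix y assume bd: "bdd_above (s ` I)" and y: "y \<in> I"
    have "\<bar>v n y\<bar> \<le> sqrt (Sup (s ` I) - s y) * C" for n
    proof -
      have "\<bar>v n y\<bar> \<le> sqrt (Sup (s ` I) - s y) * L2.nrm \<nu> (p n)"
        using end_bound(2)[OF X[of n] y bd] by (simp add: v_def p_def)
      also have "\<dots> \<le> sqrt (Sup (s ` I) - s y) * C"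
        using cSup_upper[OF imageI[OF y] bd] by (intro mult_left_mono C) simp
      finally show ?thesis .
    qed
    then show "\<bar>V y\<bar> \<le> sqrt (Sup (s ` I) - s y) * C"
      by (intro LIMSEQ_le_const2[OF tendsto_rabs[OF lim[OF y]]]) auto
  qed
  then have D: "(V, p') \<in> Dom" using VL p'L Vprim by (simp add: Dom_def)
  have "(\<lambda>n. form (X n - (V, p')) (X n - (V, p'))) \<longlonglongrightarrow> 0"
  proof (rule tendsto_sandwich)
    show "\<forall>\<^sub>F n in sequentially. 0 \<le> form (X n - (V, p')) (X n - (V, p'))"
      by (intro always_eventually allI form_nonneg Dom_diff X D)
    have "(\<integral>x. (v n x - V x)\<^sup>2 \<partial>\<mu>) = (\<integral>x. (v n x - v' x)\<^sup>2 \<partial>\<mu>)" for n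
    proof (rule integral_cong_AE)
      show "AE x in \<mu>. (v n x - V x)\<^sup>2 = (v n x - v' x)\<^sup>2" using Vv' by eventually_elim simp
    qed (use vL[of n] VL v'(1) in \<open>auto simp: L2_def square_integrable_def\<close>)
    then show "\<forall>\<^sub>F n in sequentially. form (X n - (V, p')) (X n - (V, p'))
        \<le> K * (\<integral>x. (v n x - v' x)\<^sup>2 \<partial>\<mu>) + (\<integral>x. (p n x - p' x)\<^sup>2 \<partial>\<nu>)"
      using form_le[OF Dom_diff[OF X D]] by (simp add: v_def p_def sq)
    show "(\<lambda>n. K * (\<integral>x. (v n x - v' x)\<^sup>2 \<partial>\<mu>) + (\<integral>x. (p n x - p' x)\<^sup>2 \<partial>\<nu>)) \<longlonglongrightarrow> 0"
      using tendsto_add[OF tendsto_mult_right_zero[OF v'(2), of K] p'(2)] by simp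
  qed simp
  with D show ?thesis by blast
qed

lemma semi_hilbert_form: "semi_hilbert Dom form"
  by standard (auto intro: subspace_Dom form_add form_scale form_sym form_nonneg form_complete)

end

section \<open>The resolvent\<close>

lemma bounded_on_Icc:
  fixes f :: "real \<Rightarrow> real"
  assumes f: "continuous_on I f" and cd: "{c..d} \<subseteq> I"
  shows "\<exists>B. \<forall>x\<in>{c..d}. \<bar>f x\<bar> \<le> B"
  using compact_imp_bounded[OF compact_continuous_image[OF continuous_on_subset[OF f cd] compact_Icc]]
  by (simp add: bounded_iff)

context sturm_liouville
begin

sublocale Dom: semi_hilbert Dom form
  by (rule semi_hilbert_form)

text \<open>The first component of \<open>z\<close> solves \<open>(L - A) v = g\<close> in the
  variational sense; the end conditions are contained in \<open>Dom\<close>.\<close>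

definition weak :: "(real \<Rightarrow> real) \<Rightarrow> (real \<Rightarrow> real) \<times> (real \<Rightarrow> real) \<Rightarrow> bool" where
  "weak g z \<longleftrightarrow> z \<in> Dom \<and> (\<forall>y\<in>Dom. form z y = L2_ip \<mu> g (fst y))"

lemma nrm_fst_le: "z \<in> Dom \<Longrightarrow> L2.nrm \<mu> (fst z) \<le> Dom.nrm z"
  unfolding L2.nrm_def Dom.nrm_def
  using form_ge[of z] L2.ip_nonneg[OF Dom_D(2), of z] by (intro real_sqrt_le_mono) linarith

lemma nrm_snd_le: "z \<in> Dom \<Longrightarrow> L2.nrm \<nu> (snd z) \<le> Dom.nrm z"
  unfolding L2.nrm_def Dom.nrm_def
  using form_ge[of z] L2.ip_nonneg[OF Dom_D(1), of z] by (intro real_sqrt_le_mono) linarith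

lemma weak_exists:
  assumes g: "g \<in> L2 \<mu>"
  shows "\<exists>z. weak g z"
proof -
  have "\<exists>z\<in>Dom. \<forall>y\<in>Dom. form z y = L2_ip \<mu> g (fst y)"
  proof (rule Dom.riesz_representation)
    show "L2_ip \<mu> g (fst (x + y)) = L2_ip \<mu> g (fst x) + L2_ip \<mu> g (fst y)" if "x \<in> Dom" "y \<in> Dom" for x y
      using that g by (simp add: L2.ip_add_right Dom_D)
    show "L2_ip \<mu> g (fst (c *\<^sub>R x)) = c * L2_ip \<mu> g (fst x)" if "x \<in> Dom" for x c
      using that g by (simp add: L2.ip_scale_right Dom_D)
    show "\<bar>L2_ip \<mu> g (fst x)\<bar> \<le> L2.nrm \<mu> g * Dom.nrm x" if "x \<in> Dom" for x
      using L2.Cauchy_Schwarz[OF g Dom_D(1)[OF that]] mult_left_mono[OF nrm_fst_le[OF that] L2.nrm_nonneg[OF g]]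
      by linarith
  qed
  then show ?thesis by (auto simp: weak_def)
qed

lemma weak_lincomb:
  assumes "weak f y" "weak g z" "f \<in> L2 \<mu>" "g \<in> L2 \<mu>"
  shows "weak (a *\<^sub>R f + b *\<^sub>R g) (a *\<^sub>R y + b *\<^sub>R z)"
  unfolding weak_def
proof (intro conjI ballI)
  have D: "y \<in> Dom" "z \<in> Dom" using assms by (auto simp: weak_def)
  show "a *\<^sub>R y + b *\<^sub>R z \<in> Dom" using D by (rule Dom_lincomb)
  fix x assume x: "x \<in> Dom"
  have "form (a *\<^sub>R y + b *\<^sub>R z) x = a * form y x + b * form z x"
    using D x by (simp add: Dom.ip_simps Dom.S_scale)
  also have "\<dots> = a * L2_ip \<mu> f (fst x) + b * L2_ip \<mu> g (fst x)"
    using assms x by (simp add: weak_def)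
  also have "\<dots> = L2_ip \<mu> (a *\<^sub>R f + b *\<^sub>R g) (fst x)"
    using assms Dom_D(1)[OF x] by (simp add: L2.ip_simps L2.S_scale)
  finally show "form (a *\<^sub>R y + b *\<^sub>R z) x = L2_ip \<mu> (a *\<^sub>R f + b *\<^sub>R g) (fst x)" .
qed

lemma weak_bound:
  assumes w: "weak g z" and g: "g \<in> L2 \<mu>"
  shows "Dom.nrm z \<le> L2.nrm \<mu> g"
proof -
  have z: "z \<in> Dom" using w by (simp add: weak_def)
  have "(Dom.nrm z)\<^sup>2 = L2_ip \<mu> g (fst z)" using w z by (simp add: weak_def Dom.nrm_sq)
  also have "\<dots> \<le> L2.nrm \<mu> g * L2.nrm \<mu> (fst z)"
    using L2.Cauchy_Schwarz[OF g Dom_D(1)[OF z]] by linarith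
  also have "\<dots> \<le> L2.nrm \<mu> g * Dom.nrm z"
    using nrm_fst_le[OF z] L2.nrm_nonneg[OF g] by (rule mult_left_mono)
  finally have *: "Dom.nrm z * Dom.nrm z \<le> L2.nrm \<mu> g * Dom.nrm z" by (simp add: power2_eq_square)
  show ?thesis
  proof (cases "Dom.nrm z = 0")
    case False
    then show ?thesis using * Dom.nrm_nonneg[OF z] by simp
  qed (simp add: g)
qed

text \<open>The difference solves the equation with right-hand side 0, hence has norm zero and is
  continuous. The conclusion concerns the first components, which thereby agree at every point of
  \<open>I\<close>.\<close>

lemma weak_unique:
  assumes y: "weak g y" and z: "weak g z" and g: "g \<in> L2 \<mu>" and x: "x \<in> I"
  shows "fst y x = fst z x"
proof -
  have w: "weak (1 *\<^sub>R g + (-1) *\<^sub>R g) (1 *\<^sub>R y + (-1) *\<^sub>R z)" by (rule weak_lincomb[OF y z g g])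
  then have w0: "weak 0 (y - z)" by simp
  then have D: "y - z \<in> Dom" by (simp add: weak_def)
  have "L2.nrm \<mu> (fst (y - z)) \<le> L2.nrm \<mu> 0"
    using weak_bound[OF w0] nrm_fst_le[OF D] by simp
  also have "L2.nrm \<mu> 0 = 0" by (simp add: L2_nrm_eq L2_norm_on_def)
  finally have "L2.nrm \<mu> (fst (y - z)) = 0" using L2.nrm_nonneg[OF Dom_D(1)[OF D]] by simp
  then have "AE x in \<mu>. fst (y - z) x = 0"
    using Dom_D(1)[OF D] by (subst (asm) L2_nrm_eq_0_iff) (auto simp: L2_def)
  then have "AE x in lborel. x \<in> I \<longrightarrow> fst (y - z) x = 0" by (simp add: \<mu>.AE_weighted)
  then have "fst (y - z) x = 0"
    using primitive_on_continuous[OF Dom_D(3)[OF D] open_I] x by (intro \<mu>.continuous_AE_zero)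
  then show ?thesis by (simp add: fun_diff_def)
qed

text \<open>Testing the weak equation with the primitive of \<open>p - P - C\<close> cut off to \<open>{c..d}\<close>,
  where \<open>P\<close> is a primitive of the right-hand side and \<open>C\<close> the mean of \<open>p - P\<close>, shows that \<open>p - P\<close> is constant.\<close>
lemma weak_flux_Icc:
  assumes w: "weak g (v, p)" and g: "g \<in> L2 \<mu>" and cd: "c < d" "{c..d} \<subseteq> I"
    and P: "primitive_on I P (\<lambda>x. m x * (k x * v x - g x))"
  shows "\<exists>C. AE x in lborel. x \<in> {c..d} \<longrightarrow> p x = P x + C"
proof -
  have D: "(v, p) \<in> Dom" using w by (simp add: weak_def)
  have pL: "p \<in> L2 \<nu>" and vL: "v \<in> L2 \<mu>" using Dom_D[OF D] by simp_all
  have Pc: "continuous_on I P" by (rule primitive_on_continuous[OF P open_I])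
  have ind: "indicat_real {c..d} \<in> borel_measurable (restrict_space borel I)"
    by (intro measurable_restrict_space1) auto
  define \<iota> where "\<iota> = indicat_real {c..d}"
  define r where "r = (LBINT x:{c..d}. \<rho> x)"
  have r: "r > 0" unfolding r_def by (rule \<nu>.set_integral_pos[OF cd])
  define h where "h x = \<iota> x * (p x - P x)" for x
  have PL: "(\<lambda>x. \<iota> x * P x) \<in> L2 \<nu>"
  proof -
    obtain B where B: "\<And>x. x \<in> {c..d} \<Longrightarrow> \<bar>P x\<bar> \<le> B"
      using bounded_on_Icc[OF Pc cd(2)] by blast
    show ?thesis
      using \<nu>.square_integrable_Icc[OF cd(2) B borel_measurable_continuous_on_restrict[OF Pc]]
      by (simp add: \<iota>_def L2_def)
  qed
  have pL': "(\<lambda>x. \<iota> x * p x) \<in> L2 \<nu>"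
    using pL ind unfolding L2_def mem_Collect_eq \<iota>_def
    by (intro square_integrable_bounded_mult[where K=1]) (auto simp: indicator_le_1)
  have hL: "h \<in> L2 \<nu>"
    using L2.S_diff[OF pL' PL] by (simp add: h_def[abs_def] fun_diff_def right_diff_distrib)
  \<comment> \<open>The \<open>\<nu>\<close>-mean of \<open>h\<close> over \<open>{c..d}\<close>, so
    that the primitive \<open>W\<close> of \<open>\<rho> \<eta>\<close> returns to 0 at
    \<open>d\<close>.\<close>
  define C where "C = (LBINT x:{c..d}. \<rho> x * h x) / r"
  define \<eta> where "\<eta> x = h x - C * \<iota> x" for x
  have \<iota>L: "\<iota> \<in> L2 \<nu>" unfolding \<iota>_def by (rule \<nu>.indicator_L2[OF cd(2)])
  have \<eta>L: "\<eta> \<in> L2 \<nu>"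
    using L2.S_diff[OF hL L2.S_scale[OF \<iota>L, of C]] by (simp add: \<eta>_def[abs_def] fun_diff_def)
  define W where "W x = (LBINT z=ereal c..ereal x. \<rho> z * \<eta> z)" for x
  have cI: "c \<in> I" "d \<in> I" using cd by auto
  have W: "primitive_on I W (\<lambda>x. \<rho> x * \<eta> x)"
    unfolding W_def by (intro interval_integral_primitive interval_I \<nu>.L1_loc_on_L2 \<eta>L cI)
  have \<eta>0: "\<eta> x = 0" if "x \<notin> {c..d}" for x using that by (simp add: \<eta>_def h_def \<iota>_def)
  have Wc: "W c = 0" by (simp add: W_def)
  have Wd: "W d = 0"
  proof -
    have i1: "set_integrable lborel {c..d} (\<lambda>x. \<rho> x * h x)" "set_integrable lborel {c..d} (\<lambda>x. \<rho> x * \<iota> x)"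
      by (intro \<nu>.set_integrable_L2 cd hL \<iota>L)+
    have "W d - W c = (LBINT x:{c..d}. \<rho> x * \<eta> x)" using cd by (intro primitive_onD(2)[OF W]) auto
    also have "\<dots> = (LBINT x:{c..d}. \<rho> x * h x - C * (\<rho> x * \<iota> x))" by (simp add: \<eta>_def algebra_simps)
    also have "\<dots> = (LBINT x:{c..d}. \<rho> x * h x) - C * (LBINT x:{c..d}. \<rho> x * \<iota> x)"
      using i1 by (subst set_integral_diff) auto
    also have "(LBINT x:{c..d}. \<rho> x * \<iota> x) = r"
      unfolding r_def \<iota>_def by (intro set_lebesgue_integral_cong) auto
    finally show ?thesis using r by (simp add: Wc C_def)
  qed
  have zero_int: "(LBINT x:{x..y}. \<rho> x * \<eta> x) = 0" if "y \<le> c \<or> d \<le> x" for x y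
  proof -
    have "(LBINT x:{x..y}. \<rho> x * \<eta> x) = (LBINT x:{x<..<y}. \<rho> x * \<eta> x)"
      by (intro set_integral_discrete_difference[where X="{x, y}"]) auto
    also have "\<dots> = (LBINT x:{x<..<y}. 0)"
      using that by (intro set_lebesgue_integral_cong) (auto simp: \<eta>0)
    finally show ?thesis by (simp add: set_lebesgue_integral_def)
  qed
  have Wl: "W x = 0" if "x \<in> I" "x \<le> c" for x
    using primitive_onD(2)[OF W that(2) Icc_sub[OF that(1) cI(1)]] zero_int[of c x] Wc by simp
  have Wr: "W x = 0" if "x \<in> I" "d \<le> x" for x
    using primitive_onD(2)[OF W that(2) Icc_sub[OF cI(2) that(1)]] zero_int[of x d] Wd by simp
  have Wcont: "continuous_on I W" by (rule primitive_on_continuous[OF W open_I])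
  have WL: "W \<in> L2 \<mu>"
  proof -
    obtain B where B: "\<And>x. x \<in> {c..d} \<Longrightarrow> \<bar>W x\<bar> \<le> B"
      using bounded_on_Icc[OF Wcont cd(2)] by blast
    have Wm: "W \<in> borel_measurable (restrict_space borel I)" by (rule borel_measurable_continuous_on_restrict[OF Wcont])
    have "AE x in \<mu>. W x = indicator {c..d} x * W x"
      by (rule AE_I2) (use Wl Wr in \<open>force split: split_indicator\<close>)
    then show ?thesis
      using square_integrable_cong_AE[OF _ _ \<mu>.square_integrable_Icc[OF cd(2) B Wm]] Wm by (simp add: L2_def)
  qed
  \<comment> \<open>\<open>W\<close> is 0 outside \<open>{c..d}\<close>, so it is admissible
    whichever ends are accessible.\<close>
  have "vanish W"
    unfolding vanish_def using Wl Wr cI by (metis abs_zero less_imp_le)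
  then have WD: "(W, \<eta>) \<in> Dom" using WL \<eta>L W by (simp add: mem_Dom)
  have eq: "form (v, p) (W, \<eta>) = L2_ip \<mu> g W" using w WD by (simp add: weak_def)
  \<comment> \<open>Integration by parts trades \<open>m (k v - g)\<close> against its primitive
    \<open>P\<close>; the weak equation then only involves \<open>p - P\<close>.\<close>
  have bp: "(LBINT x:{c..d}. m x * (k x * v x - g x) * W x) + (LBINT x:{c..d}. P x * (\<rho> x * \<eta> x)) = 0"
    using primitive_on_by_parts[OF P W less_imp_le[OF cd(1)] cd(2)] Wc Wd by simp
  have kg: "(\<lambda>x. k x * v x - g x) \<in> L2 \<mu>"
    using L2.S_diff[OF k_mult_L2[OF vL] g] by (simp add: fun_diff_def)
  have "L2_ip \<mu> (\<lambda>x. k x * v x - g x) W = (LBINT x:{c..d}. m x * (k x * v x - g x) * W x)"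
  proof -
    have meas: "(\<lambda>x. (k x * v x - g x) * W x) \<in> borel_measurable (restrict_space borel I)"
      using kg WL by (auto simp: L2_def square_integrable_def)
    have "L2_ip \<mu> (\<lambda>x. k x * v x - g x) W = (LBINT x:I. m x * ((k x * v x - g x) * W x))"
      unfolding L2_ip_def by (rule \<mu>.integral_weighted[OF meas])
    also have "\<dots> = (LBINT x:{c..d}. m x * (k x * v x - g x) * W x)"
      unfolding set_lebesgue_integral_def
      using Wl Wr cd(2) by (intro Bochner_Integration.integral_cong) (force split: split_indicator)+
    finally show ?thesis .
  qed
  moreover have "L2_ip \<mu> (\<lambda>x. k x * v x - g x) W = L2_ip \<mu> (\<lambda>x. k x * v x) W - L2_ip \<mu> g W"
    using L2.ip_diff[OF k_mult_L2[OF vL] g WL] by (simp add: fun_diff_def)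
  moreover have "(LBINT x:{c..d}. P x * (\<rho> x * \<eta> x)) = L2_ip \<nu> (\<lambda>x. \<iota> x * P x) \<eta>"
  proof -
    have meas: "(\<lambda>x. \<iota> x * P x * \<eta> x) \<in> borel_measurable (restrict_space borel I)"
      using PL \<eta>L by (auto simp: L2_def square_integrable_def)
    show ?thesis
      unfolding L2_ip_def \<nu>.integral_weighted[OF meas] set_lebesgue_integral_def
      using cd(2) by (intro Bochner_Integration.integral_cong) (auto simp: \<iota>_def split: split_indicator)
  qed
  moreover have "L2_ip \<nu> p \<eta> = L2_ip \<nu> (\<lambda>x. \<iota> x * p x) \<eta>"
    unfolding L2_ip_def by (intro Bochner_Integration.integral_cong) (auto simp: \<eta>_def h_def \<iota>_def split: split_indicator)
  ultimately have "L2_ip \<nu> (\<lambda>x. \<iota> x * p x) \<eta> - L2_ip \<nu> (\<lambda>x. \<iota> x * P x) \<eta> = 0"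
    using eq bp by (simp add: form_def)
  then have h\<eta>: "L2_ip \<nu> h \<eta> = 0"
    using L2.ip_diff[OF pL' PL \<eta>L] by (simp add: h_def[abs_def] fun_diff_def right_diff_distrib)
  \<comment> \<open>\<open>\<eta> = h - C \<iota>\<close> is orthogonal to \<open>h\<close> by the
    weak equation and to \<open>\<iota>\<close> by the choice of \<open>C\<close>, hence to
    itself.\<close>
  have "L2_ip \<nu> \<iota> \<eta> = W d - W c"
    using \<nu>.set_integral_L2[OF cd(2) \<eta>L] primitive_onD(2)[OF W less_imp_le[OF cd(1)] cd(2)]
    by (simp add: \<iota>_def)
  then have "L2_ip \<nu> \<eta> \<eta> = 0"
    using L2.ip_diff[OF hL L2.S_scale[OF \<iota>L, of C] \<eta>L] h\<eta> Wc Wd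
    by (simp add: \<eta>_def[abs_def] fun_diff_def L2.ip_scale[OF \<iota>L \<eta>L[unfolded \<eta>_def[abs_def]]])
  then have "L2.nrm \<nu> \<eta> = 0" by (simp add: L2.nrm_def)
  then have "AE x in \<nu>. \<eta> x = 0"
    using \<eta>L by (subst (asm) L2_nrm_eq_0_iff) (auto simp: L2_def)
  then have "AE x in lborel. x \<in> I \<longrightarrow> \<eta> x = 0" by (simp add: \<nu>.AE_weighted)
  then have "AE x in lborel. x \<in> {c..d} \<longrightarrow> p x = P x + C"
    by eventually_elim (use cd(2) in \<open>auto simp: \<eta>_def h_def \<iota>_def\<close>)
  then show ?thesis ..
qed

text \<open>\<open>weak_flux_Icc\<close> gives a constant for each compact interval. All intervals
  are enlarged to contain one fixed interval of positive length, where the constants are forced to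
  coincide.\<close>

lemma weak_strong:
  assumes w: "weak g z" and g: "g \<in> L2 \<mu>"
  shows "\<exists>P. primitive_on I P (\<lambda>x. m x * (k x * fst z x - g x)) \<and>
    primitive_on I (fst z) (\<lambda>x. \<rho> x * P x) \<and> (AE x in lborel. x \<in> I \<longrightarrow> snd z x = P x)"
proof -
  have D: "z \<in> Dom" and w': "weak g (fst z, snd z)" using w by (simp_all add: weak_def)
  obtain x0 where x0: "x0 \<in> I" using I_ne by blast
  obtain c0 d0 where cd0: "c0 < x0" "x0 < d0" "{c0..d0} \<subseteq> I" using open_Icc_nhd[OF open_I x0] .
  define P0 where "P0 x = (LBINT y=ereal x0..ereal x. m y * (k y * fst z y - g y))" for x
  have "(\<lambda>x. k x * fst z x - g x) \<in> L2 \<mu>"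
    using L2.S_diff[OF k_mult_L2[OF Dom_D(1)[OF D]] g] by (simp add: fun_diff_def)
  then have P0: "primitive_on I P0 (\<lambda>x. m x * (k x * fst z x - g x))"
    unfolding P0_def by (intro interval_integral_primitive interval_I x0 \<mu>.L1_loc_on_L2)
  obtain C where C: "AE x in lborel. x \<in> {c0..d0} \<longrightarrow> snd z x = P0 x + C"
    using weak_flux_Icc[OF w' g _ cd0(3) P0] cd0 by auto
  have "AE x in lborel. x \<in> I \<longrightarrow> snd z x = P0 x + C"
  proof (rule AE_open_Icc[OF open_I])
    fix x y assume xy: "{x..y} \<subseteq> I"
    show "AE t in lborel. x < t \<and> t < y \<longrightarrow> snd z t = P0 t + C"
    proof (cases "x < y")
      case True
      define c d where "c = min x c0" and "d = max y d0"
      have "c \<in> I" "d \<in> I" using xy cd0 True by (auto simp: c_def d_def min_def max_def)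
      then have cd: "c < d" "{c..d} \<subseteq> I" using Icc_sub cd0 by (auto simp: c_def d_def)
      obtain C' where C': "AE t in lborel. t \<in> {c..d} \<longrightarrow> snd z t = P0 t + C'"
        using weak_flux_Icc[OF w' g cd P0] by blast
      have "C' = C"
      proof (rule ccontr)
        assume "C' \<noteq> C"
        have "AE t in lborel. t \<notin> {c0..d0}"
          using C C' by eventually_elim (use \<open>C' \<noteq> C\<close> in \<open>auto simp: c_def d_def\<close>)
        then have "emeasure lborel {c0..d0} = 0"
          by (subst (asm) AE_iff_measurable[of "{c0..d0}"]) auto
        then show False using cd0 by simp
      qed
      then show ?thesis using C' by (auto elim!: eventually_mono simp: c_def d_def)
    qed auto
  qed
  then have ae: "AE x in lborel. x \<in> I \<longrightarrow> snd z x = P0 x + C" .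
  have P: "primitive_on I (\<lambda>x. P0 x + C) (\<lambda>x. m x * (k x * fst z x - g x))"
    using P0 by (simp add: primitive_on_def)
  moreover have "primitive_on I (fst z) (\<lambda>x. \<rho> x * (P0 x + C))"
  proof (rule primitive_on_cong[OF Dom_D(3)[OF D] refl])
    show "AE x in lborel. x \<in> I \<longrightarrow> \<rho> x * snd z x = \<rho> x * (P0 x + C)"
      using ae by eventually_elim simp
    have "continuous_on I (\<lambda>x. \<rho> x * (P0 x + C))"
      by (intro continuous_intros \<rho>_cont primitive_on_continuous[OF P0 open_I])
    then show "set_borel_measurable borel I (\<lambda>x. \<rho> x * (P0 x + C))"
      using borel_measurable_continuous_on_restrict[of I "\<lambda>x. \<rho> x * (P0 x + C)"]
      by (simp add: set_borel_measurable_def borel_measurable_restrict_space_iff)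
  qed simp
  ultimately show ?thesis using ae by blast
qed

text \<open>The choice of the weak solution is immaterial on \<open>I\<close> by
  \<open>weak_unique\<close>, and the value 0 elsewhere makes \<open>R\<close> linear as an
  operation on functions defined on the whole line.\<close>

definition R :: "(real \<Rightarrow> real) \<Rightarrow> real \<Rightarrow> real" where
  "R g x = (if x \<in> I then fst (SOME z. weak g z) x else 0)"

text \<open>The derivative with respect to the scale, since \<open>s\<close> has derivative
  \<open>\<rho>\<close>.\<close>

definition flux :: "(real \<Rightarrow> real) \<Rightarrow> real \<Rightarrow> real" where
  "flux v x = deriv v x / \<rho> x"

lemma weak_cong:
  assumes w: "weak g z" and v: "\<And>x. x \<in> I \<Longrightarrow> v x = fst z x"
    and p: "AE x in lborel. x \<in> I \<longrightarrow> snd z x = p x" and pc: "continuous_on I p"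
    and prim: "primitive_on I (fst z) (\<lambda>x. \<rho> x * p x)"
  shows "weak g (v, p)"
proof -
  have D: "z \<in> Dom" using w by (simp add: weak_def)
  have pm: "p \<in> borel_measurable (restrict_space borel I)" by (rule borel_measurable_continuous_on_restrict[OF pc])
  have p': "AE x in \<nu>. p x = snd z x" unfolding \<nu>.AE_weighted using p by eventually_elim simp
  have pL: "p \<in> L2 \<nu>"
    using square_integrable_cong_AE[OF p', of ] pm Dom_D(2)[OF D] by (simp add: L2_def)
  have zm: "fst z \<in> borel_measurable (restrict_space borel I)"
    using Dom_D(1)[OF D] by (simp add: L2_def square_integrable_def)
  then have vm: "v \<in> borel_measurable (restrict_space borel I)"
    by (subst measurable_cong[of _ _ "fst z"]) (auto simp: space_restrict_space v)
  have v': "AE x in \<mu>. v x = fst z x" by (rule AE_I2) (simp add: v)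
  have vL: "v \<in> L2 \<mu>"
    using square_integrable_cong_AE[OF v'] vm Dom_D(1)[OF D] by (simp add: L2_def)
  have "primitive_on I v (\<lambda>x. \<rho> x * p x)"
    using prim by (rule primitive_on_cong_on) (simp_all add: v)
  moreover have "vanish v" using Dom_D(4)[OF D] v by (simp add: vanish_def)
  ultimately have D': "(v, p) \<in> Dom" using vL pL by (simp add: mem_Dom)
  have "form (v, p) y = form z y" if y: "y \<in> Dom" for y
  proof -
    have "L2_ip \<mu> (\<lambda>x. k x * v x) (fst y) = L2_ip \<mu> (\<lambda>x. k x * fst z x) (fst y)"
      unfolding L2_ip_def by (intro Bochner_Integration.integral_cong) (auto simp: v)
    moreover have "L2_ip \<nu> p (snd y) = L2_ip \<nu> (snd z) (snd y)"
      unfolding L2_ip_def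
    proof (rule integral_cong_AE)
      show "AE x in \<nu>. p x * snd y x = snd z x * snd y x" using p' by eventually_elim simp
    qed (use pm Dom_D(2)[OF D] Dom_D(2)[OF y] in \<open>auto simp: L2_def square_integrable_def\<close>)
    ultimately show ?thesis by (simp add: form_def)
  qed
  then show ?thesis using w D' by (simp add: weak_def)
qed

text \<open>The second component of a weak solution equals a continuous function \<open>P\<close>
  almost everywhere. Replacing it by \<open>P\<close> makes \<open>R g\<close> continuously
  differentiable on \<open>I\<close>, with \<open>P\<close> as flux at every point.\<close>

lemma R_weak:
  assumes g: "g \<in> L2 \<mu>"
  shows "weak g (R g, flux (R g))"
    and "primitive_on I (flux (R g)) (\<lambda>x. m x * (k x * R g x - g x))"
    and "x \<in> I \<Longrightarrow> (R g has_real_derivative \<rho> x * flux (R g) x) (at x)"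
proof -
  define z where "z = (SOME z. weak g z)"
  have w: "weak g z" unfolding z_def using weak_exists[OF g] by (rule someI_ex)
  have Rz: "R g x = fst z x" if "x \<in> I" for x using that by (simp add: R_def z_def)
  obtain P where P: "primitive_on I P (\<lambda>x. m x * (k x * fst z x - g x))"
    and zP: "primitive_on I (fst z) (\<lambda>x. \<rho> x * P x)" and ae: "AE x in lborel. x \<in> I \<longrightarrow> snd z x = P x"
    using weak_strong[OF w g] by blast
  have Pc: "continuous_on I P" by (rule primitive_on_continuous[OF P open_I])
  have der: "(R g has_real_derivative \<rho> x * P x) (at x)" if x: "x \<in> I" for x
  proof -
    have "(fst z has_real_derivative \<rho> x * P x) (at x)"
      using primitive_on_DERIV[OF zP open_I _ x] by (simp add: \<rho>_cont Pc continuous_on_mult)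
    then show ?thesis
      by (rule has_field_derivative_transform_within_open[OF _ open_I x]) (simp add: Rz)
  qed
  have fl: "flux (R g) x = P x" if "x \<in> I" for x
    using DERIV_imp_deriv[OF der[OF that]] \<nu>.w_pos[OF that] by (simp add: flux_def)
  show "x \<in> I \<Longrightarrow> (R g has_real_derivative \<rho> x * flux (R g) x) (at x)"
    using der[of x] fl[of x] by simp
  have zfl: "primitive_on I (fst z) (\<lambda>x. \<rho> x * flux (R g) x)"
    using zP by (rule primitive_on_cong_on) (simp_all add: fl)
  show "primitive_on I (flux (R g)) (\<lambda>x. m x * (k x * R g x - g x))"
    using P by (rule primitive_on_cong_on) (simp_all add: fl Rz)
  show "weak g (R g, flux (R g))"
  proof (rule weak_cong[OF w Rz])
    show "AE x in lborel. x \<in> I \<longrightarrow> snd z x = flux (R g) x" using ae by eventually_elim (simp add: fl)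
    show "continuous_on I (flux (R g))" using Pc by (rule continuous_on_eq) (simp add: fl)
  qed (use zfl in auto)
qed

lemma
  assumes g: "g \<in> L2 \<mu>"
  shows R_Dom: "(R g, flux (R g)) \<in> Dom"
    and R_L2: "R g \<in> L2 \<mu>" and flux_L2: "flux (R g) \<in> L2 \<nu>"
    and R_form: "y \<in> Dom \<Longrightarrow> form (R g, flux (R g)) y = L2_ip \<mu> g (fst y)"
    and R_nrm: "L2.nrm \<mu> (R g) \<le> L2.nrm \<mu> g" and flux_nrm: "L2.nrm \<nu> (flux (R g)) \<le> L2.nrm \<mu> g"
    and R_vanish: "vanish (R g)"
proof -
  show D: "(R g, flux (R g)) \<in> Dom" using R_weak(1)[OF g] by (simp add: weak_def)
  show "R g \<in> L2 \<mu>" "flux (R g) \<in> L2 \<nu>" "vanish (R g)" using Dom_D[OF D] by simp_all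
  show "y \<in> Dom \<Longrightarrow> form (R g, flux (R g)) y = L2_ip \<mu> g (fst y)" using R_weak(1)[OF g] by (simp add: weak_def)
  show "L2.nrm \<mu> (R g) \<le> L2.nrm \<mu> g"
    using nrm_fst_le[OF D] weak_bound[OF R_weak(1)[OF g] g] by simp
  show "L2.nrm \<nu> (flux (R g)) \<le> L2.nrm \<mu> g"
    using nrm_snd_le[OF D] weak_bound[OF R_weak(1)[OF g] g] by simp
qed

lemma R_lincomb:
  assumes f: "f \<in> L2 \<mu>" and g: "g \<in> L2 \<mu>"
  shows "R (a *\<^sub>R f + b *\<^sub>R g) = a *\<^sub>R R f + b *\<^sub>R R g"
proof
  fix x
  have h: "a *\<^sub>R f + b *\<^sub>R g \<in> L2 \<mu>" using f g by (intro L2.S_add L2.S_scale)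
  show "R (a *\<^sub>R f + b *\<^sub>R g) x = (a *\<^sub>R R f + b *\<^sub>R R g) x"
  proof (cases "x \<in> I")
    case True
    show ?thesis
      using weak_unique[OF R_weak(1)[OF h] weak_lincomb[OF R_weak(1)[OF f] R_weak(1)[OF g] f g] h True] by simp
  qed (simp add: R_def)
qed

sublocale R: positive_contraction "L2 \<mu>" "L2_ip \<mu>" R
proof (unfold_locales)
  fix f g assume f: "f \<in> L2 \<mu>" and g: "g \<in> L2 \<mu>"
  show "R (f + g) = R f + R g" using R_lincomb[OF f g, of 1 1] by simp
  show "L2_ip \<mu> (R f) g = L2_ip \<mu> f (R g)"
    using R_form[OF f R_Dom[OF g]] R_form[OF g R_Dom[OF f]]
    by (simp add: form_sym[of "(R f, _)"] L2.ip_sym[OF R_L2[OF f] g])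
next
  fix f assume f: "f \<in> L2 \<mu>"
  show "R f \<in> L2 \<mu>" by (rule R_L2[OF f])
  show "R (c *\<^sub>R f) = c *\<^sub>R R f" for c using R_lincomb[OF f f, of c 0] by simp
  show "0 \<le> L2_ip \<mu> (R f) f"
    using R_form[OF f R_Dom[OF f]] form_nonneg[OF R_Dom[OF f]] by (simp add: L2.ip_sym[OF R_L2[OF f] f])
  have "L2_ip \<mu> (R f) f \<le> L2.nrm \<mu> (R f) * L2.nrm \<mu> f"
    using L2.Cauchy_Schwarz[OF R_L2[OF f] f] by linarith
  also have "\<dots> \<le> L2.nrm \<mu> f * L2.nrm \<mu> f" using R_nrm[OF f] f by (intro mult_right_mono) auto
  finally show "L2_ip \<mu> (R f) f \<le> L2_ip \<mu> f f" by (simp add: L2.nrm_sq[OF f, symmetric] power2_eq_square)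
qed

lemma R_eq_0:
  assumes g: "g \<in> L2 \<mu>" and 0: "L2.nrm \<mu> (R g) = 0" and x: "x \<in> I"
  shows "R g x = 0" "flux (R g) x = 0"
proof -
  have "AE x in \<mu>. R g x = 0"
    using 0 R_L2[OF g] by (subst (asm) L2_nrm_eq_0_iff) (auto simp: L2_def)
  then have z: "R g x = 0" if "x \<in> I" for x
    using \<mu>.continuous_AE_zero[of "R g" x] primitive_on_continuous[OF Dom_D(3)[OF R_Dom[OF g]] open_I] that
    by (simp add: \<mu>.AE_weighted)
  then show "R g x = 0" using x .
  have "((\<lambda>_. 0) has_real_derivative \<rho> x * flux (R g) x) (at x)"
    by (rule has_field_derivative_transform_within_open[OF R_weak(3)[OF g x] open_I x]) (simp add: z)
  then have "\<rho> x * flux (R g) x = 0" by (metis DERIV_const DERIV_unique)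
  then show "flux (R g) x = 0" using \<nu>.w_pos[OF x] by simp
qed

text \<open>If \<open>R g\<close> vanishes, so does its flux on \<open>I\<close>, and the almost
  everywhere derivative of the flux is then \<open>- m g\<close>. Injectivity is what makes the
  range of \<open>R\<close> dense and the initial value attained.\<close>

lemma R_inj:
  assumes g: "g \<in> L2 \<mu>" and 0: "L2.nrm \<mu> (R g) = 0"
  shows "L2.nrm \<mu> g = 0"
proof -
  have "AE x in lborel. x \<in> I \<longrightarrow> g x = 0"
    using primitive_on_AE_DERIV[OF R_weak(2)[OF g] open_I]
  proof eventually_elim
    fix x assume *: "x \<in> I \<longrightarrow> (flux (R g) has_real_derivative m x * (k x * R g x - g x)) (at x)"
    show "x \<in> I \<longrightarrow> g x = 0"
    proof
      assume x: "x \<in> I"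
      have "((\<lambda>_. 0) has_real_derivative m x * (k x * R g x - g x)) (at x)"
        by (rule has_field_derivative_transform_within_open[OF *[rule_format, OF x] open_I x])
          (simp add: R_eq_0[OF g 0])
      then have "m x * (k x * R g x - g x) = 0" by (metis DERIV_const DERIV_unique)
      then show "g x = 0" using \<mu>.w_pos[OF x] R_eq_0[OF g 0 x] by simp
    qed
  qed
  then have "AE x in \<mu>. g x = 0" by (simp add: \<mu>.AE_weighted)
  then show ?thesis using g by (subst L2_nrm_eq_0_iff) (auto simp: L2_def)
qed

text \<open>A Sobolev-type estimate: a value is at most the oscillation over \<open>{c..d}\<close>
  plus norm over root of mass. The energy controls the oscillation of \<open>R g\<close>; the
  equation itself controls that of the flux, whose increments are integrals of
  \<open>m (k R g - g)\<close>.\<close>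

lemma local_bound:
  assumes cd: "c < d" "{c..d} \<subseteq> I"
  shows "\<exists>C\<ge>0. \<forall>g\<in>L2 \<mu>. \<forall>x\<in>{c..d}. \<bar>R g x\<bar> \<le> C * L2.nrm \<mu> g \<and> \<bar>flux (R g) x\<bar> \<le> C * L2.nrm \<mu> g"
proof -
  define M where "M = (LBINT x:{c..d}. m x)"
  define r where "r = (LBINT x:{c..d}. \<rho> x)"
  have M: "M > 0" unfolding M_def by (rule \<mu>.set_integral_pos[OF cd])
  have r: "r > 0" unfolding r_def by (rule \<nu>.set_integral_pos[OF cd])
  have cdI: "c \<in> I" "d \<in> I" using cd by auto
  define C1 where "C1 = sqrt (s d - s c) + 1 / sqrt M"
  define C2 where "C2 = sqrt M * (K + 1) + 1 / sqrt r"
  have sd: "0 \<le> s d - s c" using s_mono[OF cdI] cd by simp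
  have C: "0 \<le> C1" "0 \<le> C2" using sd M r K_ge by (auto simp: C1_def C2_def)
  \<comment> \<open>If the value at \<open>x\<close> exceeds the oscillation \<open>b\<close>, the
    excess is a lower bound for the function on the whole interval, and the hypothesis
    \<open>n\<close> applies to it.\<close>
  have gen: "\<bar>f x\<bar> \<le> b + N / sqrt T"
    if le: "\<And>x y. x \<in> {c..d} \<Longrightarrow> y \<in> {c..d} \<Longrightarrow> \<bar>f y - f x\<bar> \<le> b" and x: "x \<in> {c..d}"
      and n: "\<And>a. 0 \<le> a \<Longrightarrow> (\<And>x. x \<in> {c..d} \<Longrightarrow> a \<le> \<bar>f x\<bar>) \<Longrightarrow> a \<le> N / sqrt T" and N: "0 \<le> N / sqrt T"
    for f :: "real \<Rightarrow> real" and b N T x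
  proof (cases "\<bar>f x\<bar> \<le> b")
    case False
    have "\<bar>f x\<bar> - b \<le> N / sqrt T"
    proof (rule n)
      fix y assume "y \<in> {c..d}"
      then show "\<bar>f x\<bar> - b \<le> \<bar>f y\<bar>" using le[OF x] by fastforce
    qed (use False in simp)
    then show ?thesis by simp
  qed (use N in linarith)
  have "\<bar>R g x\<bar> \<le> C1 * L2.nrm \<mu> g \<and> \<bar>flux (R g) x\<bar> \<le> C2 * L2.nrm \<mu> g" if g: "g \<in> L2 \<mu>" and x: "x \<in> {c..d}" for g x
  proof
    have ng: "0 \<le> L2.nrm \<mu> g" using g by simp
    have "\<bar>R g x\<bar> \<le> sqrt (s d - s c) * L2.nrm \<mu> g + L2.nrm \<mu> g / sqrt M"
    proof (rule gen[OF _ x])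
      fix x y assume xy: "x \<in> {c..d}" "y \<in> {c..d}"
      then have xyI: "x \<in> I" "y \<in> I" using cd by auto
      have "\<bar>R g y - R g x\<bar> \<le> sqrt \<bar>s y - s x\<bar> * L2.nrm \<nu> (flux (R g))"
        using energy_bound[OF Dom_D(3)[OF R_Dom[OF g]] _ xyI] flux_L2[OF g] by simp
      also have "\<dots> \<le> sqrt (s d - s c) * L2.nrm \<mu> g"
        using s_mono[OF cdI(1) xyI(1)] s_mono[OF cdI(1) xyI(2)] s_mono[OF xyI(1) cdI(2)] s_mono[OF xyI(2) cdI(2)] xy
        by (intro mult_mono flux_nrm g L2.nrm_nonneg flux_L2) (auto simp: abs_le_iff)
      finally show "\<bar>R g y - R g x\<bar> \<le> sqrt (s d - s c) * L2.nrm \<mu> g" .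
    next
      fix a :: real assume "0 \<le> a" "\<And>x. x \<in> {c..d} \<Longrightarrow> a \<le> \<bar>R g x\<bar>"
      then have "a \<le> L2.nrm \<mu> (R g) / sqrt M"
        unfolding M_def by (intro \<mu>.nrm_ge_on_Icc cd R_L2 g)
      also have "\<dots> \<le> L2.nrm \<mu> g / sqrt M" using R_nrm[OF g] M by (intro divide_right_mono) auto
      finally show "a \<le> L2.nrm \<mu> g / sqrt M" .
    qed (use ng M in simp)
    then show "\<bar>R g x\<bar> \<le> C1 * L2.nrm \<mu> g" by (simp add: C1_def distrib_right)
    have kg: "(\<lambda>x. k x * R g x - g x) \<in> L2 \<mu>"
      using L2.S_diff[OF k_mult_L2[OF R_L2[OF g]] g] by (simp add: fun_diff_def)
    have kgn: "L2.nrm \<mu> (\<lambda>x. k x * R g x - g x) \<le> (K + 1) * L2.nrm \<mu> g"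
    proof -
      have "L2.nrm \<mu> (\<lambda>x. k x * R g x) \<le> L2.nrm \<mu> (K *\<^sub>R R g)"
        unfolding L2.nrm_def L2_ip_def
      proof (rule real_sqrt_le_mono, rule integral_mono)
        show "integrable \<mu> (\<lambda>x. k x * R g x * (k x * R g x))"
          using k_mult_L2[OF R_L2[OF g]] by (intro square_integrable_mult) (simp_all add: L2_def)
        show "integrable \<mu> (\<lambda>x. (K *\<^sub>R R g) x * (K *\<^sub>R R g) x)"
          using L2.S_scale[OF R_L2[OF g], of K] by (intro square_integrable_mult) (simp_all only: L2_def mem_Collect_eq)
        fix x assume "x \<in> space \<mu>"
        then have "(k x)\<^sup>2 \<le> K\<^sup>2" using abs_k_le[of x] abs_le_square_iff[of "k x" K] by simp
        then have "(k x)\<^sup>2 * (R g x)\<^sup>2 \<le> K\<^sup>2 * (R g x)\<^sup>2" by (rule mult_right_mono) simp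
        then show "k x * R g x * (k x * R g x) \<le> (K *\<^sub>R R g) x * (K *\<^sub>R R g) x"
          by (simp add: power2_eq_square mult_ac)
      qed
      also have "\<dots> = K * L2.nrm \<mu> (R g)" using K_ge by (simp add: L2.nrm_scale[OF R_L2[OF g]])
      also have "\<dots> \<le> K * L2.nrm \<mu> g" using R_nrm[OF g] K_ge by (intro mult_left_mono) auto
      finally show ?thesis
        using L2.nrm_diff_le[OF k_mult_L2[OF R_L2[OF g]] g] by (simp add: fun_diff_def distrib_right)
    qed
    have "\<bar>flux (R g) x\<bar> \<le> sqrt M * ((K + 1) * L2.nrm \<mu> g) + L2.nrm \<mu> g / sqrt r"
    proof (rule gen[OF _ x])
      have *: "\<bar>flux (R g) y - flux (R g) x\<bar> \<le> sqrt M * ((K + 1) * L2.nrm \<mu> g)"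
        if xy: "x \<in> {c..d}" "y \<in> {c..d}" "x \<le> y" for x y
      proof -
        have sub: "{x..y} \<subseteq> {c..d}" "{x..y} \<subseteq> I" using xy cd by auto
        have "\<bar>flux (R g) y - flux (R g) x\<bar> = \<bar>LBINT t:{x..y}. m t * (k t * R g t - g t)\<bar>"
          using primitive_onD(2)[OF R_weak(2)[OF g] xy(3) sub(2)] by simp
        also have "\<dots> \<le> sqrt (LBINT t:{x..y}. m t) * L2.nrm \<mu> (\<lambda>x. k x * R g x - g x)"
          by (rule \<mu>.set_integral_L2_bound[OF sub(2) kg])
        also have "\<dots> \<le> sqrt M * ((K + 1) * L2.nrm \<mu> g)"
        proof (intro mult_mono kgn real_sqrt_le_mono L2.nrm_nonneg kg)
          show "(LBINT t:{x..y}. m t) \<le> M"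
            unfolding M_def set_lebesgue_integral_def
          proof (rule integral_mono)
            show "indicator {x..y} t *\<^sub>R m t \<le> indicator {c..d} t *\<^sub>R m t" for t
              using sub(1) cd(2) \<mu>.w_pos[of t] by (auto split: split_indicator)
          qed (use L1_loc_on_Icc[OF \<mu>.w_loc] sub(2) cd(2) in \<open>simp_all add: set_integrable_def\<close>)
        qed (use M in simp)
        finally show ?thesis .
      qed
      show "\<bar>flux (R g) y - flux (R g) x\<bar> \<le> sqrt M * ((K + 1) * L2.nrm \<mu> g)"
        if "x \<in> {c..d}" "y \<in> {c..d}" for x y
        using *[of x y] *[of y x] that by (cases "x \<le> y") (auto simp: abs_minus_commute)
    next
      fix a :: real assume "0 \<le> a" "\<And>x. x \<in> {c..d} \<Longrightarrow> a \<le> \<bar>flux (R g) x\<bar>"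
      then have "a \<le> L2.nrm \<nu> (flux (R g)) / sqrt r"
        unfolding r_def by (intro \<nu>.nrm_ge_on_Icc cd flux_L2 g)
      also have "\<dots> \<le> L2.nrm \<mu> g / sqrt r" using flux_nrm[OF g] r by (intro divide_right_mono) auto
      finally show "a \<le> L2.nrm \<mu> g / sqrt r" .
    qed (use ng r in simp)
    then show "\<bar>flux (R g) x\<bar> \<le> C2 * L2.nrm \<mu> g" by (simp add: C2_def distrib_right mult.assoc)
  qed
  then have "\<bar>R g x\<bar> \<le> (C1 + C2) * L2.nrm \<mu> g \<and> \<bar>flux (R g) x\<bar> \<le> (C1 + C2) * L2.nrm \<mu> g"
    if "g \<in> L2 \<mu>" "x \<in> {c..d}" for g x
    using that C L2.nrm_nonneg[OF that(1)] mult_nonneg_nonneg[OF C(1) L2.nrm_nonneg[OF that(1)]]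
      mult_nonneg_nonneg[OF C(2) L2.nrm_nonneg[OF that(1)]] by (fastforce simp: distrib_right)
  then show ?thesis using C by (intro exI[of _ "C1 + C2"]) auto
qed

lemma flux_diff:
  assumes "f \<in> L2 \<mu>" "g \<in> L2 \<mu>" "x \<in> I"
  shows "flux (R (f - g)) x = flux (R f) x - flux (R g) x"
proof -
  have "(R f has_real_derivative \<rho> x * flux (R f) x) (at x)" "(R g has_real_derivative \<rho> x * flux (R g) x) (at x)"
    using R_weak(3) assms by auto
  then have "((\<lambda>y. R f y - R g y) has_real_derivative \<rho> x * flux (R f) x - \<rho> x * flux (R g) x) (at x)"
    by (rule DERIV_diff)
  moreover have "(\<lambda>y. R f y - R g y) = R (f - g)"
    using R.R_diff[OF assms(1,2)] by (simp add: fun_diff_def)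
  ultimately have "(R (f - g) has_real_derivative \<rho> x * (flux (R f) x - flux (R g) x)) (at x)"
    by (simp add: right_diff_distrib)
  then show ?thesis
    using \<nu>.w_pos[OF assms(3)] by (simp add: flux_def[of "R (f - g)"] DERIV_imp_deriv)
qed

end

section \<open>Scalar functions of the resolvent\<close>

text \<open>To the value \<open>r\<close> of the resolvent \<open>(L - A)\<^sup>-\<^sup>1\<close> corresponds the value \<open>L - 1 / r\<close> of \<open>A\<close>. The first function
  below is \<open>A\<^sup>k exp (t A) (L - A)\<close>, the second \<open>(L - A)\<close> times the integral of \<open>exp (\<tau> A)\<close> over \<open>\<tau> \<in> [0, t]\<close>; at \<open>r = 0\<close> they are
  extended by their limits.\<close>
definition resolvent_exp :: "real \<Rightarrow> nat \<Rightarrow> real \<Rightarrow> real \<Rightarrow> real" where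
  "resolvent_exp L k t r = (if r \<le> 0 then 0 else (L - 1 / r) ^ k * exp (t * (L - 1 / r)) / r)"

definition resolvent_int :: "real \<Rightarrow> real \<Rightarrow> real \<Rightarrow> real" where
  "resolvent_int L t r = (if r \<le> 0 then 1 else if L * r = 1 then L * t else (exp (t * (L - 1 / r)) - 1) / (L * r - 1))"

lemma power_div_fact_le_exp:
  assumes "0 \<le> (x::real)" shows "x ^ n / fact n \<le> exp x"
proof -
  have "(\<Sum>i\<in>{n}. x ^ i /\<^sub>R fact i) \<le> (\<Sum>i. x ^ i /\<^sub>R fact i)"
    using assms by (intro sum_le_suminf summable_exp_generic) auto
  then show ?thesis by (simp add: exp_def divide_inverse mult.commute)
qed

lemma abs_exp_minus_one_le:
  assumes "x \<le> c" "0 \<le> (c::real)" shows "\<bar>exp x - 1\<bar> \<le> \<bar>x\<bar> * exp c"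
proof (cases "0 \<le> x")
  case True
  have "exp x * (1 - x) \<le> exp x * exp (- x)" using exp_ge_add_one_self[of "-x"] by (intro mult_left_mono) auto
  then have "exp x - 1 \<le> x * exp x" by (simp add: algebra_simps flip: exp_add)
  also have "\<dots> \<le> x * exp c" using True assms by (intro mult_left_mono) auto
  finally show ?thesis using True by simp
next
  case False
  have "1 - exp x \<le> - x" using exp_ge_add_one_self[of x] by linarith
  also have "\<dots> \<le> - x * exp c" using False assms by (simp add: mult_le_cancel_left1)
  finally show ?thesis using False by simp
qed

context
  fixes L :: real
  assumes L: "1 \<le> L"
begin

text \<open>With \<open>y = 1 / r\<close>, the factor \<open>exp (- t y)\<close> absorbs
  \<open>y^(k + 2)\<close>. One power more than the symbol contains is absorbed, which leaves the
  factor \<open>r\<close> and hence continuity at 0.\<close>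

lemma resolvent_exp_bound:
  assumes t: "0 < t" and r: "0 \<le> r" "r \<le> 1"
  shows "\<bar>resolvent_exp L k t r\<bar> \<le> (L + 1) ^ k * exp (t * L) * (fact (k + 2) / t ^ (k + 2)) * r"
proof (cases "r = 0")
  case False
  define y where "y = 1 / r"
  have y: "1 \<le> y" using r False by (simp add: y_def)
  have "\<bar>L - y\<bar> \<le> (L + 1) * y"
  proof -
    have "L \<le> L * y" using L y by (simp add: mult_le_cancel_left1)
    then show ?thesis using L y unfolding distrib_right abs_le_iff by linarith
  qed
  then have 1: "\<bar>L - y\<bar> ^ k \<le> ((L + 1) * y) ^ k" by (intro power_mono) auto
  have 2: "y ^ (k + 2) * exp (- (t * y)) \<le> fact (k + 2) / t ^ (k + 2)"
  proof -
    have "(t * y) ^ (k + 2) / fact (k + 2) \<le> exp (t * y)" using t y by (intro power_div_fact_le_exp) auto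
    then have "t ^ (k + 2) * y ^ (k + 2) \<le> fact (k + 2) * exp (t * y)"
      by (simp only: power_mult_distrib) (simp only: pos_divide_le_eq fact_gt_zero mult.commute)
    then have "t ^ (k + 2) * y ^ (k + 2) * exp (- (t * y)) \<le> fact (k + 2) * exp (t * y) * exp (- (t * y))"
      by (intro mult_right_mono) auto
    also have "\<dots> = fact (k + 2)" by (simp only: mult.assoc exp_add[symmetric]) simp
    finally show ?thesis using t by (simp only: pos_le_divide_eq zero_less_power) (simp only: mult_ac)
  qed
  have "\<bar>resolvent_exp L k t r\<bar> = \<bar>L - y\<bar> ^ k * (exp (t * L) * exp (- (t * y))) * y"
    using r False by (simp add: resolvent_exp_def y_def abs_mult power_abs right_diff_distrib flip: exp_add)
  also have "\<dots> \<le> ((L + 1) * y) ^ k * (exp (t * L) * exp (- (t * y))) * y"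
    using y by (intro mult_right_mono 1) auto
  also have "\<dots> = (L + 1) ^ k * exp (t * L) * (y ^ (k + 2) * exp (- (t * y))) * r"
  proof -
    have r: "r = 1 / y" using False by (simp add: y_def)
    show ?thesis unfolding r using y by (simp add: power_mult_distrib power2_eq_square power_add)
  qed
  also have "\<dots> \<le> (L + 1) ^ k * exp (t * L) * (fact (k + 2) / t ^ (k + 2)) * r"
    using L r by (intro mult_right_mono mult_left_mono 2) auto
  finally show ?thesis .
qed (simp add: resolvent_exp_def)

lemma resolvent_exp_continuous:
  assumes t: "0 < t"
  shows "continuous_on {0..1} (resolvent_exp L k t)"
  unfolding continuous_on_eq_continuous_within
proof
  fix r :: real assume r: "r \<in> {0..1}"
  show "continuous (at r within {0..1}) (resolvent_exp L k t)"
  proof (cases "r = 0")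
    case True
    let ?C = "(L + 1) ^ k * exp (t * L) * (fact (k + 2) / t ^ (k + 2))"
    have "(resolvent_exp L k t \<longlongrightarrow> 0) (at 0 within {0..1})"
    proof (rule Lim_null_comparison)
      show "\<forall>\<^sub>F r in at 0 within {0..1}. norm (resolvent_exp L k t r) \<le> ?C * r"
        using resolvent_exp_bound[OF t] by (auto simp: eventually_at_filter)
      show "((\<lambda>r. ?C * r) \<longlongrightarrow> 0) (at 0 within {0..1})"
        by (rule tendsto_eq_intros | simp)+
    qed
    then show ?thesis using True by (simp add: continuous_within resolvent_exp_def)
  next
    case False
    then have r0: "r > 0" using r by simp
    have "isCont (\<lambda>r. (L - 1 / r) ^ k * exp (t * (L - 1 / r)) / r) r"
      using r0 by (intro continuous_intros) auto
    moreover have ev: "\<forall>\<^sub>F x in nhds r. (L - 1 / x) ^ k * exp (t * (L - 1 / x)) / x = resolvent_exp L k t x"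
      using eventually_nhds_in_open[of "{0<..}" r] r0 by (auto elim!: eventually_mono simp: resolvent_exp_def)
    ultimately have "isCont (resolvent_exp L k t) r" unfolding isCont_cong[OF ev] by blast
    then show ?thesis by (rule continuous_at_imp_continuous_at_within)
  qed
qed

lemma resolvent_exp_deriv:
  "((\<lambda>t. resolvent_exp L k t r) has_real_derivative resolvent_exp L (Suc k) t r) (at t)"
proof (cases "r \<le> 0")
  case False
  have "((\<lambda>t. (L - 1 / r) ^ k * exp (t * (L - 1 / r)) / r) has_real_derivative
      (L - 1 / r) ^ k * (exp (t * (L - 1 / r)) * (L - 1 / r)) / r) (at t)"
    using False by (auto intro!: derivative_eq_intros)
  then show ?thesis using False by (simp add: resolvent_exp_def mult_ac)
qed (simp add: resolvent_exp_def)

lemma resolvent_int_deriv: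
  "((\<lambda>t. resolvent_int L t r) has_real_derivative resolvent_exp L 0 t r) (at t)"
proof (cases "r \<le> 0")
  case r: False
  show ?thesis
  proof (cases "L * r = 1")
    case True
    then have e: "L - 1 / r = 0" using r by (simp add: field_simps)
    have "(\<lambda>t. resolvent_int L t r) = (\<lambda>t. L * t)" "resolvent_exp L 0 t r = L"
      using r True e by (auto simp: resolvent_int_def resolvent_exp_def)
    then show ?thesis by (auto intro!: derivative_eq_intros)
  next
    case False
    have "((\<lambda>t. (exp (t * (L - 1 / r)) - 1) / (L * r - 1)) has_real_derivative
        exp (t * (L - 1 / r)) * (L - 1 / r) / (L * r - 1)) (at t)"
      using False by (auto intro!: derivative_eq_intros)
    moreover have "exp (t * (L - 1 / r)) * (L - 1 / r) / (L * r - 1) = resolvent_exp L 0 t r"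
    proof -
      have "(L - 1 / r) / (L * r - 1) = 1 / r" using False r by (simp add: field_simps)
      then have "exp (t * (L - 1 / r)) * ((L - 1 / r) / (L * r - 1)) = exp (t * (L - 1 / r)) / r"
        by (simp only: times_divide_eq_right mult_1_right)
      then show ?thesis using r by (simp add: resolvent_exp_def)
    qed
    moreover have "(\<lambda>t. resolvent_int L t r) = (\<lambda>t. (exp (t * (L - 1 / r)) - 1) / (L * r - 1))"
      using r False by (simp add: resolvent_int_def)
    ultimately show ?thesis by simp
  qed
qed (simp add: resolvent_int_def resolvent_exp_def)

text \<open>A time derivative multiplies the symbol by \<open>L - 1 / r\<close>; clearing the
  denominator gives a relation that also holds at \<open>r = 0\<close> and involves only continuous
  functions.\<close>

lemma resolvent_exp_identity: "(L * r - 1) * resolvent_exp L k t r = r * resolvent_exp L (Suc k) t r"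
  by (cases "r \<le> 0") (auto simp: resolvent_exp_def field_simps)

text \<open>The integral of the exponential starts from the identity, which leaves the constant 1;
  in the equation it becomes the source term.\<close>

lemma resolvent_int_identity: "0 \<le> r \<Longrightarrow> (L * r - 1) * resolvent_int L t r = r * resolvent_exp L 0 t r - 1"
proof -
  assume r: "0 \<le> r"
  show ?thesis
  proof (cases "r = 0 \<or> L * r \<noteq> 1")
    case True
    then show ?thesis using r by (auto simp: resolvent_exp_def resolvent_int_def)
  next
    case False
    then have "L - 1 / r = 0" "L * r - 1 = 0" "0 < r" using r by (auto simp: field_simps)
    then show ?thesis unfolding resolvent_exp_def by simp
  qed
qed

text \<open>Near \<open>r = 1 / L\<close> the quotient is a removable singularity of \<open>(exp x - 1) / x\<close>.\<close>
lemma resolvent_int_continuous: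
  assumes t: "0 < t"
  shows "continuous_on {0..1} (resolvent_int L t)"
proof -
  define D where "D x = (if x = 0 then 1 else (exp x - 1) / x)" for x :: real
  have D: "isCont D x" for x
  proof (cases "x = 0")
    case True
    have "((\<lambda>h. (exp (0 + h) - exp 0) / h) \<longlongrightarrow> 1) (at (0::real))"
      using DERIV_exp[of "0::real"] by (simp add: DERIV_def)
    then have "(D \<longlongrightarrow> 1) (at 0)"
      by (rule Lim_transform_eventually) (auto simp: D_def eventually_at_filter)
    then show ?thesis using True by (simp add: isCont_def D_def)
  next
    case False
    have "isCont (\<lambda>x. (exp x - 1) / x) x" using False by (intro continuous_intros) auto
    moreover have ev: "\<forall>\<^sub>F y in nhds x. (exp y - 1) / y = D y"
      using eventually_nhds_in_open[of "- {0}" x] False by (auto elim!: eventually_mono simp: D_def)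
    ultimately show ?thesis unfolding isCont_cong[OF ev] by blast
  qed
  show ?thesis
    unfolding continuous_on_eq_continuous_within
  proof
    fix r :: real assume r: "r \<in> {0..1}"
    show "continuous (at r within {0..1}) (resolvent_int L t)"
    proof (cases "r = 0")
      case True
      \<comment> \<open>Near 0 the identity is solved for \<open>resolvent_int\<close>, which
        inherits continuity from \<open>resolvent_exp\<close>; staying below \<open>1 / L\<close>
        keeps the denominator away from 0.\<close>
      have "continuous_on {0..<1/L} (\<lambda>r. (r * resolvent_exp L 0 t r - 1) / (L * r - 1))"
      proof (intro continuous_intros continuous_on_subset[OF resolvent_exp_continuous[OF t]])
        have "1 / L \<le> 1" using L by simp
        then show "{0..<1/L} \<subseteq> {0..1}" by auto
        show "\<forall>r\<in>{0..<1/L}. L * r - 1 \<noteq> 0" using L by (auto simp: field_simps)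
      qed
      moreover have "(r * resolvent_exp L 0 t r - 1) / (L * r - 1) = resolvent_int L t r" if "r \<in> {0..<1/L}" for r
      proof -
        have "L * r - 1 \<noteq> 0" using that L by (auto simp: field_simps)
        then show ?thesis using resolvent_int_identity[of r t] that by (simp add: field_simps)
      qed
      ultimately have "continuous_on {0..<1/L} (resolvent_int L t)" by (rule continuous_on_eq)
      then have "continuous (at 0 within {0..<1/L}) (resolvent_int L t)"
        using L by (simp add: continuous_on_eq_continuous_within)
      moreover have "at 0 within {0..<1/L} = at 0 within {0..1}"
      proof (rule at_within_nhd[of _ "{..<1/L}"])
        have "1 / L \<le> 1" using L by simp
        then show "{0..<1/L} \<inter> {..<1/L} - {0} = {0..1} \<inter> {..<1/L} - {0}" by auto
      qed (use L in auto)
      ultimately show ?thesis using True by (simp add: continuous_within)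
    next
      case False
      then have r0: "r > 0" using r by simp
      \<comment> \<open>This single expression covers \<open>L r = 1\<close> too, as
        \<open>D\<close> has its limit value at 0.\<close>
      have "isCont (\<lambda>r. t * D (t * (L - 1 / r)) / r) r"
        using r0 by (intro continuous_intros isCont_o2[OF _ D]) auto
      moreover have ev: "\<forall>\<^sub>F x in nhds r. t * D (t * (L - 1 / x)) / x = resolvent_int L t x"
        using eventually_nhds_in_open[of "{0<..}" r, OF open_greaterThan]
      proof (rule eventually_mono)
        fix x :: real assume x: "x \<in> {0<..}"
        show "t * D (t * (L - 1 / x)) / x = resolvent_int L t x"
        proof (cases "L * x = 1")
          case True
          then have "1 / x = L" using x by (auto simp: field_simps)
          then have "L - 1 / x = 0" by simp
          have "t * D (t * (L - 1 / x)) / x = t * (1 / x)" by (simp add: D_def \<open>L - 1 / x = 0\<close>)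
          also have "\<dots> = resolvent_int L t x"
            unfolding \<open>1 / x = L\<close> using x True by (simp add: resolvent_int_def)
          finally show ?thesis .
        next
          case False
          then have "L - 1 / x \<noteq> 0" "L * x - 1 \<noteq> 0" using x by (auto simp: field_simps)
          then show ?thesis using x False t by (simp add: D_def resolvent_int_def) (simp add: field_simps)
        qed
      qed (use r0 in simp)
      ultimately have "isCont (resolvent_int L t) r" unfolding isCont_cong[OF ev] by blast
      then show ?thesis by (rule continuous_at_imp_continuous_at_within)
    qed
  qed
qed

text \<open>The product is the integral of \<open>exp (\<tau> (L - 1 / r))\<close> over
  \<open>[0, t]\<close> when \<open>r > 0\<close>, with integrand at most
  \<open>exp (t L)\<close>.\<close>

lemma resolvent_int_small:
  assumes t: "0 \<le> t" and r: "0 \<le> r" "r \<le> 1"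
  shows "\<bar>r * resolvent_int L t r\<bar> \<le> t * exp (t * L)"
proof (cases "r = 0")
  case False
  then have r0: "r > 0" using r by simp
  show ?thesis
  proof (cases "L * r = 1")
    case True
    then have "r * resolvent_int L t r = t" using r0 by (simp add: resolvent_int_def mult.commute mult.left_commute)
    then show ?thesis using t L by (simp add: mult_le_cancel_left1)
  next
    case False
    have nz: "L * r - 1 \<noteq> 0" using False by simp
    have "r * resolvent_int L t r * (L * r - 1) = r * (exp (t * (L - 1 / r)) - 1)"
      using r0 False by (simp add: resolvent_int_def)
    then have "\<bar>r * resolvent_int L t r\<bar> * \<bar>L * r - 1\<bar> = r * \<bar>exp (t * (L - 1 / r)) - 1\<bar>"
      using r0 by (metis abs_mult abs_of_pos)
    also have "\<dots> \<le> r * (\<bar>t * (L - 1 / r)\<bar> * exp (t * L))"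
      using r0 t L by (intro mult_left_mono abs_exp_minus_one_le) (auto intro!: mult_left_mono)
    also have "\<dots> = t * exp (t * L) * \<bar>L * r - 1\<bar>"
    proof -
      have "r * \<bar>L - 1 / r\<bar> = \<bar>L * r - 1\<bar>"
      proof -
        have "r * (L - 1 / r) = L * r - 1" using r0 by (simp add: field_simps)
        then show ?thesis using r0 by (metis abs_mult abs_of_pos)
      qed
      moreover have "r * (\<bar>t * (L - 1 / r)\<bar> * exp (t * L)) = t * exp (t * L) * (r * \<bar>L - 1 / r\<bar>)"
        using t by (simp add: abs_mult)
      ultimately show ?thesis by simp
    qed
    finally show ?thesis using nz by simp
  qed
qed (use t in simp)

text \<open>\<open>r * resolvent_exp L 0 t r\<close> is the symbol of the semigroup. It is not
  uniformly close to 1 for small \<open>t\<close>; the extra factor \<open>r\<close> in the first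
  estimate, available on the range of \<open>R\<close>, restores closeness of order
  \<open>t\<close>.\<close>

lemma resolvent_exp_small:
  assumes t: "0 \<le> t" and r: "0 \<le> r" "r \<le> 1"
  shows "\<bar>(r * resolvent_exp L 0 t r - 1) * r\<bar> \<le> t * exp (t * L) * (L + 1)"
    and "\<bar>r * resolvent_exp L 0 t r\<bar> \<le> exp (t * L)"
proof -
  show "\<bar>(r * resolvent_exp L 0 t r - 1) * r\<bar> \<le> t * exp (t * L) * (L + 1)"
  proof (cases "r = 0")
    case False
    then have r0: "r > 0" using r by simp
    have "\<bar>(r * resolvent_exp L 0 t r - 1) * r\<bar> = r * \<bar>exp (t * (L - 1 / r)) - 1\<bar>"
      using r0 by (simp add: resolvent_exp_def abs_mult)
    also have "\<dots> \<le> r * (\<bar>t * (L - 1 / r)\<bar> * exp (t * L))"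
      using r0 t L by (intro mult_left_mono abs_exp_minus_one_le) (auto intro!: mult_left_mono)
    also have "\<dots> = t * exp (t * L) * \<bar>L * r - 1\<bar>"
    proof -
      have "r * \<bar>L - 1 / r\<bar> = \<bar>L * r - 1\<bar>"
      proof -
        have "r * (L - 1 / r) = L * r - 1" using r0 by (simp add: field_simps)
        then show ?thesis using r0 by (metis abs_mult abs_of_pos)
      qed
      moreover have "r * (\<bar>t * (L - 1 / r)\<bar> * exp (t * L)) = t * exp (t * L) * (r * \<bar>L - 1 / r\<bar>)"
        using t by (simp add: abs_mult)
      ultimately show ?thesis by simp
    qed
    also have "\<dots> \<le> t * exp (t * L) * (L + 1)"
    proof -
      have "\<bar>L * r - 1\<bar> \<le> L + 1" proof -
        have "L * r \<le> L" "0 \<le> L * r" using r0 r L by (simp_all add: mult_left_le)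
        then show ?thesis using L by linarith
      qed
      then show ?thesis using t by (intro mult_left_mono) auto
    qed
    finally show ?thesis .
  qed (use t L in simp)
  show "\<bar>r * resolvent_exp L 0 t r\<bar> \<le> exp (t * L)"
  proof (cases "r = 0")
    case False
    then have r0: "r > 0" using r by simp
    then show ?thesis using t by (simp add: resolvent_exp_def mult_left_mono)
  qed simp
qed

end

section \<open>Families of scalar functions smooth in time\<close>

lemma Taylor_two_bound:
  fixes f f' f'' :: "real \<Rightarrow> real"
  assumes f: "\<And>z. z \<in> closed_segment x y \<Longrightarrow> (f has_real_derivative f' z) (at z)"
    and f': "\<And>z. z \<in> closed_segment x y \<Longrightarrow> (f' has_real_derivative f'' z) (at z)"
    and B: "\<And>z. z \<in> closed_segment x y \<Longrightarrow> \<bar>f'' z\<bar> \<le> B"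
  shows "\<bar>f y - f x - (y - x) * f' x\<bar> \<le> B * (y - x)\<^sup>2"
proof -
  have 1: "\<bar>f' z - f' x\<bar> \<le> B * \<bar>y - x\<bar>" if z: "z \<in> closed_segment x y" for z
  proof -
    have "norm (f' z - f' x) \<le> B * norm (z - x)"
    proof (rule field_differentiable_bound[of "closed_segment x y" f' f''])
      show "(f' has_field_derivative f'' w) (at w within closed_segment x y)" if "w \<in> closed_segment x y" for w
        using f'[OF that] by (rule has_field_derivative_at_within)
    qed (use B z in auto)
    also have "\<dots> \<le> B * \<bar>y - x\<bar>"
    proof (rule mult_left_mono)
      show "norm (z - x) \<le> \<bar>y - x\<bar>" using z by (auto simp: closed_segment_eq_real_ivl split: if_splits)
      show "0 \<le> B" using B[of x] by force
    qed
    finally show ?thesis by simp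
  qed
  have "norm ((\<lambda>z. f z - z * f' x) y - (\<lambda>z. f z - z * f' x) x) \<le> (B * \<bar>y - x\<bar>) * norm (y - x)"
  proof (rule field_differentiable_bound[of "closed_segment x y" _ "\<lambda>z. f' z - f' x"])
    show "((\<lambda>z. f z - z * f' x) has_field_derivative f' z - f' x) (at z within closed_segment x y)"
      if "z \<in> closed_segment x y" for z
      using has_field_derivative_at_within[OF f[OF that]] by (auto intro!: derivative_eq_intros)
  qed (use 1 in auto)
  then show ?thesis by (simp add: algebra_simps power2_eq_square abs_mult_self_eq flip: abs_mult)
qed

text \<open>Member \<open>Suc k\<close> is the time derivative of member \<open>k\<close>, expressed
  as an expansion whose remainder is uniform in \<open>r\<close>, so that it passes through
  \<open>fc\<close>. The window \<open>t / 2\<close> keeps \<open>\<tau>\<close> positive.\<close>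

definition smooth_family :: "(nat \<Rightarrow> real \<Rightarrow> real \<Rightarrow> real) \<Rightarrow> bool" where
  "smooth_family \<Phi> \<longleftrightarrow> (\<forall>k. \<forall>t>0. continuous_on {0..1} (\<Phi> k t) \<and>
     (\<exists>B. \<forall>\<tau>. \<bar>\<tau> - t\<bar> < t / 2 \<longrightarrow> (\<forall>r\<in>{0..1}. \<bar>\<Phi> k \<tau> r - \<Phi> k t r - (\<tau> - t) * \<Phi> (Suc k) t r\<bar> \<le> B * (\<tau> - t)\<^sup>2)))"

lemma smooth_familyI:
  assumes c: "\<And>k t. 0 < t \<Longrightarrow> continuous_on {0..1} (\<Phi> k t)"
    and d: "\<And>k t r. ((\<lambda>t. \<Phi> k t r) has_real_derivative \<Phi> (Suc k) t r) (at t)"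
    and b: "\<And>k t0 T. 0 < t0 \<Longrightarrow> \<exists>B. \<forall>t\<in>{t0..T}. \<forall>r\<in>{0..1}. \<bar>\<Phi> (Suc k) t r\<bar> \<le> B"
  shows "smooth_family \<Phi>"
  unfolding smooth_family_def
proof (intro allI impI conjI c)
  fix k and t :: real assume t: "0 < t"
  \<comment> \<open>The second derivative of member \<open>k\<close> has index
    \<open>Suc (Suc k)\<close>; the interval contains all \<open>\<tau>\<close> of the
    window.\<close>
  obtain B where B: "\<And>\<tau> r. \<tau> \<in> {t/2..2*t} \<Longrightarrow> r \<in> {0..1} \<Longrightarrow> \<bar>\<Phi> (Suc (Suc k)) \<tau> r\<bar> \<le> B"
  proof -
    have "\<exists>B. \<forall>\<tau>\<in>{t/2..2*t}. \<forall>r\<in>{0..1}. \<bar>\<Phi> (Suc (Suc k)) \<tau> r\<bar> \<le> B" using t by (intro b) simp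
    then show ?thesis using that by blast
  qed
  show "\<exists>B. \<forall>\<tau>. \<bar>\<tau> - t\<bar> < t / 2 \<longrightarrow> (\<forall>r\<in>{0..1}. \<bar>\<Phi> k \<tau> r - \<Phi> k t r - (\<tau> - t) * \<Phi> (Suc k) t r\<bar> \<le> B * (\<tau> - t)\<^sup>2)"
  proof (intro exI[of _ B] allI impI ballI)
    fix \<tau> r :: real assume \<tau>: "\<bar>\<tau> - t\<bar> < t / 2" and r: "r \<in> {0..1}"
    show "\<bar>\<Phi> k \<tau> r - \<Phi> k t r - (\<tau> - t) * \<Phi> (Suc k) t r\<bar> \<le> B * (\<tau> - t)\<^sup>2"
    proof (rule Taylor_two_bound[where f = "\<lambda>t. \<Phi> k t r" and f' = "\<lambda>t. \<Phi> (Suc k) t r"])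
      fix z assume "z \<in> closed_segment t \<tau>"
      then have "z \<in> {t/2..2*t}" using \<tau> by (auto simp: closed_segment_eq_real_ivl split: if_splits)
      then show "\<bar>\<Phi> (Suc (Suc k)) z r\<bar> \<le> B" using B r by blast
    qed (rule d)+
  qed
qed

lemma resolvent_exp_locally_bounded:
  assumes L: "1 \<le> L" and t0: "0 < t0"
  shows "\<exists>B. \<forall>t\<in>{t0..T}. \<forall>r\<in>{0..1}. \<bar>resolvent_exp L k t r\<bar> \<le> B"
proof (intro exI ballI)
  fix t r :: real assume t: "t \<in> {t0..T}" and r: "r \<in> {0..1}"
  have "\<bar>resolvent_exp L k t r\<bar> \<le> (L + 1) ^ k * exp (t * L) * (fact (k + 2) / t ^ (k + 2)) * r"
    using t t0 r by (intro resolvent_exp_bound L) auto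
  also have "\<dots> \<le> (L + 1) ^ k * exp (T * L) * (fact (k + 2) / t0 ^ (k + 2)) * 1"
    using t t0 r L by (intro mult_mono divide_left_mono power_mono) auto
  finally show "\<bar>resolvent_exp L k t r\<bar> \<le> (L + 1) ^ k * exp (T * L) * (fact (k + 2) / t0 ^ (k + 2)) * 1" .
qed

lemma smooth_resolvent_exp: "1 \<le> L \<Longrightarrow> smooth_family (resolvent_exp L)"
  by (intro smooth_familyI resolvent_exp_continuous resolvent_exp_deriv resolvent_exp_locally_bounded)

text \<open>The integral differentiates to the exponential, so from index 1 on the family is
  \<open>resolvent_exp\<close> shifted by one.\<close>

definition resolvent_int_family :: "real \<Rightarrow> nat \<Rightarrow> real \<Rightarrow> real \<Rightarrow> real" where
  "resolvent_int_family L k = (case k of 0 \<Rightarrow> resolvent_int L | Suc k \<Rightarrow> resolvent_exp L k)"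

lemma smooth_resolvent_int: "1 \<le> L \<Longrightarrow> smooth_family (resolvent_int_family L)"
proof (rule smooth_familyI)
  assume L: "1 \<le> L"
  show "0 < t \<Longrightarrow> continuous_on {0..1} (resolvent_int_family L k t)" for k t
    by (cases k) (auto simp: resolvent_int_family_def intro: L resolvent_int_continuous resolvent_exp_continuous)
  show "((\<lambda>t. resolvent_int_family L k t r) has_real_derivative resolvent_int_family L (Suc k) t r) (at t)" for k t r
    by (cases k) (auto simp: resolvent_int_family_def intro: L resolvent_int_deriv resolvent_exp_deriv)
  show "\<exists>B. \<forall>t\<in>{t0..T}. \<forall>r\<in>{0..1}. \<bar>resolvent_int_family L (Suc k) t r\<bar> \<le> B" if "0 < t0" for k t0 T
    using resolvent_exp_locally_bounded[OF L that] by (simp add: resolvent_int_family_def)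
qed

context positive_contraction
begin

lemma fc_smooth_family:
  assumes \<Phi>: "smooth_family \<Phi>" and x: "x \<in> S" and t: "0 < t"
  shows "fc (\<Phi> k t) x \<in> S"
    and "\<exists>B. \<forall>\<tau>. \<bar>\<tau> - t\<bar> < t / 2 \<longrightarrow>
      nrm (fc (\<Phi> k \<tau>) x - fc (\<Phi> k t) x - (\<tau> - t) *\<^sub>R fc (\<Phi> (Suc k) t) x) \<le> B * (\<tau> - t)\<^sup>2"
proof -
  have c: "continuous_on {0..1} (\<Phi> k t)" if "0 < t" for k t using \<Phi> that by (simp add: smooth_family_def)
  show "fc (\<Phi> k t) x \<in> S" by (intro fc_in c t x)
  obtain B where B: "\<And>\<tau> r. \<bar>\<tau> - t\<bar> < t / 2 \<Longrightarrow> r \<in> {0..1} \<Longrightarrow>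
      \<bar>\<Phi> k \<tau> r - \<Phi> k t r - (\<tau> - t) * \<Phi> (Suc k) t r\<bar> \<le> B * (\<tau> - t)\<^sup>2"
    using \<Phi> t unfolding smooth_family_def by blast
  show "\<exists>B. \<forall>\<tau>. \<bar>\<tau> - t\<bar> < t / 2 \<longrightarrow>
      nrm (fc (\<Phi> k \<tau>) x - fc (\<Phi> k t) x - (\<tau> - t) *\<^sub>R fc (\<Phi> (Suc k) t) x) \<le> B * (\<tau> - t)\<^sup>2"
  proof (intro exI[of _ "B * nrm x"] allI impI)
    fix \<tau> assume \<tau>: "\<bar>\<tau> - t\<bar> < t / 2"
    then have "0 < \<tau>" using t by linarith
    have "nrm (fc (\<Phi> k \<tau>) x - 1 *\<^sub>R fc (\<Phi> k t) x - (\<tau> - t) *\<^sub>R fc (\<Phi> (Suc k) t) x) \<le> B * (\<tau> - t)\<^sup>2 * nrm x"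
      using B[OF \<tau>] by (intro fc_lincomb_bound c \<open>0 < \<tau>\<close> t x) simp
    then show "nrm (fc (\<Phi> k \<tau>) x - fc (\<Phi> k t) x - (\<tau> - t) *\<^sub>R fc (\<Phi> (Suc k) t) x) \<le> B * nrm x * (\<tau> - t)\<^sup>2"
      by (simp add: mult_ac)
  qed
qed

text \<open>With \<open>G\<close> the time derivative of the symbol \<open>F\<close>, this recovers
  \<open>L - A\<close> applied to \<open>R (fc F x)\<close>. It is used with \<open>c = 0\<close>
  for the exponential and with \<open>c = -1\<close> for its integral at index 0.\<close>

lemma fc_resolvent_identity:
  assumes F: "continuous_on {0..1} F" and G: "continuous_on {0..1} G" and x: "x \<in> S"
    and eq: "\<And>r. r \<in> {0..1} \<Longrightarrow> L * r * F r - r * G r - F r = c"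
  shows "nrm (L *\<^sub>R R (fc F x) - R (fc G x) - fc F x - c *\<^sub>R x) = 0"
proof -
  \<comment> \<open>\<open>fc_lincomb_bound\<close> relates three functions at a time; the auxiliary
    function \<open>F + c\<close> splits the four-term identity into two such relations.\<close>
  let ?rF = "\<lambda>r. r * F r" and ?rG = "\<lambda>r. r * G r" and ?H = "\<lambda>r. F r + c" and ?one = "\<lambda>r::real. 1::real"
  have c: "continuous_on {0..1} ?rF" "continuous_on {0..1} ?rG" "continuous_on {0..1} ?H" "continuous_on {0..1} ?one"
    by (intro continuous_intros F G)+
  note S = fc_in[OF F x] fc_in[OF G x] fc_in[OF c(1) x] fc_in[OF c(2) x] fc_in[OF c(3) x] fc_in[OF c(4) x]
  have 1: "nrm (fc ?H x - L *\<^sub>R fc ?rF x - (-1) *\<^sub>R fc ?rG x) \<le> 0 * nrm x"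
    using eq by (intro fc_lincomb_bound c x) (simp add: algebra_simps)
  have 2: "nrm (fc ?H x - 1 *\<^sub>R fc F x - c *\<^sub>R fc ?one x) \<le> 0 * nrm x"
    by (intro fc_lincomb_bound F c x) simp
  define A where "A = fc ?H x - L *\<^sub>R fc ?rF x - (-1) *\<^sub>R fc ?rG x"
  define B where "B = fc ?H x - 1 *\<^sub>R fc F x - c *\<^sub>R fc ?one x"
  define P where "P = R (fc F x) - fc ?rF x"
  define Q where "Q = R (fc G x) - fc ?rG x"
  define U where "U = x - fc ?one x"
  have mem: "A \<in> S" "B \<in> S" "P \<in> S" "Q \<in> S" "U \<in> S"
    unfolding A_def B_def P_def Q_def U_def using S x by (auto intro!: S_diff S_scale)
  have z: "nrm A \<le> 0" "nrm B \<le> 0" "nrm P = 0" "nrm Q = 0" "nrm U = 0"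
    using 1 2 fc_R[OF F x] fc_R[OF G x] fc_one[OF x] by (simp_all add: A_def B_def P_def Q_def U_def)
  have e: "L *\<^sub>R R (fc F x) - R (fc G x) - fc F x - c *\<^sub>R x = (L *\<^sub>R P - Q) + ((B - A) - c *\<^sub>R U)"
    by (simp add: A_def B_def P_def Q_def U_def algebra_simps)
  have "nrm ((L *\<^sub>R P - Q) + ((B - A) - c *\<^sub>R U)) \<le> (\<bar>L\<bar> * nrm P + nrm Q) + ((nrm B + nrm A) + \<bar>c\<bar> * nrm U)"
    using mem
    by (intro order_trans[OF nrm_triangle] add_mono order_trans[OF nrm_diff_le] S_diff S_scale)
      (auto simp: nrm_scale)
  also have "\<dots> \<le> 0" using z by simp
  finally show ?thesis
    unfolding e using mem by (intro antisym nrm_nonneg) auto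
qed

end

section \<open>The evolution\<close>

context positive_contraction
begin

text \<open>Any constant \<open>M\<close> may replace \<open>nrm x\<close> in the error estimate.
  For differences of values the natural constant is the sum of two norms.\<close>

lemma fc_unique:
  assumes F: "continuous_on {0..1} F" and x: "x \<in> S" and y: "y \<in> S" and M: "0 \<le> M"
    and le: "\<And>p e. (\<And>r. r \<in> {0..1} \<Longrightarrow> \<bar>poly p r - F r\<bar> \<le> e) \<Longrightarrow> nrm (pol p x - y) \<le> e * M"
  shows "nrm (y - fc F x) = 0"
proof -
  have "nrm (y - fc F x) \<le> 0 + e" if e: "e > 0" for e
  proof -
    define T where "T = M + nrm x + 1"
    have T: "T > 0" "M + nrm x \<le> T" using M x by (simp_all add: T_def add_nonneg_pos)
    define d where "d = e / T"
    have d: "d > 0" using e T by (simp add: d_def)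
    obtain p where p: "\<forall>r\<in>{0..1}. \<bar>poly p r - F r\<bar> \<le> d" using poly_approx[OF F d] by blast
    have "nrm (y - fc F x) \<le> nrm (y - pol p x) + nrm (pol p x - fc F x)"
      using F x y by (intro nrm_triangle_sub) auto
    also have "nrm (y - pol p x) = nrm (pol p x - y)" using x y by (intro nrm_minus_commute) auto
    also have "nrm (pol p x - y) + nrm (pol p x - fc F x) \<le> d * M + d * nrm x"
      using p by (intro add_mono le fc_spec(2)[OF F x p]) auto
    also have "\<dots> = d * (M + nrm x)" by (simp add: distrib_left)
    also have "\<dots> \<le> d * T" using d T by (intro mult_left_mono) auto
    also have "\<dots> = e" using T by (simp add: d_def)
    finally show ?thesis by simp
  qed
  then have "nrm (y - fc F x) \<le> 0" by (rule field_le_epsilon)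
  then show ?thesis using F x y by (intro antisym nrm_nonneg) auto
qed

lemma fc_arg_diff:
  assumes F: "continuous_on {0..1} F" and x: "x \<in> S" and y: "y \<in> S"
  shows "nrm (fc F x - fc F y - fc F (x - y)) = 0"
proof (rule fc_unique[OF F])
  fix p e assume p: "\<And>r. r \<in> {0..1} \<Longrightarrow> \<bar>poly p r - F r\<bar> \<le> e"
  have e: "pol p (x - y) - (fc F x - fc F y) = (pol p x - fc F x) - (pol p y - fc F y)"
    using pol_arg_add[of x "(-1) *\<^sub>R y" p] pol_arg_scale[of y p "-1"] S_scale[of y "-1"] x y by simp
  have "nrm (pol p (x - y) - (fc F x - fc F y)) \<le> nrm (pol p x - fc F x) + nrm (pol p y - fc F y)"
    unfolding e using F x y by (intro nrm_diff_le) auto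
  also have "\<dots> \<le> e * nrm x + e * nrm y"
    using p by (intro add_mono fc_spec(2)[OF F x] fc_spec(2)[OF F y]) auto
  finally show "nrm (pol p (x - y) - (fc F x - fc F y)) \<le> e * (nrm x + nrm y)" by (simp add: distrib_left)
qed (use F x y in auto)

lemma fc_arg_R:
  assumes F: "continuous_on {0..1} F" and x: "x \<in> S"
  shows "nrm (fc (\<lambda>r. r * F r) x - fc F (R x)) = 0"
proof (rule fc_unique[OF F])
  have rF: "continuous_on {0..1} (\<lambda>r. r * F r)" by (intro continuous_intros F)
  then show "fc (\<lambda>r. r * F r) x \<in> S" using x by auto
  fix p e assume p: "\<And>r. r \<in> {0..1} \<Longrightarrow> \<bar>poly p r - F r\<bar> \<le> e"
  have "nrm (pol (pCons 0 p) x - fc (\<lambda>r. r * F r) x) \<le> e * nrm x"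
  proof (rule fc_spec(2)[OF rF x], rule ballI)
    fix r :: real assume r: "r \<in> {0..1}"
    have "\<bar>poly (pCons 0 p) r - r * F r\<bar> = r * \<bar>poly p r - F r\<bar>"
      using r by (simp add: abs_mult right_diff_distrib[symmetric])
    also have "\<dots> \<le> 1 * \<bar>poly p r - F r\<bar>" using r by (intro mult_right_mono) auto
    finally show "\<bar>poly (pCons 0 p) r - r * F r\<bar> \<le> e" using p[OF r] by simp
  qed
  then show "nrm (pol p (R x) - fc (\<lambda>r. r * F r) x) \<le> e * nrm x" using x by (simp add: pol_R)
qed (use x in auto)

text \<open>Split \<open>x\<close> into \<open>x - R z\<close> and \<open>R z\<close>. On the first
  part the symbol minus 1 is merely bounded, on the second the factor \<open>r\<close> makes it of
  order \<open>t\<close>, as is the source contribution.\<close>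

lemma fc_initial_bound:
  assumes L: "1 \<le> L" and x: "x \<in> S" and z: "z \<in> S" and h: "h \<in> S" and t: "0 < t"
  shows "nrm (R (fc (resolvent_exp L 0 t) x - fc (resolvent_int L t) h) - x)
    \<le> (exp (t * L) + 1) * nrm (x - R z) + t * exp (t * L) * (L + 1) * nrm z + t * exp (t * L) * nrm h"
proof -
  let ?E = "resolvent_exp L 0 t" and ?N = "resolvent_int L t" and ?one = "\<lambda>r::real. 1::real"
  let ?F = "\<lambda>r. r * resolvent_exp L 0 t r - 1"
  have E: "continuous_on {0..1} ?E" and N: "continuous_on {0..1} ?N"
    by (intro resolvent_exp_continuous resolvent_int_continuous L t)+
  have c: "continuous_on {0..1} (\<lambda>r. r * ?E r)" "continuous_on {0..1} (\<lambda>r. r * ?N r)" "continuous_on {0..1} ?one"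
    "continuous_on {0..1} ?F" "continuous_on {0..1} (\<lambda>r. r * ?F r)"
    by (intro continuous_intros E N)+
  define A where "A = R (fc ?E x) - fc (\<lambda>r. r * ?E r) x"
  define B where "B = R (fc ?N h) - fc (\<lambda>r. r * ?N r) h"
  define U where "U = x - fc ?one x"
  define V where "V = fc ?F x - 1 *\<^sub>R fc (\<lambda>r. r * ?E r) x - (-1) *\<^sub>R fc ?one x"
  define W where "W = fc ?F x - fc ?F (R z) - fc ?F (x - R z)"
  define Z where "Z = fc (\<lambda>r. r * ?F r) z - fc ?F (R z)"
  have xz: "x - R z \<in> S" using x z by auto
  note S = fc_in[OF E x] fc_in[OF N h] fc_in[OF c(1) x] fc_in[OF c(2) h] fc_in[OF c(3) x] fc_in[OF c(4) x]
    fc_in[OF c(4) R_in[OF z]] fc_in[OF c(4) xz] fc_in[OF c(5) z]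
  have mem: "A \<in> S" "B \<in> S" "U \<in> S" "V \<in> S" "W \<in> S" "Z \<in> S"
    unfolding A_def B_def U_def V_def W_def Z_def using S x h z by (auto intro!: S_diff S_scale)
  have V0: "nrm V \<le> 0 * nrm x" unfolding V_def by (intro fc_lincomb_bound c x) simp
  have z0: "nrm A = 0" "nrm B = 0" "nrm U = 0" "nrm W = 0" "nrm Z = 0"
    unfolding A_def B_def U_def W_def Z_def
    by (intro fc_R fc_one fc_arg_diff fc_arg_R E N c x h z R_in)+
  \<comment> \<open>\<open>A\<close>, \<open>B\<close>, \<open>U\<close>, \<open>V\<close>,
    \<open>W\<close>, \<open>Z\<close> record identities of the calculus and have norm zero; only
    the last three terms count.\<close>
  have e: "R (fc ?E x - fc ?N h) - x
      = ((A - B) - (U + V)) + ((W - Z) + ((fc ?F (x - R z) + fc (\<lambda>r. r * ?F r) z) - fc (\<lambda>r. r * ?N r) h))"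
    unfolding R_diff[OF S(1) S(2)] A_def B_def U_def V_def W_def Z_def by (simp add: algebra_simps)
  have n1: "nrm (fc ?F (x - R z)) \<le> (exp (t * L) + 1) * nrm (x - R z)"
  proof (intro fc_bound c xz)
    fix r :: real assume "r \<in> {0..1}"
    then show "\<bar>?F r\<bar> \<le> exp (t * L) + 1" using resolvent_exp_small(2)[OF L, of t r] t by (auto simp: abs_le_iff)
  qed
  have n2: "nrm (fc (\<lambda>r. r * ?F r) z) \<le> t * exp (t * L) * (L + 1) * nrm z"
  proof (intro fc_bound c z)
    fix r :: real assume "r \<in> {0..1}"
    then show "\<bar>r * ?F r\<bar> \<le> t * exp (t * L) * (L + 1)"
      using resolvent_exp_small(1)[OF L, of t r] t by (simp add: mult.commute)
  qed
  have n3: "nrm (fc (\<lambda>r. r * ?N r) h) \<le> t * exp (t * L) * nrm h"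
  proof (intro fc_bound c h)
    fix r :: real assume "r \<in> {0..1}"
    then show "\<bar>r * ?N r\<bar> \<le> t * exp (t * L)" using resolvent_int_small[OF L, of t r] t by simp
  qed
  have "nrm (R (fc ?E x - fc ?N h) - x)
      \<le> ((nrm A + nrm B) + (nrm U + nrm V)) + ((nrm W + nrm Z)
          + ((nrm (fc ?F (x - R z)) + nrm (fc (\<lambda>r. r * ?F r) z)) + nrm (fc (\<lambda>r. r * ?N r) h)))"
    unfolding e using mem S
    by (intro order_trans[OF nrm_triangle] order_trans[OF nrm_diff_le] add_mono S_add S_diff order_refl) auto
  then show ?thesis using n1 n2 n3 z0 V0 by simp
qed

lemma fc_initial_limit:
  assumes inj: "\<And>z. z \<in> S \<Longrightarrow> nrm (R z) = 0 \<Longrightarrow> nrm z = 0"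
    and L: "1 \<le> L" and x: "x \<in> S" and h: "h \<in> S"
  shows "((\<lambda>t. nrm (R (fc (resolvent_exp L 0 t) x - fc (resolvent_int L t) h) - x)) \<longlongrightarrow> 0) (at_right 0)"
proof (rule tendstoI)
  fix e :: real assume e: "e > 0"
  obtain z where z: "z \<in> S" "nrm (x - R z) < e / 4" using range_dense[OF inj x, of "e/4"] e by auto
  let ?b = "\<lambda>t. (exp (t * L) + 1) * nrm (x - R z) + t * exp (t * L) * (L + 1) * nrm z + t * exp (t * L) * nrm h"
  have "(?b \<longlongrightarrow> (exp (0 * L) + 1) * nrm (x - R z) + 0 * exp (0 * L) * (L + 1) * nrm z + 0 * exp (0 * L) * nrm h) (at_right 0)"
    by (intro tendsto_intros)
  then have "(?b \<longlongrightarrow> 2 * nrm (x - R z)) (at_right 0)" by simp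
  moreover have "2 * nrm (x - R z) < e" using z(2) nrm_nonneg[of "x - R z"] x z e by auto
  ultimately have "\<forall>\<^sub>F t in at_right 0. ?b t < e" by (rule order_tendstoD)
  then show "\<forall>\<^sub>F t in at_right 0. dist (nrm (R (fc (resolvent_exp L 0 t) x - fc (resolvent_int L t) h) - x)) 0 < e"
    using eventually_at_right_less[of 0]
  proof eventually_elim
    fix t :: real assume b: "?b t < e" and t: "0 < t"
    have "R (fc (resolvent_exp L 0 t) x - fc (resolvent_int L t) h) - x \<in> S"
      using x h t L by (auto intro!: S_diff R_in fc_in resolvent_exp_continuous resolvent_int_continuous)
    then show "dist (nrm (R (fc (resolvent_exp L 0 t) x - fc (resolvent_int L t) h) - x)) 0 < e"
      using fc_initial_bound[OF L x z(1) h t] b by simp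
  qed
qed

end

section \<open>From norm estimates to derivatives and joint continuity\<close>

lemma DERIV_from_quadratic_bound:
  fixes f :: "real \<Rightarrow> real"
  assumes e: "0 < e" and le: "\<And>y. \<bar>y - x\<bar> < e \<Longrightarrow> \<bar>f y - f x - (y - x) * D\<bar> \<le> B * (y - x)\<^sup>2"
  shows "(f has_real_derivative D) (at x)"
proof -
  have "((\<lambda>h. (f (x + h) - f x) / h - D) \<longlongrightarrow> 0) (at 0)"
  proof (rule Lim_null_comparison)
    have "\<forall>\<^sub>F h in at (0::real). h \<noteq> 0 \<and> \<bar>h\<bar> < e"
      using e by (auto simp: eventually_at dist_real_def intro!: exI[of _ e])
    then show "\<forall>\<^sub>F h in at 0. norm ((f (x + h) - f x) / h - D) \<le> B * \<bar>h\<bar>"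
    proof eventually_elim
      fix h :: real assume h: "h \<noteq> 0 \<and> \<bar>h\<bar> < e"
      have "(f (x + h) - f x) / h - D = (f (x + h) - f x - h * D) / h" using h by (simp add: field_simps)
      also have "\<bar>\<dots>\<bar> \<le> B * h\<^sup>2 / \<bar>h\<bar>"
        using le[of "x + h"] h by (simp add: abs_divide divide_right_mono)
      also have "\<dots> = B * \<bar>h\<bar>" using h by (simp add: power2_eq_square abs_if)
      finally show "norm ((f (x + h) - f x) / h - D) \<le> B * \<bar>h\<bar>" by simp
    qed
    show "((\<lambda>h. B * \<bar>h\<bar>) \<longlongrightarrow> 0) (at (0::real))"
      by (rule tendsto_eq_intros | simp)+
  qed
  then show ?thesis by (simp add: DERIV_def LIM_zero_iff)
qed

text \<open>Continuity in \<open>x\<close> at a fixed time suffices once the dependence on time is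
  controlled uniformly on compact intervals, which is the form in which \<open>local_bound\<close>
  delivers it.\<close>

lemma jointly_continuousI:
  fixes f :: "real \<Rightarrow> real \<Rightarrow> real"
  assumes I: "open I" and x: "\<And>t. 0 < t \<Longrightarrow> continuous_on I (f t)"
    and t: "\<And>t c d. 0 < t \<Longrightarrow> c < d \<Longrightarrow> {c..d} \<subseteq> I \<Longrightarrow>
      \<exists>n. (n \<longlongrightarrow> 0) (nhds t) \<and> (\<forall>\<tau>>0. \<forall>x\<in>{c..d}. \<bar>f \<tau> x - f t x\<bar> \<le> n \<tau>)"
  shows "jointly_continuous I f"
  unfolding jointly_continuous_def continuous_on_def
proof (rule ballI)
  fix p :: "real \<times> real" assume "p \<in> {0<..} \<times> I"
  then obtain t0 x0 where p: "p = (t0, x0)" "0 < t0" "x0 \<in> I" by auto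
  obtain c d where cd: "c < x0" "x0 < d" "{c..d} \<subseteq> I" using open_Icc_nhd[OF I p(3)] by blast
  obtain n where n: "(n \<longlongrightarrow> 0) (nhds t0)" "\<And>\<tau> x. \<tau> > 0 \<Longrightarrow> x \<in> {c..d} \<Longrightarrow> \<bar>f \<tau> x - f t0 x\<bar> \<le> n \<tau>"
    using t[OF p(2) _ cd(3)] cd by (meson less_trans)
  let ?F = "at p within {0<..} \<times> I"
  have id: "((\<lambda>z. z) \<longlongrightarrow> p) ?F" by (rule tendsto_ident_at)
  have fst: "(fst \<longlongrightarrow> t0) ?F" and snd: "(snd \<longlongrightarrow> x0) ?F"
    using tendsto_fst[OF id] tendsto_snd[OF id] p by simp_all
  have "isCont (f t0) x0" using x[OF p(2)] I p(3) by (simp add: continuous_on_eq_continuous_at)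
  then have 1: "((\<lambda>z. f t0 (snd z)) \<longlongrightarrow> f t0 x0) ?F" using snd by (rule isCont_tendsto_compose)
  have 2: "((\<lambda>z. f (fst z) (snd z) - f t0 (snd z)) \<longlongrightarrow> 0) ?F"
  proof (rule Lim_null_comparison)
    have "\<forall>\<^sub>F z in ?F. snd z \<in> {c<..<d}" using snd cd by (intro topological_tendstoD) auto
    moreover have "\<forall>\<^sub>F z in ?F. fst z \<in> {0<..}" using fst p by (intro topological_tendstoD) auto
    ultimately show "\<forall>\<^sub>F z in ?F. norm (f (fst z) (snd z) - f t0 (snd z)) \<le> n (fst z)"
      by eventually_elim (use n(2) in auto)
    show "((\<lambda>z. n (fst z)) \<longlongrightarrow> 0) ?F" by (rule filterlim_compose[OF n(1) fst])
  qed
  have "((\<lambda>z. f (fst z) (snd z)) \<longlongrightarrow> f t0 x0) ?F" using tendsto_add[OF 2 1] by simp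
  then show "((\<lambda>(t, x). f t x) \<longlongrightarrow> (case p of (t, x) \<Rightarrow> f t x)) ?F"
    by (simp add: p(1) case_prod_beta')
qed

text \<open>The Cauchy problem \<open>v' = A v - h\<close> with \<open>v(0) = g\<close>.\<close>

locale sl_evolution = sturm_liouville +
  fixes L :: real and g h :: "real \<Rightarrow> real"
  assumes L: "1 \<le> L" and g_L2: "g \<in> L2 (weighted I m)" and h_L2: "h \<in> L2 (weighted I m)"
begin

text \<open>\<open>L - A\<close> applied to the \<open>j\<close>-th time derivative of Duhamel's
  formula.\<close>

definition Y :: "nat \<Rightarrow> real \<Rightarrow> real \<Rightarrow> real" where
  "Y j t = R.fc (resolvent_exp L j t) g - R.fc (resolvent_int_family L j t) h"

definition v :: "nat \<Rightarrow> real \<Rightarrow> real \<Rightarrow> real" where "v j t = R (Y j t)"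

lemma Y_L2: "0 < t \<Longrightarrow> Y j t \<in> L2 \<mu>"
  unfolding Y_def
  by (intro L2.S_diff R.fc_smooth_family(1)[OF smooth_resolvent_exp[OF L] g_L2]
      R.fc_smooth_family(1)[OF smooth_resolvent_int[OF L] h_L2])

lemma Y_diff:
  assumes t: "0 < t"
  shows "\<exists>B. \<forall>\<tau>. \<bar>\<tau> - t\<bar> < t / 2 \<longrightarrow> L2.nrm \<mu> (Y j \<tau> - Y j t - (\<tau> - t) *\<^sub>R Y (Suc j) t) \<le> B * (\<tau> - t)\<^sup>2"
proof -
  let ?E = "\<lambda>j t. R.fc (resolvent_exp L j t) g" and ?N = "\<lambda>j t. R.fc (resolvent_int_family L j t) h"
  have S: "?E j t \<in> L2 \<mu>" "?N j t \<in> L2 \<mu>" if "0 < t" for j t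
    using R.fc_smooth_family(1)[OF smooth_resolvent_exp[OF L] g_L2 that]
      R.fc_smooth_family(1)[OF smooth_resolvent_int[OF L] h_L2 that] by auto
  obtain B1 where B1: "\<And>\<tau>. \<bar>\<tau> - t\<bar> < t / 2 \<Longrightarrow> L2.nrm \<mu> (?E j \<tau> - ?E j t - (\<tau> - t) *\<^sub>R ?E (Suc j) t) \<le> B1 * (\<tau> - t)\<^sup>2"
    using R.fc_smooth_family(2)[OF smooth_resolvent_exp[OF L] g_L2 t] by blast
  obtain B2 where B2: "\<And>\<tau>. \<bar>\<tau> - t\<bar> < t / 2 \<Longrightarrow> L2.nrm \<mu> (?N j \<tau> - ?N j t - (\<tau> - t) *\<^sub>R ?N (Suc j) t) \<le> B2 * (\<tau> - t)\<^sup>2"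
    using R.fc_smooth_family(2)[OF smooth_resolvent_int[OF L] h_L2 t] by blast
  have "L2.nrm \<mu> (Y j \<tau> - Y j t - (\<tau> - t) *\<^sub>R Y (Suc j) t) \<le> (B1 + B2) * (\<tau> - t)\<^sup>2" if \<tau>: "\<bar>\<tau> - t\<bar> < t / 2" for \<tau>
  proof -
    have \<tau>0: "0 < \<tau>" using \<tau> t by linarith
    have e: "Y j \<tau> - Y j t - (\<tau> - t) *\<^sub>R Y (Suc j) t
        = (?E j \<tau> - ?E j t - (\<tau> - t) *\<^sub>R ?E (Suc j) t) - (?N j \<tau> - ?N j t - (\<tau> - t) *\<^sub>R ?N (Suc j) t)"
      unfolding Y_def by (simp add: algebra_simps)
    have "L2.nrm \<mu> (Y j \<tau> - Y j t - (\<tau> - t) *\<^sub>R Y (Suc j) t)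
        \<le> L2.nrm \<mu> (?E j \<tau> - ?E j t - (\<tau> - t) *\<^sub>R ?E (Suc j) t)
        + L2.nrm \<mu> (?N j \<tau> - ?N j t - (\<tau> - t) *\<^sub>R ?N (Suc j) t)"
      unfolding e by (intro L2.nrm_diff_le L2.S_diff L2.S_scale S t \<tau>0)
    also have "\<dots> \<le> (B1 + B2) * (\<tau> - t)\<^sup>2" using B1[OF \<tau>] B2[OF \<tau>] by (simp add: distrib_right)
    finally show ?thesis .
  qed
  then show ?thesis by blast
qed

lemma Y_continuous:
  assumes t: "0 < t"
  shows "((\<lambda>\<tau>. L2.nrm \<mu> (Y j \<tau> - Y j t)) \<longlongrightarrow> 0) (nhds t)"
proof -
  obtain B where B: "\<And>\<tau>. \<bar>\<tau> - t\<bar> < t / 2 \<Longrightarrow> L2.nrm \<mu> (Y j \<tau> - Y j t - (\<tau> - t) *\<^sub>R Y (Suc j) t) \<le> B * (\<tau> - t)\<^sup>2"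
    using Y_diff[OF t] by blast
  show ?thesis
  proof (rule Lim_null_comparison)
    have "\<forall>\<^sub>F \<tau> in nhds t. \<bar>\<tau> - t\<bar> < t / 2"
      using t by (auto simp: eventually_nhds_metric dist_real_def intro!: exI[of _ "t/2"])
    then show "\<forall>\<^sub>F \<tau> in nhds t. norm (L2.nrm \<mu> (Y j \<tau> - Y j t)) \<le> B * (\<tau> - t)\<^sup>2 + \<bar>\<tau> - t\<bar> * L2.nrm \<mu> (Y (Suc j) t)"
    proof eventually_elim
      fix \<tau> assume \<tau>: "\<bar>\<tau> - t\<bar> < t / 2"
      then have "0 < \<tau>" using t by linarith
      then have S: "Y j \<tau> \<in> L2 \<mu>" "Y j t \<in> L2 \<mu>" "Y (Suc j) t \<in> L2 \<mu>" using t by (auto intro: Y_L2)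
      have "L2.nrm \<mu> ((Y j \<tau> - Y j t - (\<tau> - t) *\<^sub>R Y (Suc j) t) + (\<tau> - t) *\<^sub>R Y (Suc j) t)
          \<le> L2.nrm \<mu> (Y j \<tau> - Y j t - (\<tau> - t) *\<^sub>R Y (Suc j) t) + L2.nrm \<mu> ((\<tau> - t) *\<^sub>R Y (Suc j) t)"
        by (intro L2.nrm_triangle L2.S_diff L2.S_scale S)
      then show "norm (L2.nrm \<mu> (Y j \<tau> - Y j t)) \<le> B * (\<tau> - t)\<^sup>2 + \<bar>\<tau> - t\<bar> * L2.nrm \<mu> (Y (Suc j) t)"
        using B[OF \<tau>] S by (simp add: L2.nrm_scale L2.S_diff)
    qed
    have "((\<lambda>\<tau>. B * (\<tau> - t)\<^sup>2 + \<bar>\<tau> - t\<bar> * L2.nrm \<mu> (Y (Suc j) t)) \<longlongrightarrow> B * (t - t)\<^sup>2 + \<bar>t - t\<bar> * L2.nrm \<mu> (Y (Suc j) t)) (nhds t)"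
      by (intro tendsto_intros filterlim_ident)
    then show "((\<lambda>\<tau>. B * (\<tau> - t)\<^sup>2 + \<bar>\<tau> - t\<bar> * L2.nrm \<mu> (Y (Suc j) t)) \<longlongrightarrow> 0) (nhds t)" by simp
  qed
qed

text \<open>\<open>local_bound\<close> at the single point \<open>x\<close> turns the quadratic
  remainder of \<open>Y\<close> in norm into a quadratic remainder of the values.\<close>

lemma v_time_deriv:
  assumes t: "0 < t" and x: "x \<in> I"
  shows "((\<lambda>\<tau>. v j \<tau> x) has_real_derivative v (Suc j) t x) (at t)"
proof -
  obtain B where B: "\<And>\<tau>. \<bar>\<tau> - t\<bar> < t / 2 \<Longrightarrow> L2.nrm \<mu> (Y j \<tau> - Y j t - (\<tau> - t) *\<^sub>R Y (Suc j) t) \<le> B * (\<tau> - t)\<^sup>2"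
    using Y_diff[OF t] by blast
  obtain c d where cd: "c < x" "x < d" "{c..d} \<subseteq> I" using open_Icc_nhd[OF open_I x] .
  then obtain C where C: "0 \<le> C" "\<And>g. g \<in> L2 \<mu> \<Longrightarrow> \<bar>R g x\<bar> \<le> C * L2.nrm \<mu> g"
    using local_bound[of c d] by fastforce
  show ?thesis
  proof (rule DERIV_from_quadratic_bound[of "t / 2"])
    fix \<tau> assume \<tau>: "\<bar>\<tau> - t\<bar> < t / 2"
    then have "0 < \<tau>" using t by linarith
    then have S: "Y j \<tau> \<in> L2 \<mu>" "Y j t \<in> L2 \<mu>" "Y (Suc j) t \<in> L2 \<mu>" using t by (auto intro: Y_L2)
    have "v j \<tau> x - v j t x - (\<tau> - t) * v (Suc j) t x = R (Y j \<tau> - Y j t - (\<tau> - t) *\<^sub>R Y (Suc j) t) x"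
      using S by (simp add: v_def R.R_diff R.R_scale L2.S_diff L2.S_scale)
    also have "\<bar>\<dots>\<bar> \<le> C * (B * (\<tau> - t)\<^sup>2)"
      using order_trans[OF C(2) mult_left_mono[OF B[OF \<tau>] C(1)]] S by (simp add: L2.S_diff L2.S_scale)
    finally show "\<bar>v j \<tau> x - v j t x - (\<tau> - t) * v (Suc j) t x\<bar> \<le> C * B * (\<tau> - t)\<^sup>2" by simp
  qed (use t in simp)
qed

lemma v_space_deriv: "0 < t \<Longrightarrow> x \<in> I \<Longrightarrow> (v j t has_real_derivative \<rho> x * flux (v j t) x) (at x)"
  unfolding v_def by (intro R_weak(3) Y_L2)

lemma v_L2: "0 < t \<Longrightarrow> v j t \<in> L2 \<mu>" and v_vanish: "0 < t \<Longrightarrow> vanish (v j t)"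
  unfolding v_def by (intro R_L2 R_vanish Y_L2; simp)+

lemma v_joint: "jointly_continuous I (v j)" and flux_joint: "jointly_continuous I (\<lambda>t. flux (v j t))"
proof -
  have *: "\<exists>n. (n \<longlongrightarrow> 0) (nhds t) \<and> (\<forall>\<tau>>0. \<forall>x\<in>{c..d}. \<bar>v j \<tau> x - v j t x\<bar> \<le> n \<tau> \<and> \<bar>flux (v j \<tau>) x - flux (v j t) x\<bar> \<le> n \<tau>)"
    if t: "0 < t" and cd: "c < d" "{c..d} \<subseteq> I" for t c d
  proof -
    obtain C where C: "\<And>g x. g \<in> L2 \<mu> \<Longrightarrow> x \<in> {c..d} \<Longrightarrow> \<bar>R g x\<bar> \<le> C * L2.nrm \<mu> g \<and> \<bar>flux (R g) x\<bar> \<le> C * L2.nrm \<mu> g"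
      using local_bound[OF cd] by blast
    have "\<bar>v j \<tau> x - v j t x\<bar> \<le> C * L2.nrm \<mu> (Y j \<tau> - Y j t) \<and> \<bar>flux (v j \<tau>) x - flux (v j t) x\<bar> \<le> C * L2.nrm \<mu> (Y j \<tau> - Y j t)"
      if \<tau>: "0 < \<tau>" and x: "x \<in> {c..d}" for \<tau> x
    proof -
      have S: "Y j \<tau> \<in> L2 \<mu>" "Y j t \<in> L2 \<mu>" using t \<tau> by (auto intro: Y_L2)
      have xI: "x \<in> I" using x cd by auto
      show ?thesis
        using C[OF L2.S_diff[OF S] x] flux_diff[OF S xI] R.R_diff[OF S] by (simp add: v_def fun_diff_def)
    qed
    moreover have "((\<lambda>\<tau>. C * L2.nrm \<mu> (Y j \<tau> - Y j t)) \<longlongrightarrow> 0) (nhds t)"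
      by (rule tendsto_mult_right_zero[OF Y_continuous[OF t]])
    ultimately show ?thesis by blast
  qed
  show "jointly_continuous I (v j)"
  proof (rule jointly_continuousI[OF open_I])
    show "continuous_on I (v j t)" if "0 < t" for t
      unfolding v_def using primitive_on_continuous[OF Dom_D(3)[OF R_Dom[OF Y_L2[OF that]]] open_I] by simp
    fix t c d :: real assume "0 < t" "c < d" "{c..d} \<subseteq> I"
    from *[OF this] obtain n where "(n \<longlongrightarrow> 0) (nhds t)"
      "\<forall>\<tau>>0. \<forall>x\<in>{c..d}. \<bar>v j \<tau> x - v j t x\<bar> \<le> n \<tau> \<and> \<bar>flux (v j \<tau>) x - flux (v j t) x\<bar> \<le> n \<tau>" by (elim exE conjE)
    then show "\<exists>n. (n \<longlongrightarrow> 0) (nhds t) \<and> (\<forall>\<tau>>0. \<forall>x\<in>{c..d}. \<bar>v j \<tau> x - v j t x\<bar> \<le> n \<tau>)"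
      by (intro exI[of _ n]) simp
  qed
  show "jointly_continuous I (\<lambda>t. flux (v j t))"
  proof (rule jointly_continuousI[OF open_I])
    show "continuous_on I (flux (v j t))" if "0 < t" for t
      unfolding v_def by (rule primitive_on_continuous[OF R_weak(2)[OF Y_L2[OF that]] open_I])
    fix t c d :: real assume "0 < t" "c < d" "{c..d} \<subseteq> I"
    from *[OF this] obtain n where "(n \<longlongrightarrow> 0) (nhds t)"
      "\<forall>\<tau>>0. \<forall>x\<in>{c..d}. \<bar>v j \<tau> x - v j t x\<bar> \<le> n \<tau> \<and> \<bar>flux (v j \<tau>) x - flux (v j t) x\<bar> \<le> n \<tau>" by (elim exE conjE)
    then show "\<exists>n. (n \<longlongrightarrow> 0) (nhds t) \<and> (\<forall>\<tau>>0. \<forall>x\<in>{c..d}. \<bar>flux (v j \<tau>) x - flux (v j t) x\<bar> \<le> n \<tau>)"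
      by (intro exI[of _ n]) simp
  qed
qed

text \<open>This is \<open>(L - A) v = L v - v' - h\<close>. The source is constant in time and
  drops out after one time derivative. Equality is almost everywhere because \<open>fc\<close> is
  fixed only up to norm zero.\<close>

lemma Y_identity:
  assumes t: "0 < t"
  shows "AE x in lborel. x \<in> I \<longrightarrow> Y j t x = L * v j t x - v (Suc j) t x - (if j = 0 then h x else 0)"
proof -
  let ?E = "\<lambda>j. R.fc (resolvent_exp L j t) g" and ?N = "\<lambda>j. R.fc (resolvent_int_family L j t) h"
  define c where "c = (if j = 0 then -1 else 0 :: real)"
  have cE: "continuous_on {0..1} (resolvent_exp L j t)" for j by (rule resolvent_exp_continuous[OF L t])
  have cN: "continuous_on {0..1} (resolvent_int_family L j t)" for j
    using smooth_resolvent_int[OF L] t by (simp add: smooth_family_def)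
  have S: "?E j \<in> L2 \<mu>" "?N j \<in> L2 \<mu>" for j by (intro R.fc_in cE cN g_L2 h_L2)+
  define A where "A = L *\<^sub>R R (?E j) - R (?E (Suc j)) - ?E j - 0 *\<^sub>R g"
  define B where "B = L *\<^sub>R R (?N j) - R (?N (Suc j)) - ?N j - c *\<^sub>R h"
  have mem: "A \<in> L2 \<mu>" "B \<in> L2 \<mu>" unfolding A_def B_def using S g_L2 h_L2 by (auto intro!: L2.S_diff L2.S_scale R_L2)
  have A0: "L2.nrm \<mu> A = 0" unfolding A_def
  proof (rule R.fc_resolvent_identity[OF cE cE g_L2])
    show "L * r * resolvent_exp L j t r - r * resolvent_exp L (Suc j) t r - resolvent_exp L j t r = 0" for r
      using resolvent_exp_identity[OF L, of r j t] by (simp add: algebra_simps)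
  qed
  have B0: "L2.nrm \<mu> B = 0" unfolding B_def
  proof (rule R.fc_resolvent_identity[OF cN cN h_L2])
    show "L * r * resolvent_int_family L j t r - r * resolvent_int_family L (Suc j) t r - resolvent_int_family L j t r = c"
      if "r \<in> {0..1}" for r
      \<comment> \<open>For positive \<open>j\<close> the family is the exponential of index
        \<open>j - 1\<close>; for \<open>j = 0\<close> the identity of the integral supplies
        \<open>c = -1\<close>.\<close>
      using resolvent_exp_identity[OF L, of r "j - 1" t] resolvent_int_identity[OF L, of r t] that
      by (cases j) (auto simp: resolvent_int_family_def c_def algebra_simps)
  qed
  have eq: "Y j t x = L * v j t x - v (Suc j) t x - (if j = 0 then h x else 0) - (A x - B x)" for x
  proof -
    have "v i t = R (?E i) - R (?N i)" for i unfolding v_def Y_def by (rule R.R_diff[OF S])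
    then show ?thesis by (simp add: Y_def A_def B_def c_def fun_diff_def algebra_simps)
  qed
  have "AE x in \<mu>. A x = 0" "AE x in \<mu>. B x = 0"
    using A0 B0 mem by (auto simp: L2_nrm_eq_0_iff L2_def)
  then have "AE x in lborel. x \<in> I \<longrightarrow> A x = 0" "AE x in lborel. x \<in> I \<longrightarrow> B x = 0"
    by (simp_all add: \<mu>.AE_weighted)
  then show ?thesis by eventually_elim (simp add: eq)
qed

text \<open>The equation in integrated form. Replacing \<open>Y\<close> by \<open>v\<close> and its
  time derivative removes the last function known only almost everywhere, so that the density is
  continuous as soon as the coefficients are.\<close>

lemma flux_primitive:
  assumes t: "0 < t"
  shows "primitive_on I (flux (v j t)) (\<lambda>x. m x * ((k x - L) * v j t x + v (Suc j) t x + (if j = 0 then h x else 0)))"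
proof (rule primitive_on_cong)
  show "primitive_on I (flux (v j t)) (\<lambda>x. m x * (k x * v j t x - Y j t x))"
    unfolding v_def by (rule R_weak(2)[OF Y_L2[OF t]])
  show "AE x in lborel. x \<in> I \<longrightarrow> m x * (k x * v j t x - Y j t x)
      = m x * ((k x - L) * v j t x + v (Suc j) t x + (if j = 0 then h x else 0))"
    using Y_identity[OF t, of j]
  proof eventually_elim
    fix x assume *: "x \<in> I \<longrightarrow> Y j t x = L * v j t x - v (Suc j) t x - (if j = 0 then h x else 0)"
    show "x \<in> I \<longrightarrow> m x * (k x * v j t x - Y j t x)
        = m x * ((k x - L) * v j t x + v (Suc j) t x + (if j = 0 then h x else 0))"
    proof
      assume "x \<in> I"
      then have Y: "Y j t x = L * v j t x - v (Suc j) t x - (if j = 0 then h x else 0)" using * by blast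
      show "m x * (k x * v j t x - Y j t x) = m x * ((k x - L) * v j t x + v (Suc j) t x + (if j = 0 then h x else 0))"
        unfolding Y by (simp only: left_diff_distrib diff_diff_eq2 diff_add_eq add_diff_eq) (simp add: algebra_simps)
    qed
  qed
  have "(\<lambda>x. m x * ((k x - L) * v j t x + v (Suc j) t x + (if j = 0 then h x else 0))) \<in> borel_measurable (restrict_space borel I)"
    using \<mu>.w_meas k_meas v_L2[OF t, of j] v_L2[OF t, of "Suc j"] h_L2
    by (auto simp: L2_def square_integrable_def)
  then show "set_borel_measurable borel I (\<lambda>x. m x * ((k x - L) * v j t x + v (Suc j) t x + (if j = 0 then h x else 0)))"
    by (simp add: set_borel_measurable_def borel_measurable_restrict_space_iff)
qed auto

lemma v_initial: "((\<lambda>t. L2.nrm \<mu> (v 0 t - g)) \<longlongrightarrow> 0) (at_right 0)"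
  unfolding v_def Y_def resolvent_int_family_def
  using R.fc_initial_limit[OF R_inj L g_L2 h_L2] by simp

end

section \<open>The parabolic equation\<close>

text \<open>Products, exponentials and congruence of absolutely continuous functions all reduce to
  domination of increments by those of two given functions.\<close>

lemma abs_continuous_on_dominated:
  assumes f: "abs_continuous_on c d f" and g: "abs_continuous_on c d g" and M: "0 \<le> M"
    and le: "\<And>y z. c \<le> y \<Longrightarrow> y \<le> z \<Longrightarrow> z \<le> d \<Longrightarrow> \<bar>h z - h y\<bar> \<le> M * (\<bar>f z - f y\<bar> + \<bar>g z - g y\<bar>)"
  shows "abs_continuous_on c d h"
  unfolding abs_continuous_on_def
proof (intro allI impI)
  fix e :: real assume e: "e > 0"
  define e' where "e' = e / (2 * (M + 1))"
  have e': "e' > 0" using e M by (simp add: e'_def)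
  obtain \<delta>1 where \<delta>1: "\<delta>1 > 0" "\<forall>(n::nat) y z. (\<forall>i<n. c \<le> y i \<and> y i \<le> z i \<and> z i \<le> d) \<and>
      disjoint_family_on (\<lambda>i. {y i<..<z i}) {..<n} \<and> (\<Sum>i<n. z i - y i) < \<delta>1 \<longrightarrow> (\<Sum>i<n. \<bar>f (z i) - f (y i)\<bar>) < e'"
    using f[unfolded abs_continuous_on_def, rule_format, OF e'] by (elim exE conjE)
  obtain \<delta>2 where \<delta>2: "\<delta>2 > 0" "\<forall>(n::nat) y z. (\<forall>i<n. c \<le> y i \<and> y i \<le> z i \<and> z i \<le> d) \<and>
      disjoint_family_on (\<lambda>i. {y i<..<z i}) {..<n} \<and> (\<Sum>i<n. z i - y i) < \<delta>2 \<longrightarrow> (\<Sum>i<n. \<bar>g (z i) - g (y i)\<bar>) < e'"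
    using g[unfolded abs_continuous_on_def, rule_format, OF e'] by (elim exE conjE)
  show "\<exists>\<delta>>0. \<forall>(n::nat) y z. (\<forall>i<n. c \<le> y i \<and> y i \<le> z i \<and> z i \<le> d) \<and>
      disjoint_family_on (\<lambda>i. {y i<..<z i}) {..<n} \<and> (\<Sum>i<n. z i - y i) < \<delta> \<longrightarrow> (\<Sum>i<n. \<bar>h (z i) - h (y i)\<bar>) < e"
  proof (intro exI[of _ "min \<delta>1 \<delta>2"] conjI allI impI)
    fix n :: nat and y z :: "nat \<Rightarrow> real"
    assume A: "(\<forall>i<n. c \<le> y i \<and> y i \<le> z i \<and> z i \<le> d) \<and>
      disjoint_family_on (\<lambda>i. {y i<..<z i}) {..<n} \<and> (\<Sum>i<n. z i - y i) < min \<delta>1 \<delta>2"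
    have "(\<Sum>i<n. \<bar>h (z i) - h (y i)\<bar>) \<le> (\<Sum>i<n. M * (\<bar>f (z i) - f (y i)\<bar> + \<bar>g (z i) - g (y i)\<bar>))"
      using A by (intro sum_mono le) auto
    also have "\<dots> = M * ((\<Sum>i<n. \<bar>f (z i) - f (y i)\<bar>) + (\<Sum>i<n. \<bar>g (z i) - g (y i)\<bar>))"
      unfolding sum.distrib[symmetric] sum_distrib_left ..
    also have "\<dots> \<le> M * (e' + e')"
      using A \<delta>1(2)[rule_format, of n y z] \<delta>2(2)[rule_format, of n y z] M by (intro mult_left_mono add_mono) auto
    also have "\<dots> < (M + 1) * (e' + e')" using e' by (intro mult_strict_right_mono) auto
    also have "\<dots> = (2 * (M + 1)) * e'" by (simp add: algebra_simps)
    also have "\<dots> = e"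
    proof -
      have pos: "0 < 2 * (M + 1)" using M by simp
      show ?thesis
        unfolding e'_def by (simp only: times_divide_eq_right nonzero_mult_div_cancel_left[OF less_imp_neq[OF pos, symmetric]])
    qed
    finally show "(\<Sum>i<n. \<bar>h (z i) - h (y i)\<bar>) < e" .
  qed (use \<delta>1 \<delta>2 in auto)
qed

lemma AC_loc_on_mult:
  assumes f: "AC_loc_on I f" "continuous_on I f" and g: "AC_loc_on I g" "continuous_on I g"
  shows "AC_loc_on I (\<lambda>x. f x * g x)"
  unfolding AC_loc_on_def
proof (intro allI impI; elim conjE)
  fix c d :: real assume cd: "c \<le> d" "{c..d} \<subseteq> I"
  obtain B1 where B1: "\<And>x. x \<in> {c..d} \<Longrightarrow> \<bar>f x\<bar> \<le> B1" using bounded_on_Icc[OF f(2) cd(2)] by blast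
  obtain B2 where B2: "\<And>x. x \<in> {c..d} \<Longrightarrow> \<bar>g x\<bar> \<le> B2" using bounded_on_Icc[OF g(2) cd(2)] by blast
  define M where "M = max B1 B2"
  have M: "0 \<le> M" using B1[of c] cd by (auto simp: M_def)
  show "abs_continuous_on c d (\<lambda>x. f x * g x)"
  proof (rule abs_continuous_on_dominated[OF _ _ M])
    show "abs_continuous_on c d f" "abs_continuous_on c d g" using f g cd by (simp_all add: AC_loc_on_def)
    fix y z assume yz: "c \<le> y" "y \<le> z" "z \<le> d"
    have "f z * g z - f y * g y = (f z - f y) * g z + f y * (g z - g y)" by (simp add: algebra_simps)
    also have "\<bar>\<dots>\<bar> \<le> \<bar>f z - f y\<bar> * \<bar>g z\<bar> + \<bar>f y\<bar> * \<bar>g z - g y\<bar>"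
      unfolding abs_mult[symmetric] by (rule abs_triangle_ineq)
    also have "\<dots> \<le> \<bar>f z - f y\<bar> * M + M * \<bar>g z - g y\<bar>"
      using B1[of y] B2[of z] yz by (intro add_mono mult_mono) (auto simp: M_def)
    finally show "\<bar>f z * g z - f y * g y\<bar> \<le> M * (\<bar>f z - f y\<bar> + \<bar>g z - g y\<bar>)" by (simp add: algebra_simps)
  qed
qed

lemma AC_loc_on_exp_uminus:
  assumes f: "AC_loc_on I f" "continuous_on I f"
  shows "AC_loc_on I (\<lambda>x. exp (- f x))"
  unfolding AC_loc_on_def
proof (intro allI impI; elim conjE)
  fix c d :: real assume cd: "c \<le> d" "{c..d} \<subseteq> I"
  obtain B where B: "\<And>x. x \<in> {c..d} \<Longrightarrow> \<bar>f x\<bar> \<le> B" using bounded_on_Icc[OF f(2) cd(2)] by blast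
  show "abs_continuous_on c d (\<lambda>x. exp (- f x))"
  proof (rule abs_continuous_on_dominated)
    show "abs_continuous_on c d f" "abs_continuous_on c d f" using f cd by (simp_all add: AC_loc_on_def)
    \<comment> \<open>One-sided estimate from \<open>1 + x \<le> exp x\<close>; exchanging the
      arguments gives the other sign.\<close>
    have up: "exp (- p) - exp (- q) \<le> exp B * \<bar>p - q\<bar>" if "\<bar>p\<bar> \<le> B" for p q :: real
    proof -
      have "exp (- q) = exp (- p) * exp (p - q)" by (simp flip: exp_add)
      also have "\<dots> \<ge> exp (- p) * (1 + (p - q))" by (intro mult_left_mono) (auto simp: exp_ge_add_one_self)
      finally have "exp (- p) - exp (- q) \<le> exp (- p) * (q - p)" by (simp add: algebra_simps)
      also have "\<dots> \<le> exp (- p) * \<bar>p - q\<bar>" by (intro mult_left_mono) auto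
      also have "\<dots> \<le> exp B * \<bar>p - q\<bar>" using that by (intro mult_right_mono) auto
      finally show ?thesis .
    qed
    fix y z assume yz: "c \<le> y" "y \<le> z" "z \<le> d"
    have "\<bar>exp (- f z) - exp (- f y)\<bar> \<le> exp B * \<bar>f z - f y\<bar>"
      using up[of "f z" "f y"] up[of "f y" "f z"] B[of y] B[of z] yz by (auto simp: abs_le_iff abs_minus_commute)
    then show "\<bar>exp (- f z) - exp (- f y)\<bar> \<le> exp B * (\<bar>f z - f y\<bar> + \<bar>f z - f y\<bar>)"
      by (simp add: distrib_left add_increasing2)
  qed simp
qed

lemma AC_loc_on_cong:
  assumes f: "AC_loc_on I f" and fg: "\<And>x. x \<in> I \<Longrightarrow> f x = g x"
  shows "AC_loc_on I g"
  unfolding AC_loc_on_def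
proof (intro allI impI; elim conjE)
  fix c d :: real assume cd: "c \<le> d" "{c..d} \<subseteq> I"
  have f': "abs_continuous_on c d f" using f cd by (simp add: AC_loc_on_def)
  show "abs_continuous_on c d g"
  proof (rule abs_continuous_on_dominated[OF f' f'])
    fix y z assume "c \<le> y" "y \<le> z" "z \<le> d"
    then have "y \<in> I" "z \<in> I" using cd(2) by auto
    then show "\<bar>g z - g y\<bar> \<le> 1 * (\<bar>f z - f y\<bar> + \<bar>f z - f y\<bar>)" using fg by simp
  qed simp
qed

lemma jointly_continuous_cong:
  assumes "jointly_continuous I f" "\<And>t x. 0 < t \<Longrightarrow> x \<in> I \<Longrightarrow> f t x = g t x"
  shows "jointly_continuous I g"
  using assms(1) unfolding jointly_continuous_def
  by (rule continuous_on_eq) (auto simp: assms(2))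

lemma jointly_continuous_space: "continuous_on I f \<Longrightarrow> jointly_continuous I (\<lambda>t x. f x)"
  unfolding jointly_continuous_def case_prod_beta'
  by (rule continuous_on_compose2[OF _ continuous_on_snd[OF continuous_on_id]]) auto

lemma
  assumes "jointly_continuous I f" "jointly_continuous I g"
  shows jointly_continuous_add: "jointly_continuous I (\<lambda>t x. f t x + g t x)"
    and jointly_continuous_mult: "jointly_continuous I (\<lambda>t x. f t x * g t x)"
  using assms unfolding jointly_continuous_def case_prod_beta' by (auto intro: continuous_intros)

text \<open>That \<open>\<xi>\<close> solves \<open>a \<xi>'' + b \<xi>' = 0\<close> is encoded as
  affinity in the scale, which treats all cases of its definition alike. The shift \<open>L\<close>
  enters \<open>k\<close> and cancels against the \<open>L\<close> of the resolvent.\<close>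

locale diffusion = sl_evolution I m \<rho> s k K L g h for I m \<rho> s k K L g h +
  fixes a b q \<xi> \<phi> :: "real \<Rightarrow> real" and c0 c1 :: real
  assumes a_pos: "\<And>x. x \<in> I \<Longrightarrow> 0 < a x"
    and \<rho>_eq: "\<And>x. x \<in> I \<Longrightarrow> \<rho> x = exp (- \<phi> x)" and \<phi>_prim: "primitive_on I \<phi> (\<lambda>x. b x / a x)"
    and m_eq: "\<And>x. x \<in> I \<Longrightarrow> m x = 1 / (a x * \<rho> x)"
    and k_eq: "\<And>x. x \<in> I \<Longrightarrow> k x = q x + L"
    and h_eq: "\<And>x. x \<in> I \<Longrightarrow> h x = q x * \<xi> x"
    and \<xi>_eq: "\<And>x. x \<in> I \<Longrightarrow> \<xi> x = c0 + c1 * s x"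
begin

definition u :: "real \<Rightarrow> real \<Rightarrow> real" where "u t x = \<xi> x + v 0 t x"

text \<open>The flux of \<open>\<xi>\<close>, which is constant in space and disappears after a time
  derivative.\<close>

definition C :: "nat \<Rightarrow> real" where "C j = (if j = 0 then c1 else 0)"

abbreviation U :: "nat \<Rightarrow> real \<Rightarrow> real \<Rightarrow> real" where "U j \<equiv> (dt ^^ j) u"

text \<open>A derivative at \<open>t\<close> sees the values at neighbouring times, so the induction
  keeps \<open>t\<close> arbitrary and exchanges functions on the open half-line.\<close>

lemma U_eq: "0 < t \<Longrightarrow> x \<in> I \<Longrightarrow> U j t x = (if j = 0 then \<xi> x else 0) + v j t x"
proof (induction j arbitrary: t)
  case (Suc j)
  have "((\<lambda>\<tau>. (if j = 0 then \<xi> x else 0) + v j \<tau> x) has_real_derivative 0 + v (Suc j) t x) (at t)"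
    by (intro DERIV_add DERIV_const v_time_deriv Suc.prems)
  then have "((\<lambda>\<tau>. U j \<tau> x) has_real_derivative v (Suc j) t x) (at t)"
    using has_field_derivative_transform_within_open[of _ _ t "{0<..}" "\<lambda>\<tau>. U j \<tau> x"] Suc by simp
  moreover have "U (Suc j) t x = deriv (\<lambda>\<tau>. U j \<tau> x) t" by (simp add: dt_def[of "U j"])
  ultimately show ?case by (simp add: DERIV_imp_deriv)
qed (simp add: u_def)

lemma U_time_deriv:
  assumes t: "0 < t" and x: "x \<in> I"
  shows "((\<lambda>\<tau>. U j \<tau> x) has_real_derivative U (Suc j) t x) (at t)"
proof -
  have "((\<lambda>\<tau>. (if j = 0 then \<xi> x else 0) + v j \<tau> x) has_real_derivative 0 + v (Suc j) t x) (at t)"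
    by (intro DERIV_add DERIV_const v_time_deriv t x)
  then have "((\<lambda>\<tau>. U j \<tau> x) has_real_derivative v (Suc j) t x) (at t)"
    using has_field_derivative_transform_within_open[of _ _ t "{0<..}" "\<lambda>\<tau>. U j \<tau> x"] U_eq t x by simp
  then show ?thesis using U_eq[OF t x, of "Suc j"] by simp
qed

definition G :: "nat \<Rightarrow> real \<Rightarrow> real \<Rightarrow> real" where "G j t x = \<rho> x * (C j + flux (v j t) x)"

lemma s_deriv: "x \<in> I \<Longrightarrow> (s has_real_derivative \<rho> x) (at x)"
  by (rule primitive_on_DERIV[OF s_prim open_I \<rho>_cont])

lemma U_space_deriv:
  assumes t: "0 < t" and x: "x \<in> I"
  shows "(U j t has_real_derivative G j t x) (at x)"
proof -
  have "((\<lambda>x. (if j = 0 then c0 + c1 * s x else 0) + v j t x) has_real_derivative (if j = 0 then c1 * \<rho> x else 0) + \<rho> x * flux (v j t) x) (at x)"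
    using s_deriv[OF x] v_space_deriv[OF t x, of j] by (cases "j = 0") (auto intro!: derivative_eq_intros)
  then have "(U j t has_real_derivative (if j = 0 then c1 * \<rho> x else 0) + \<rho> x * flux (v j t) x) (at x)"
    by (rule has_field_derivative_transform_within_open[OF _ open_I x]) (simp add: U_eq[OF t] \<xi>_eq)
  then show ?thesis by (simp add: G_def C_def algebra_simps split: if_splits)
qed

lemma dx_U: "0 < t \<Longrightarrow> x \<in> I \<Longrightarrow> dx (U j) t x = G j t x"
  using U_space_deriv by (simp add: dx_def DERIV_imp_deriv)

lemma dt_U: "dt (U j) = U (Suc j)" by simp

lemma dt_exists_U: "dt_exists I (U j)"
  unfolding dt_exists_def field_differentiable_def using U_time_deriv by blast

lemma dx_exists_U: "dx_exists I (U j)"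
  unfolding dx_exists_def field_differentiable_def using U_space_deriv by blast

lemma s_cont: "continuous_on I s"
  by (rule primitive_on_continuous[OF s_prim open_I])

lemma \<xi>_cont: "continuous_on I \<xi>"
proof -
  have "continuous_on I (\<lambda>x. c0 + c1 * s x)" by (intro continuous_intros s_cont)
  then show ?thesis by (rule continuous_on_eq) (simp add: \<xi>_eq)
qed

lemma U_joint: "jointly_continuous I (U j)"
proof -
  have "continuous_on I (\<lambda>x. if j = 0 then \<xi> x else 0)" using \<xi>_cont by (cases "j = 0") auto
  from jointly_continuous_add[OF jointly_continuous_space[OF this] v_joint[of j]]
  show ?thesis by (rule jointly_continuous_cong) (simp add: U_eq)
qed

lemma G_joint: "jointly_continuous I (G j)"
  unfolding G_def
  by (intro jointly_continuous_mult jointly_continuous_add jointly_continuous_space \<rho>_cont continuous_on_const flux_joint)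

lemma dx_U_joint: "jointly_continuous I (dx (U j))"
  using G_joint by (rule jointly_continuous_cong) (simp add: dx_U)

lemma \<phi>_cont: "continuous_on I \<phi>"
  by (rule primitive_on_continuous[OF \<phi>_prim open_I])

lemma flux_cont: "0 < t \<Longrightarrow> continuous_on I (flux (v j t))"
  by (rule primitive_on_continuous[OF flux_primitive open_I])

text \<open>A product of \<open>\<rho>\<close>, the exponential of a primitive, with a flux that is
  a primitive as well.\<close>

lemma G_AC:
  assumes t: "0 < t" shows "AC_loc_on I (G j t)"
proof -
  have 1: "AC_loc_on I \<rho>"
    using AC_loc_on_exp_uminus[OF primitive_on_AC[OF \<phi>_prim] \<phi>_cont] by (rule AC_loc_on_cong) (simp add: \<rho>_eq)
  have "primitive_on I (\<lambda>x. C j + flux (v j t) x) (\<lambda>x. m x * ((k x - L) * v j t x + v (Suc j) t x + (if j = 0 then h x else 0)))"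
    using flux_primitive[OF t, of j] by (simp add: primitive_on_def)
  then have 2: "AC_loc_on I (\<lambda>x. C j + flux (v j t) x)" by (rule primitive_on_AC)
  show ?thesis
    unfolding G_def by (intro AC_loc_on_mult 1 2 \<rho>_cont continuous_intros flux_cont t)
qed

text \<open>The second space derivative that the equation prescribes.\<close>

definition H :: "nat \<Rightarrow> real \<Rightarrow> real \<Rightarrow> real" where
  "H j t x = - (b x / a x) * G j t x + (q x * v j t x + v (Suc j) t x + (if j = 0 then q x * \<xi> x else 0)) / a x"

text \<open>Differentiability of \<open>\<phi>\<close> and of the flux at the point is assumed, so
  the same computation serves almost every point in general and every point for continuous
  coefficients.\<close>

lemma G_space_deriv:
  assumes t: "0 < t" and x: "x \<in> I" and \<phi>: "(\<phi> has_real_derivative b x / a x) (at x)"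
    and fl: "(flux (v j t) has_real_derivative m x * ((k x - L) * v j t x + v (Suc j) t x + (if j = 0 then h x else 0))) (at x)"
  shows "(dx (U j) t has_real_derivative H j t x) (at x)"
proof -
  have "((\<lambda>x. exp (- \<phi> x)) has_real_derivative exp (- \<phi> x) * - (b x / a x)) (at x)"
    by (auto intro!: derivative_eq_intros \<phi>)
  then have "(\<rho> has_real_derivative exp (- \<phi> x) * - (b x / a x)) (at x)"
    by (rule has_field_derivative_transform_within_open[OF _ open_I x]) (simp add: \<rho>_eq)
  then have r: "(\<rho> has_real_derivative - (b x / a x) * \<rho> x) (at x)" using \<rho>_eq[OF x] by (simp add: mult.commute)
  let ?F = "(k x - L) * v j t x + v (Suc j) t x + (if j = 0 then h x else 0)"
  have "((\<lambda>x. \<rho> x * (C j + flux (v j t) x)) has_real_derivative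
      - (b x / a x) * \<rho> x * (C j + flux (v j t) x) + (0 + m x * ?F) * \<rho> x) (at x)"
    by (intro DERIV_mult DERIV_add DERIV_const r fl)
  moreover have "- (b x / a x) * \<rho> x * (C j + flux (v j t) x) + (0 + m x * ?F) * \<rho> x = H j t x"
  proof -
    have "m x * \<rho> x = 1 / a x" using m_eq[OF x] \<nu>.w_pos[OF x] by simp
    then have "(0 + m x * ?F) * \<rho> x = ?F / a x" by (simp add: mult.commute mult.left_commute) (simp add: mult.assoc[symmetric] mult.commute)
    then show ?thesis using k_eq[OF x] h_eq[OF x] by (simp add: H_def G_def)
  qed
  ultimately have "(G j t has_real_derivative H j t x) (at x)" unfolding G_def by simp
  then show ?thesis
    by (rule has_field_derivative_transform_within_open[OF _ open_I x]) (simp add: dx_U[OF t])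
qed

lemma pde_of_deriv:
  assumes t: "0 < t" and x: "x \<in> I" and d: "(dx (U j) t has_real_derivative H j t x) (at x)"
  shows "dx (U j) t field_differentiable (at x) \<and> pde_at a b q (U j) t x"
proof
  show "dx (U j) t field_differentiable (at x)" using d by (auto simp: field_differentiable_def)
  have "dx (dx (U j)) t x = H j t x" using d by (simp add: dx_def[of "dx (U j)"] DERIV_imp_deriv)
  moreover have "a x * H j t x = - b x * G j t x + (q x * v j t x + v (Suc j) t x + (if j = 0 then q x * \<xi> x else 0))"
    using a_pos[OF x] by (simp add: H_def field_simps)
  ultimately show "pde_at a b q (U j) t x"
    unfolding pde_at_def dt_U by (simp add: U_eq[OF t x] dx_U[OF t x] distrib_left del: funpow.simps)
qed

lemma pde_ae_U: "pde_ae I a b q (U j)"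
  unfolding pde_ae_def
proof (intro allI impI conjI)
  fix t :: real assume t: "0 < t"
  show "AC_loc_on I (dx (U j) t)" using G_AC[OF t] by (rule AC_loc_on_cong) (simp add: dx_U[OF t])
  show "AE x in lborel. x \<in> I \<longrightarrow> dx (U j) t field_differentiable (at x) \<and> pde_at a b q (U j) t x"
    using primitive_on_AE_DERIV[OF \<phi>_prim open_I] primitive_on_AE_DERIV[OF flux_primitive[OF t, of j] open_I]
  proof eventually_elim
    fix x
    assume \<phi>: "x \<in> I \<longrightarrow> (\<phi> has_real_derivative b x / a x) (at x)"
      and fl: "x \<in> I \<longrightarrow> (flux (v j t) has_real_derivative
        m x * ((k x - L) * v j t x + v (Suc j) t x + (if j = 0 then h x else 0))) (at x)"
    show "x \<in> I \<longrightarrow> dx (U j) t field_differentiable (at x) \<and> pde_at a b q (U j) t x"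
    proof
      assume x: "x \<in> I"
      show "dx (U j) t field_differentiable (at x) \<and> pde_at a b q (U j) t x"
        by (rule pde_of_deriv[OF t x G_space_deriv[OF t x \<phi>[rule_format, OF x] fl[rule_format, OF x]]])
    qed
  qed
qed

section \<open>Continuous coefficients\<close>

context
  assumes ac: "continuous_on I a" and bc: "continuous_on I b" and qc: "continuous_on I q"
begin

text \<open>The densities of \<open>\<phi>\<close> and of the flux are now continuous on
  \<open>I\<close>, so both primitives are differentiable at every point.\<close>

lemma dx_U_deriv_cont:
  assumes t: "0 < t" and x: "x \<in> I"
  shows "(dx (U j) t has_real_derivative H j t x) (at x)"
proof (rule G_space_deriv[OF t x])
  have a0: "a x \<noteq> 0" if "x \<in> I" for x using a_pos[OF that] by simp
  show "(\<phi> has_real_derivative b x / a x) (at x)"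
    by (rule primitive_on_DERIV[OF \<phi>_prim open_I _ x]) (intro continuous_intros ac bc ballI a0)
  show "(flux (v j t) has_real_derivative m x * ((k x - L) * v j t x + v (Suc j) t x + (if j = 0 then h x else 0))) (at x)"
  proof (rule primitive_on_DERIV[OF flux_primitive[OF t] open_I _ x])
    have vc: "continuous_on I (v i t)" for i
      using v_space_deriv[OF t] by (auto intro!: continuous_at_imp_continuous_on DERIV_isCont)
    have "continuous_on I (\<lambda>x. if j = 0 then q x * \<xi> x else 0)"
      using continuous_on_mult[OF qc \<xi>_cont] by (cases "j = 0") auto
    then have "continuous_on I (\<lambda>x. 1 / (a x * \<rho> x) * (q x * v j t x + v (Suc j) t x + (if j = 0 then q x * \<xi> x else 0)))"
      using a0 \<nu>.w_pos by (intro continuous_intros ac qc vc \<rho>_cont) (auto simp: less_le)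
    then show "continuous_on I (\<lambda>x. m x * ((k x - L) * v j t x + v (Suc j) t x + (if j = 0 then h x else 0)))"
      by (rule continuous_on_eq) (simp add: m_eq k_eq h_eq)
  qed
qed

lemma C12_U: "C12 I (U j)"
proof -
  have a0: "a x \<noteq> 0" if "x \<in> I" for x using a_pos[OF that] by simp
  have H: "jointly_continuous I (H j)"
  proof -
    have 1: "continuous_on I (\<lambda>x. - (b x / a x))" "continuous_on I (\<lambda>x. 1 / a x)"
      using a0 by (auto intro!: continuous_on_minus continuous_on_divide ac bc continuous_on_const)
    have 2: "continuous_on I (\<lambda>x. if j = 0 then q x * \<xi> x else 0)"
      using continuous_on_mult[OF qc \<xi>_cont] by (cases "j = 0") auto
    have "jointly_continuous I (\<lambda>t x. - (b x / a x) * G j t x + (q x * v j t x + v (Suc j) t x + (if j = 0 then q x * \<xi> x else 0)) * (1 / a x))"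
      by (intro jointly_continuous_add jointly_continuous_mult G_joint v_joint
          jointly_continuous_space[OF 1(1)] jointly_continuous_space[OF 1(2)] jointly_continuous_space[OF 2] jointly_continuous_space[OF qc])
    then show ?thesis by (simp add: H_def[abs_def])
  qed
  have "dx_exists I (dx (U j))"
    unfolding dx_exists_def field_differentiable_def using dx_U_deriv_cont by blast
  moreover have "jointly_continuous I (dx (dx (U j)))"
    using H
  proof (rule jointly_continuous_cong)
    show "H j t x = dx (dx (U j)) t x" if "0 < t" "x \<in> I" for t x
      using DERIV_imp_deriv[OF dx_U_deriv_cont[OF that, of j]] by (simp add: dx_def[of "dx (U j)"])
  qed
  ultimately show ?thesis
    unfolding C12_def using dt_exists_U dx_exists_U U_joint[of j] U_joint[of "Suc j"] dx_U_joint by simp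
qed

lemma pde_at_U: "0 < t \<Longrightarrow> x \<in> I \<Longrightarrow> pde_at a b q (U j) t x"
  using pde_of_deriv dx_U_deriv_cont by blast

end

end

section \<open>Boundary values\<close>

text \<open>Working with the filter on extended reals covers finite and infinite ends at
  once.\<close>

lemma eventually_at_right_einterval:
  assumes c: "c \<in> einterval l r" and P: "\<And>x. x \<in> einterval l r \<Longrightarrow> x \<le> c \<Longrightarrow> P x"
  shows "\<forall>\<^sub>F y in at_right l. P (real_of_ereal y)"
proof -
  have lc: "l < ereal c" using c by (simp add: einterval_iff)
  show ?thesis
    unfolding eventually_at_right[OF lc]
  proof (intro exI[of _ "ereal c"] conjI lc allI impI)
    fix y assume y: "l < y" "y < ereal c"
    then obtain x where x: "y = ereal x" by (cases y) auto
    have "ereal x < r" using less_trans[of "ereal x" "ereal c" r] y c x by (simp add: einterval_iff)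
    then show "P (real_of_ereal y)" using P[of x] y x by (simp add: einterval_iff)
  qed
qed

lemma eventually_at_left_einterval:
  assumes c: "c \<in> einterval l r" and P: "\<And>x. x \<in> einterval l r \<Longrightarrow> c \<le> x \<Longrightarrow> P x"
  shows "\<forall>\<^sub>F y in at_left r. P (real_of_ereal y)"
proof -
  have cr: "ereal c < r" using c by (simp add: einterval_iff)
  show ?thesis
    unfolding eventually_at_left[OF cr]
  proof (intro exI[of _ "ereal c"] conjI cr allI impI)
    fix y assume y: "ereal c < y" "y < r"
    then obtain x where x: "y = ereal x" by (cases y) auto
    have "l < ereal x" using less_trans[of l "ereal c" "ereal x"] y c x by (simp add: einterval_iff)
    then show "P (real_of_ereal y)" using P[of x] y x by (simp add: einterval_iff)
  qed
qed

lemma at_right_neq_bot: "l < (c::ereal) \<Longrightarrow> at_right l \<noteq> bot"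
  using dense unfolding trivial_limit_def eventually_at_right by blast

lemma at_left_neq_bot: "(c::ereal) < r \<Longrightarrow> at_left r \<noteq> bot"
  using dense unfolding trivial_limit_def eventually_at_left by blast

text \<open>\<open>Lim\<close> names the limit only once convergence is known. Monotonicity provides
  it, with the infimum as value, which connects the end value of the scale with boundedness below of
  its range.\<close>

lemma lim_left_end_mono:
  assumes lr: "l < r" and mono: "\<And>x y. x \<in> einterval l r \<Longrightarrow> y \<in> einterval l r \<Longrightarrow> x \<le> y \<Longrightarrow> g x \<le> g y"
  shows "lim_left_end l g = (INF x\<in>einterval l r. ereal (g x))"
    and "((\<lambda>y. ereal (g (real_of_ereal y))) \<longlongrightarrow> lim_left_end l g) (at_right l)"
proof -
  let ?I = "einterval l r" and ?L = "INF x\<in>einterval l r. ereal (g x)"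
  obtain x0 where x0: "x0 \<in> ?I" using einterval_nonempty[OF lr] by blast
  have lim: "((\<lambda>y. ereal (g (real_of_ereal y))) \<longlongrightarrow> ?L) (at_right l)"
  proof (rule order_tendstoI)
    fix a assume a: "a < ?L"
    have "a < ereal (g x)" if "x \<in> ?I" for x using less_le_trans[OF a INF_lower[OF that]] .
    then show "\<forall>\<^sub>F y in at_right l. a < ereal (g (real_of_ereal y))"
      by (intro eventually_at_right_einterval[OF x0])
  next
    fix a assume "?L < a"
    then obtain c where c: "c \<in> ?I" "ereal (g c) < a" unfolding INF_less_iff by blast
    show "\<forall>\<^sub>F y in at_right l. ereal (g (real_of_ereal y)) < a"
    proof (rule eventually_at_right_einterval[OF c(1)])
      fix x assume "x \<in> ?I" "x \<le> c"
      then have "ereal (g x) \<le> ereal (g c)" using mono c by simp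
      then show "ereal (g x) < a" using c(2) by (rule le_less_trans)
    qed
  qed
  show L: "lim_left_end l g = ?L"
    unfolding lim_left_end_def by (rule tendsto_Lim[OF at_right_neq_bot[OF lr] lim])
  show "((\<lambda>y. ereal (g (real_of_ereal y))) \<longlongrightarrow> lim_left_end l g) (at_right l)"
    unfolding L by (rule lim)
qed

lemma lim_right_end_mono:
  assumes lr: "l < r" and mono: "\<And>x y. x \<in> einterval l r \<Longrightarrow> y \<in> einterval l r \<Longrightarrow> x \<le> y \<Longrightarrow> g x \<le> g y"
  shows "lim_right_end r g = (SUP x\<in>einterval l r. ereal (g x))"
    and "((\<lambda>y. ereal (g (real_of_ereal y))) \<longlongrightarrow> lim_right_end r g) (at_left r)"
proof -
  let ?I = "einterval l r" and ?L = "SUP x\<in>einterval l r. ereal (g x)"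
  obtain x0 where x0: "x0 \<in> ?I" using einterval_nonempty[OF lr] by blast
  have lim: "((\<lambda>y. ereal (g (real_of_ereal y))) \<longlongrightarrow> ?L) (at_left r)"
  proof (rule order_tendstoI)
    fix a assume a: "?L < a"
    have "ereal (g x) < a" if "x \<in> ?I" for x using le_less_trans[OF SUP_upper[OF that] a] .
    then show "\<forall>\<^sub>F y in at_left r. ereal (g (real_of_ereal y)) < a"
      by (intro eventually_at_left_einterval[OF x0])
  next
    fix a assume "a < ?L"
    then obtain c where c: "c \<in> ?I" "a < ereal (g c)" unfolding less_SUP_iff by blast
    show "\<forall>\<^sub>F y in at_left r. a < ereal (g (real_of_ereal y))"
    proof (rule eventually_at_left_einterval[OF c(1)])
      fix x assume "x \<in> ?I" "c \<le> x"
      then have "ereal (g c) \<le> ereal (g x)" using mono c by simp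
      with c(2) show "a < ereal (g x)" by (rule less_le_trans)
    qed
  qed
  show L: "lim_right_end r g = ?L"
    unfolding lim_right_end_def by (rule tendsto_Lim[OF at_left_neq_bot[OF lr] lim])
  show "((\<lambda>y. ereal (g (real_of_ereal y))) \<longlongrightarrow> lim_right_end r g) (at_left r)"
    unfolding L by (rule lim)
qed

lemma L1_loc_on_continuous_mult:
  assumes I: "is_interval I" and f: "L1_loc_on I f" and g: "continuous_on I g"
  shows "L1_loc_on I (\<lambda>x. g x * f x)"
proof (rule L1_loc_onI[OF I])
  fix x y assume xy: "x \<le> y" "{x..y} \<subseteq> I"
  obtain B where B: "\<And>z. z \<in> {x..y} \<Longrightarrow> \<bar>g z\<bar> \<le> B" using bounded_on_Icc[OF g xy(2)] by blast
  have fi: "integrable lborel (\<lambda>z. indicator {x..y} z *\<^sub>R f z)"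
    using L1_loc_on_Icc[OF f xy(2)] by (simp add: set_integrable_def)
  have gm: "(\<lambda>z. indicator {x..y} z *\<^sub>R g z) \<in> borel_measurable lborel"
    using borel_measurable_continuous_on_indicator[of "{x..y}" g] continuous_on_subset[OF g xy(2)] by simp
  show "set_integrable lborel {x..y} (\<lambda>x. g x * f x)"
    unfolding set_integrable_def
  proof (rule Bochner_Integration.integrable_bound)
    show "integrable lborel (\<lambda>z. B * (indicator {x..y} z *\<^sub>R f z))" using fi by (rule integrable_mult_right)
    have "(\<lambda>z. (indicator {x..y} z *\<^sub>R g z) * (indicator {x..y} z *\<^sub>R f z)) \<in> borel_measurable lborel"
      using gm fi by (intro borel_measurable_times) auto
    moreover have "(\<lambda>z. (indicator {x..y} z *\<^sub>R g z) * (indicator {x..y} z *\<^sub>R f z)) = (\<lambda>z. indicator {x..y} z *\<^sub>R (g z * f z))"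
      by (auto simp: fun_eq_iff split: split_indicator)
    ultimately show "(\<lambda>z. indicator {x..y} z *\<^sub>R (g z * f z)) \<in> borel_measurable lborel" by metis
    have "norm (indicator {x..y} z *\<^sub>R (g z * f z)) \<le> norm (B * (indicator {x..y} z *\<^sub>R f z))" for z
    proof (cases "z \<in> {x..y}")
      case True
      then have "\<bar>g z\<bar> * \<bar>f z\<bar> \<le> \<bar>B\<bar> * \<bar>f z\<bar>" using B[OF True] by (intro mult_right_mono) auto
      then show ?thesis using True by (simp add: abs_mult)
    qed simp
    then show "AE z in lborel. norm (indicator {x..y} z *\<^sub>R (g z * f z)) \<le> norm (B * (indicator {x..y} z *\<^sub>R f z))"
      by simp
  qed
qed

lemma L1_loc_on_const: "is_interval I \<Longrightarrow> L1_loc_on I (\<lambda>_. 1)"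
  by (rule L1_loc_onI) (auto simp: set_integrable_def)

text \<open>When at most one end is accessible the function is constant, and the slope in
  \<open>s\<close> is 0.\<close>

lemma xi_fun_affine: "\<exists>c0 c1. \<forall>x. xi_fun s \<alpha> \<beta> \<gamma>l \<gamma>r x = c0 + c1 * s x"
proof (cases "\<alpha> > -\<infinity> \<and> \<beta> < \<infinity>")
  case True
  let ?d = "real_of_ereal \<beta> - real_of_ereal \<alpha>"
  have "xi_fun s \<alpha> \<beta> \<gamma>l \<gamma>r x = (\<gamma>l - (\<gamma>r - \<gamma>l) * real_of_ereal \<alpha> / ?d) + (\<gamma>r - \<gamma>l) / ?d * s x" for x
    using True by (simp add: xi_fun_def diff_divide_distrib algebra_simps)
  then show ?thesis by blast
next
  case False
  then have "\<exists>c. \<forall>x. xi_fun s \<alpha> \<beta> \<gamma>l \<gamma>r x = c" by (auto simp: xi_fun_def)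
  then show ?thesis by (metis add.right_neutral mult_zero_left)
qed

theorem proposition3p5:
  fixes l r :: ereal and I :: "real set"
    and b \<sigma> a q f s \<xi> :: "real \<Rightarrow> real"
    and x0 \<gamma>l \<gamma>r :: real and \<alpha> \<beta> :: ereal and \<mu> :: "real measure"
  assumes "l < r" and I_eq: "I = einterval l r"
    and "b \<in> borel_measurable (restrict_space borel I)"
    and "\<sigma> \<in> borel_measurable (restrict_space borel I)"
    and "\<And>x. x \<in> I \<Longrightarrow> \<sigma> x \<noteq> 0"
    and "L1_loc_on I (\<lambda>x. 1 / (\<sigma> x)\<^sup>2)"
    and "L1_loc_on I (\<lambda>x. b x / (\<sigma> x)\<^sup>2)"
    and a_eq: "a = (\<lambda>x. (\<sigma> x)\<^sup>2 / 2)"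
    and "q \<in> borel_measurable (restrict_space borel I)" and "bounded (q ` I)"
    and "f \<in> borel_measurable (restrict_space borel I)"
    and "x0 \<in> I"
    and s_eq: "s = scale_fun a b x0"
    and \<mu>_eq: "\<mu> = speed_measure I a b x0"
    and \<alpha>_eq: "\<alpha> = lim_left_end l s"
    and \<beta>_eq: "\<beta> = lim_right_end r s"
    and \<xi>_eq: "\<xi> = xi_fun s \<alpha> \<beta> \<gamma>l \<gamma>r"
    and "square_integrable \<mu> (\<lambda>x. f x - \<xi> x)"
    and "square_integrable \<mu> (\<lambda>x. q x * \<xi> x)"
  shows "\<exists>u :: real \<Rightarrow> real \<Rightarrow> real.
    (\<forall>k. (\<forall>j<k. dt_exists I ((dt ^^ j) u)) \<and> dx_exists I ((dt ^^ k) u) \<and>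
         jointly_continuous I ((dt ^^ k) u) \<and> jointly_continuous I (dx ((dt ^^ k) u))) \<and>
    (\<forall>k. pde_ae I a b q ((dt ^^ k) u)) \<and>
    (continuous_on I a \<and> continuous_on I b \<and> continuous_on I q \<longrightarrow>
       C12 I u \<and> (\<forall>t>0. \<forall>x\<in>I. pde_at a b q u t x) \<and> (\<forall>k. C12 I ((dt ^^ k) u))) \<and>
    (\<forall>t>0. square_integrable \<mu> (\<lambda>x. u t x - \<xi> x)) \<and>
    (\<alpha> > -\<infinity> \<longrightarrow> (\<forall>t>0. ((\<lambda>y. u t (real_of_ereal y)) \<longlongrightarrow> \<gamma>l) (at_right l))) \<and>
    (\<beta> < \<infinity> \<longrightarrow> (\<forall>t>0. ((\<lambda>y. u t (real_of_ereal y)) \<longlongrightarrow> \<gamma>r) (at_left r))) \<and>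
    tendsto_zero_L2 \<mu> (\<lambda>t x. u t x - f x) (at_right 0)"
proof -
  note b_meas = assms(3) and \<sigma>_meas = assms(4) and \<sigma>_nz = assms(5) and loc1 = assms(6) and loc2 = assms(7)
    and q_meas = assms(9) and q_bdd = assms(10) and x0 = assms(12) and f_L2 = assms(18) and q_L2 = assms(19)
  have open_I: "open I" by (simp add: I_eq)
  have int_I: "is_interval I"
    unfolding is_interval_1
  proof (intro ballI allI impI)
    fix p p' x assume "p \<in> I" "p' \<in> I" "p \<le> x \<and> x \<le> p'"
    then show "x \<in> I"
      using less_le_trans[of l "ereal p" "ereal x"] le_less_trans[of "ereal x" "ereal p'" r]
      by (simp add: I_eq einterval_iff)
  qed
  have a_pos: "0 < a x" if "x \<in> I" for x using \<sigma>_nz[OF that] by (simp add: a_eq)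
  define \<phi> where "\<phi> x = (LBINT z=ereal x0..ereal x. b z / a z)" for x
  define \<rho> where "\<rho> = rho a b x0"
  define m where "m x = 1 / (a x * \<rho> x)" for x
  \<comment> \<open>The factor 2 stems from \<open>a = \<sigma>^2 / 2\<close>.\<close>
  have loc_a: "L1_loc_on I (\<lambda>x. 1 / a x)" and loc_ba: "L1_loc_on I (\<lambda>x. b x / a x)"
    using L1_loc_on_continuous_mult[OF int_I loc1 continuous_on_const[of _ 2]]
      L1_loc_on_continuous_mult[OF int_I loc2 continuous_on_const[of _ 2]] by (simp_all add: a_eq mult.commute)
  have \<phi>: "primitive_on I \<phi> (\<lambda>x. b x / a x)"
    unfolding \<phi>_def by (rule interval_integral_primitive[OF int_I loc_ba x0])
  have \<rho>\<phi>: "\<rho> = (\<lambda>x. exp (- \<phi> x))" by (simp add: \<rho>_def rho_def \<phi>_def fun_eq_iff)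
  have \<rho>_cont: "continuous_on I \<rho>"
    unfolding \<rho>\<phi> by (intro continuous_intros primitive_on_continuous[OF \<phi> open_I])
  have \<rho>_pos: "0 < \<rho> x" for x by (simp add: \<rho>\<phi>)
  have \<rho>_meas: "\<rho> \<in> borel_measurable (restrict_space borel I)" by (rule borel_measurable_continuous_on_restrict[OF \<rho>_cont])
  have loc_\<rho>: "L1_loc_on I \<rho>"
    using L1_loc_on_continuous_mult[OF int_I L1_loc_on_const[OF int_I] \<rho>_cont] by simp
  have s: "primitive_on I s \<rho>"
    unfolding s_eq scale_fun_def[abs_def] \<rho>_def[symmetric] by (rule interval_integral_primitive[OF int_I loc_\<rho> x0])
  have loc_m: "L1_loc_on I m"
  proof -
    have "continuous_on I (\<lambda>x. 1 / \<rho> x)" using \<rho>_pos by (intro continuous_intros \<rho>_cont) (auto simp: less_le)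
    from L1_loc_on_continuous_mult[OF int_I loc_a this] show ?thesis by (simp add: m_def[abs_def] mult.commute)
  qed
  have m_meas: "m \<in> borel_measurable (restrict_space borel I)"
    unfolding m_def a_eq using \<sigma>_meas \<rho>_meas by measurable
  have \<mu>: "\<mu> = weighted I m" unfolding \<mu>_eq speed_measure_def weighted_def m_def \<rho>_def ..
  obtain Q where Q: "\<And>x. x \<in> I \<Longrightarrow> \<bar>q x\<bar> \<le> Q" using q_bdd by (auto simp: bounded_iff)
  have Q0: "0 \<le> Q" using Q[OF x0] by linarith
  obtain c0 c1 where \<xi>_aff: "\<And>x. \<xi> x = c0 + c1 * s x"
    unfolding \<xi>_eq using xi_fun_affine by metis
  \<comment> \<open>Since \<open>q\<close> lies between \<open>- Q\<close> and \<open>Q\<close>, the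
    shift \<open>L = Q + 1\<close> puts \<open>k = q + L\<close> between 1 and
    \<open>2 Q + 1\<close>; also \<open>Q \<ge> 0\<close> gives \<open>1 \<le> L\<close>.\<close>
  interpret ev: diffusion I m \<rho> s "\<lambda>x. q x + (Q + 1)" "2 * Q + 1" "Q + 1" "\<lambda>x. f x - \<xi> x" "\<lambda>x. q x * \<xi> x" a b q \<xi> \<phi> c0 c1
  proof unfold_locales
    show "(\<lambda>x. q x + (Q + 1)) \<in> borel_measurable (restrict_space borel I)" using q_meas by simp
    show "1 \<le> q x + (Q + 1)" "q x + (Q + 1) \<le> 2 * Q + 1" if "x \<in> I" for x using Q[OF that] by linarith+
  qed (use open_I int_I m_meas \<rho>_meas loc_m loc_\<rho> a_pos \<rho>_pos \<rho>_cont s x0 Q0 f_L2 q_L2 \<phi> \<xi>_aff in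
      \<open>auto simp: L2_def \<mu>[symmetric] m_def \<rho>\<phi>\<close>)
  have s_mono: "s x \<le> s y" if "x \<in> einterval l r" "y \<in> einterval l r" "x \<le> y" for x y
    using ev.s_mono that by (simp add: I_eq)
  have s_strict: "s x < s y" if "x \<in> I" "y \<in> I" "x < y" for x y using ev.s_strict_mono that by simp
  have left: "\<alpha> = (INF x\<in>einterval l r. ereal (s x))" "((\<lambda>y. ereal (s (real_of_ereal y))) \<longlongrightarrow> \<alpha>) (at_right l)"
    unfolding \<alpha>_eq by (rule lim_left_end_mono[OF assms(1)], rule s_mono; assumption)+
  have right: "\<beta> = (SUP x\<in>einterval l r. ereal (s x))" "((\<lambda>y. ereal (s (real_of_ereal y))) \<longlongrightarrow> \<beta>) (at_left r)"
    unfolding \<beta>_eq by (rule lim_right_end_mono[OF assms(1)], rule s_mono; assumption)+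
  have \<alpha>_le: "\<alpha> \<le> ereal (s x)" if "x \<in> I" for x
    by (rule ord_eq_le_trans[OF left(1) INF_lower[OF that[unfolded I_eq]]])
  have \<beta>_ge: "ereal (s x) \<le> \<beta>" if "x \<in> I" for x
    by (rule ord_le_eq_trans[OF SUP_upper[OF that[unfolded I_eq]] right(1)[symmetric]])
  obtain x1 where x1: "x1 \<in> I" "x0 < x1"
    using open_Icc_nhd[OF open_I x0] by (metis atLeastAtMost_iff less_imp_le less_trans order_refl subsetD)
  \<comment> \<open>Strict monotonicity between two points of \<open>I\<close> makes the denominator
    in \<open>\<xi>\<close> nonzero when both ends are accessible.\<close>
  have \<alpha>\<beta>: "\<alpha> < \<beta>"
    using le_less_trans[OF \<alpha>_le[OF x0], of "ereal (s x1)"] s_strict[OF x0 x1] \<beta>_ge[OF x1(1)]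
    by (auto intro: less_le_trans)
  have \<alpha>_real: "\<exists>A. \<alpha> = ereal A" if "\<alpha> > -\<infinity>" using that \<alpha>_le[OF x0] by (cases \<alpha>) auto
  have \<beta>_real: "\<exists>B. \<beta> = ereal B" if "\<beta> < \<infinity>" using that \<beta>_ge[OF x0] by (cases \<beta>) auto
  have \<xi>_left: "((\<lambda>y. \<xi> (real_of_ereal y)) \<longlongrightarrow> \<gamma>l) (at_right l)" if \<alpha>: "\<alpha> > -\<infinity>"
  proof -
    obtain A where A: "\<alpha> = ereal A" using \<alpha>_real[OF \<alpha>] by blast
    have sA: "((\<lambda>y. s (real_of_ereal y)) \<longlongrightarrow> A) (at_right l)" using left(2) by (simp add: A)
    show ?thesis
    proof (cases "\<beta> < \<infinity>")
      case True
      obtain B where B: "\<beta> = ereal B" using \<beta>_real[OF True] by blast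
      have "((\<lambda>y. \<gamma>l + (\<gamma>r - \<gamma>l) * ((s (real_of_ereal y) - A) / (B - A))) \<longlongrightarrow> \<gamma>l + (\<gamma>r - \<gamma>l) * ((A - A) / (B - A))) (at_right l)"
        using \<alpha>\<beta> A B by (intro tendsto_intros sA) auto
      then show ?thesis by (simp add: \<xi>_eq xi_fun_def A B)
    next
      case False
      then show ?thesis using \<alpha> by (simp add: \<xi>_eq xi_fun_def)
    qed
  qed
  have \<xi>_right: "((\<lambda>y. \<xi> (real_of_ereal y)) \<longlongrightarrow> \<gamma>r) (at_left r)" if \<beta>: "\<beta> < \<infinity>"
  proof -
    obtain B where B: "\<beta> = ereal B" using \<beta>_real[OF \<beta>] by blast
    have sB: "((\<lambda>y. s (real_of_ereal y)) \<longlongrightarrow> B) (at_left r)" using right(2) by (simp add: B)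
    show ?thesis
    proof (cases "\<alpha> > -\<infinity>")
      case True
      obtain A where A: "\<alpha> = ereal A" using \<alpha>_real[OF True] by blast
      have "((\<lambda>y. \<gamma>l + (\<gamma>r - \<gamma>l) * ((s (real_of_ereal y) - A) / (B - A))) \<longlongrightarrow> \<gamma>l + (\<gamma>r - \<gamma>l) * ((B - A) / (B - A))) (at_left r)"
        using \<alpha>\<beta> A B by (intro tendsto_intros sB) auto
      then show ?thesis using \<alpha>\<beta> by (simp add: \<xi>_eq xi_fun_def A B)
    next
      case False
      then show ?thesis using \<beta> by (simp add: \<xi>_eq xi_fun_def)
    qed
  qed
  have v_left: "((\<lambda>y. ev.v 0 t (real_of_ereal y)) \<longlongrightarrow> 0) (at_right l)" if \<alpha>: "\<alpha> > -\<infinity>" and t: "0 < t" for t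
  proof (rule tendstoI)
    fix e :: real assume e: "e > 0"
    obtain A where A: "\<alpha> = ereal A" using \<alpha>_real[OF \<alpha>] by blast
    have "bdd_below (s ` I)" using \<alpha>_le by (auto simp: A intro!: bdd_belowI2)
    \<comment> \<open>\<open>vanish\<close> gives a weak inequality; \<open>e / 2\<close> makes it
      strict.\<close>
    then obtain c where c: "c \<in> I" "\<forall>x\<in>I. x \<le> c \<longrightarrow> \<bar>ev.v 0 t x\<bar> \<le> e / 2"
      using ev.vanish_leftD[OF ev.v_vanish[OF t], of "e / 2"] e by (auto simp only: half_gt_zero)
    show "\<forall>\<^sub>F y in at_right l. dist (ev.v 0 t (real_of_ereal y)) 0 < e"
      by (rule eventually_at_right_einterval[OF c(1)[unfolded I_eq]]) (use c(2) e in \<open>force simp: I_eq\<close>)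
  qed
  have v_right: "((\<lambda>y. ev.v 0 t (real_of_ereal y)) \<longlongrightarrow> 0) (at_left r)" if \<beta>: "\<beta> < \<infinity>" and t: "0 < t" for t
  proof (rule tendstoI)
    fix e :: real assume e: "e > 0"
    obtain B where B: "\<beta> = ereal B" using \<beta>_real[OF \<beta>] by blast
    have "bdd_above (s ` I)" using \<beta>_ge by (auto simp: B intro!: bdd_aboveI2)
    then obtain c where c: "c \<in> I" "\<forall>x\<in>I. c \<le> x \<longrightarrow> \<bar>ev.v 0 t x\<bar> \<le> e / 2"
      using ev.vanish_rightD[OF ev.v_vanish[OF t], of "e / 2"] e by (auto simp only: half_gt_zero)
    show "\<forall>\<^sub>F y in at_left r. dist (ev.v 0 t (real_of_ereal y)) 0 < e"
      by (rule eventually_at_left_einterval[OF c(1)[unfolded I_eq]]) (use c(2) e in \<open>force simp: I_eq\<close>)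
  qed
  have initial: "tendsto_zero_L2 \<mu> (\<lambda>t x. ev.u t x - f x) (at_right 0)"
    unfolding tendsto_zero_L2_def
  proof
    have eq: "(\<lambda>x. ev.u t x - f x) = ev.v 0 t - (\<lambda>x. f x - \<xi> x)" for t
      by (simp add: ev.u_def fun_eq_iff)
    show "\<forall>\<^sub>F t in at_right 0. square_integrable \<mu> (\<lambda>x. ev.u t x - f x)"
      using eventually_at_right_less[of 0]
    proof eventually_elim
      fix t :: real assume "0 < t"
      then have "ev.v 0 t - (\<lambda>x. f x - \<xi> x) \<in> L2 (weighted I m)" by (intro L2.S_diff ev.v_L2 ev.g_L2)
      then show "square_integrable \<mu> (\<lambda>x. ev.u t x - f x)" unfolding eq \<mu> L2_def by (rule CollectD)
    qed
    show "((\<lambda>t. L2_norm_on \<mu> (\<lambda>x. ev.u t x - f x)) \<longlongrightarrow> 0) (at_right 0)"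
      unfolding eq \<mu> L2_nrm_eq[symmetric] by (rule ev.v_initial)
  qed
  show ?thesis
  proof (rule exI[of _ ev.u], intro conjI)
    show "\<forall>k. (\<forall>j<k. dt_exists I ((dt ^^ j) ev.u)) \<and> dx_exists I ((dt ^^ k) ev.u) \<and>
         jointly_continuous I ((dt ^^ k) ev.u) \<and> jointly_continuous I (dx ((dt ^^ k) ev.u))"
      by (simp add: ev.dt_exists_U ev.dx_exists_U ev.U_joint ev.dx_U_joint)
    show "\<forall>k. pde_ae I a b q ((dt ^^ k) ev.u)"
      by (simp add: ev.pde_ae_U)
    show "continuous_on I a \<and> continuous_on I b \<and> continuous_on I q \<longrightarrow>
       C12 I ev.u \<and> (\<forall>t>0. \<forall>x\<in>I. pde_at a b q ev.u t x) \<and> (\<forall>k. C12 I ((dt ^^ k) ev.u))"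
      using ev.C12_U[of 0] ev.pde_at_U[where j = 0] ev.C12_U by simp
    show "\<forall>t>0. square_integrable \<mu> (\<lambda>x. ev.u t x - \<xi> x)"
      using ev.v_L2[of _ 0] by (simp add: ev.u_def L2_def \<mu>)
    show "\<alpha> > -\<infinity> \<longrightarrow> (\<forall>t>0. ((\<lambda>y. ev.u t (real_of_ereal y)) \<longlongrightarrow> \<gamma>l) (at_right l))"
      unfolding ev.u_def using tendsto_add[OF \<xi>_left v_left] by simp
    show "\<beta> < \<infinity> \<longrightarrow> (\<forall>t>0. ((\<lambda>y. ev.u t (real_of_ereal y)) \<longlongrightarrow> \<gamma>r) (at_left r))"
      unfolding ev.u_def using tendsto_add[OF \<xi>_right v_right] by simp
    show "tendsto_zero_L2 \<mu> (\<lambda>t x. ev.u t x - f x) (at_right 0)" by (rule initial)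
  qed
qed

end
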